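(* Let $n\ge1$. An $\mathbb N^*$-pair $(T,\mathcal J)$ is a primitive $\mathbb N^n$-pair if and only if $(T,\mathcal J)$ is generated by a weighted tree with $n$ tops.
   Context: $\mathbb N=\mathbb Z_{\ge 0}$. For $n\ge1$, an $\mathbb N^n$-pair is a pair $(T,\mathcal J)$ of subsets of $\mathbb N^n$ such that every element of $\mathbb N^n$ can be written in exactly one way as $t+s$ with $t\in T$, $s\in\mathcal J$. An $\mathbb N^*$-pair is an $\mathbb N^n$-pair for some $n\ge1$. The Cartesian product of an $\mathbb N^p$-pair $(I_1,J_1)$ and an $\mathbb N^q$-pair $(I_2,J_2)$ ($p,q\ge1$) is $(I_1\times I_2,J_1\times J_2)$. An $\mathbb N^n$-pair is primitive if it is not, up to a simultaneous permutation of the $n$ coordinates of both sets, a Cartesian product of two $\mathbb N^*$-pairs of lower dimensions. All $\mathbb N$-pairs are primitive. For $A\subset\mathbb N^n$ put $A(x)=\sum_{a\in A}x_1^{a_1}\cdots x_n^{a_n}$; sets are identified with these power series. For $\boldsymbol a\in(\mathbb N\setminus\{0\})^p$, $L_{\boldsymbol a}=\mathbb N^p\setminus(\mathbb N^p+\boldsymbol a)$, and $L_{\boldsymbol a}^{\delta}(\cdot)$ denotes the $\delta$-th power of its power series ($\delta\in\{0,1\}$). An interval pair of size $N\ge1$ is a pair $(C,D)$ of subsets of $\{0,\dots,N-1\}$ such that $C+D=\{0,\dots,N-1\}$ with every element uniquely of the form $c+d$, $c\in C$, $d\in D$ (size $1$ gives $(\{0\},\{0\})$). Weighted trees. Let $(V,\Gamma)$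 be a finite tree with root $\phi$. Offspring, parent and ancestor are understood with respect to the root; a top is a node without offspring, and $V_0$ is the set of tops. Every node which is not a top is assumed to have at least two offspring. (The tree consisting of $\phi$ alone has the single top $\phi$.) A weight is a quadruple $((T_0,\mathcal J_0),\boldsymbol\delta,\boldsymbol\alpha,\Phi)$, where $(T_0,\mathcal J_0)$ is an $\mathbb N$-pair (the initial pair), $\boldsymbol\delta:V\setminus V_0\to\{0,1\}$, $\boldsymbol\alpha:V\setminus\{\phi\}\to\mathbb N\setminus\{0\}$, $\Phi:V\setminus\{\phi\}\to\{\text{interval pairs}\}$, and, if $\phi$ is not a top, $\boldsymbol\delta_\phi=1$ when $T_0=\{0\}$ and $\boldsymbol\delta_\phi=0$ when $\mathcal J_0=\{0\}$. Generated pair. Nodes are used as variables; enumerating the $n$ tops as $x_1,\dots,x_n$ (in any order), the generated pair is a pair of subsets of $\mathbb N^n$, defined by induction on $\#V-\#V_0$. If $V=\{\phi\}$, it is $(T_0,\mathcal J_0)$. Otherwise choose a non-top node $z_1$ all of whose offspring are tops; reorder the tops so that these offspring are $x_1,\dots,x_p$. Delete the nodes $x_1,\dots,x_p$ and the edges joining them to $z_1$; the resulting tree has tops $z_1,x_{p+1},\dots,x_n$, and, with the restricted weight, generates a pair $(\widetilde T,\widetilde{\mathcal J})$ in the variables $(z_1,\bar x)$, $\bar x=(x_{p+1},\dots,x_n)$. Let $\delta=\boldsymbol\delta_{z_1}$, $a_j=\boldsymbol\alpha_{x_j}$, $\boldsymbol a=(a_1,\dots,a_p)$, $\Phi_{x_j}=(C_j,D_j)$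 of size $N_j$. Then the generated pair $(T,\mathcal J)$ is $$T(x)=\Big(\prod_{j=1}^pC_j(x_j)\Big)L_{\boldsymbol a}^{\delta}(x_1^{N_1},\dots,x_p^{N_p})\,\widetilde T\Big(\prod_{j=1}^px_j^{a_jN_j},\bar x\Big),$$ $$\mathcal J(x)=\Big(\prod_{j=1}^pD_j(x_j)\Big)L_{\boldsymbol a}^{1-\delta}(x_1^{N_1},\dots,x_p^{N_p})\,\widetilde{\mathcal J}\Big(\prod_{j=1}^px_j^{a_jN_j},\bar x\Big).$$ A pair is generated by the weighted tree if it arises by this procedure (for some choices of nodes $z_1$ and some enumeration of the tops). *)

theory Defs
  imports Main "HOL-Library.Poly_Mapping" "HOL-Combinatorics.Permutations"
begin

section \<open>Exponent vectors\<close>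

text \<open>
  A vector with entries in the naturals, indexed by a finite set \<open>I\<close>, is a finitely supported
  function vanishing outside \<open>I\<close>. The set \<open>\<nat>\<^sup>n\<close> is \<open>vecs {..<n}\<close>: the coordinates are
  numbered from \<open>0\<close>.
\<close>

definition vecs :: "'i set \<Rightarrow> ('i \<Rightarrow>\<^sub>0 nat) set" where
  "vecs I = {u. Poly_Mapping.keys u \<subseteq> I}"

text \<open>
  The monomial obtained from \<open>x\<^sup>u\<close> by substituting for every variable \<open>x\<^sub>i\<close> the monomial with
  exponent \<open>\<sigma> i\<close>.
\<close>

definition expo_subst :: "('i \<Rightarrow> ('j \<Rightarrow>\<^sub>0 nat)) \<Rightarrow> ('i \<Rightarrow>\<^sub>0 nat) \<Rightarrow> ('j \<Rightarrow>\<^sub>0 nat)" where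
  "expo_subst \<sigma> u = (\<Sum>i\<in>Poly_Mapping.keys u. Poly_Mapping.map (\<lambda>k. Poly_Mapping.lookup u i * k) (\<sigma> i))"

definition rename :: "('i \<Rightarrow> 'j) \<Rightarrow> ('i \<Rightarrow>\<^sub>0 nat) \<Rightarrow> ('j \<Rightarrow>\<^sub>0 nat)" where
  "rename f = expo_subst (\<lambda>i. Poly_Mapping.single (f i) 1)"


section \<open>Pairs and primitive pairs\<close>

definition npair :: "nat \<Rightarrow> (nat \<Rightarrow>\<^sub>0 nat) set \<Rightarrow> (nat \<Rightarrow>\<^sub>0 nat) set \<Rightarrow> bool" where
  "npair n T J \<longleftrightarrow> T \<subseteq> vecs {..<n} \<and> J \<subseteq> vecs {..<n} \<and>
     (\<forall>m\<in>vecs {..<n}. \<exists>!p. p \<in> T \<times> J \<and> m = fst p + snd p)"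

definition nstar_pair :: "(nat \<Rightarrow>\<^sub>0 nat) set \<Rightarrow> (nat \<Rightarrow>\<^sub>0 nat) set \<Rightarrow> bool" where
  "nstar_pair T J \<longleftrightarrow> (\<exists>n\<ge>1. npair n T J)"

text \<open>
  For \<open>A \<subseteq> \<nat>\<^sup>p\<close> and \<open>B \<subseteq> \<nat>\<^sup>q\<close> the Cartesian product, as a subset of \<open>\<nat>\<^sup>p\<^sup>+\<^sup>q\<close>: the
  coordinates \<open>0, \<dots>, q - 1\<close> of \<open>B\<close> become \<open>p, \<dots>, p + q - 1\<close>.
\<close>

definition cart :: "nat \<Rightarrow> (nat \<Rightarrow>\<^sub>0 nat) set \<Rightarrow> (nat \<Rightarrow>\<^sub>0 nat) set \<Rightarrow> (nat \<Rightarrow>\<^sub>0 nat) set" where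
  "cart p A B = {a + rename (\<lambda>i. p + i) b | a b. a \<in> A \<and> b \<in> B}"

definition primitive_pair :: "nat \<Rightarrow> (nat \<Rightarrow>\<^sub>0 nat) set \<Rightarrow> (nat \<Rightarrow>\<^sub>0 nat) set \<Rightarrow> bool" where
  "primitive_pair n T J \<longleftrightarrow> npair n T J \<and>
     \<not> (\<exists>p q I1 J1 I2 J2 \<pi>. p \<ge> 1 \<and> q \<ge> 1 \<and> p + q = n \<and>
          npair p I1 J1 \<and> npair q I2 J2 \<and> \<pi> permutes {..<n} \<and>
          T = rename \<pi> ` cart p I1 I2 \<and> J = rename \<pi> ` cart p J1 J2)"


section \<open>Formal power series in several variables\<close>

text \<open>
  Power series with integer coefficients whose variables are the elements of \<open>'v\<close>, given by their
  coefficients.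
\<close>

typedef 'v mps = "UNIV :: (('v \<Rightarrow>\<^sub>0 nat) \<Rightarrow> int) set"
  morphisms coeff Mps ..

lemma finite_antidiagonal: "finite {(k, l). k + l = (m :: 'v \<Rightarrow>\<^sub>0 nat)}"
proof -
  let ?S = "{(k, l). k + l = m}"
  have fin: "finite {f. \<forall>i. (i \<in> Poly_Mapping.keys m \<longrightarrow> f i \<in> {..Max (Poly_Mapping.lookup m ` Poly_Mapping.keys m)}) \<and> (i \<notin> Poly_Mapping.keys m \<longrightarrow> f i = 0)}"
    (is "finite ?G") by (rule finite_set_of_finite_funs) auto
  have lk: "Poly_Mapping.lookup k \<in> ?G" if "k + l = m" for k l
  proof -
    have le: "Poly_Mapping.lookup k i \<le> Poly_Mapping.lookup m i" for i
      using that by (auto simp: lookup_add)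
    have "Poly_Mapping.lookup k i \<le> Max (Poly_Mapping.lookup m ` Poly_Mapping.keys m)" if "i \<in> Poly_Mapping.keys m" for i
    proof -
      have "Poly_Mapping.lookup m i \<le> Max (Poly_Mapping.lookup m ` Poly_Mapping.keys m)" using that by (intro Max_ge) auto
      then show ?thesis using le[of i] by linarith
    qed
    moreover have "Poly_Mapping.lookup k i = 0" if "i \<notin> Poly_Mapping.keys m" for i
      using le[of i] that by (simp add: in_keys_iff)
    ultimately show ?thesis by auto
  qed
  have "inj_on (\<lambda>(k, l). (Poly_Mapping.lookup k, Poly_Mapping.lookup l)) ?S"
    by (auto simp: inj_on_def lookup_inject)
  moreover have "(\<lambda>(k, l). (Poly_Mapping.lookup k, Poly_Mapping.lookup l)) ` ?S \<subseteq> ?G \<times> ?G"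
  proof (rule image_subsetI)
    fix p assume "p \<in> ?S"
    then have "fst p + snd p = m" "snd p + fst p = m" by (auto simp: add.commute)
    from lk[OF this(1)] lk[OF this(2)]
    show "(\<lambda>(k, l). (Poly_Mapping.lookup k, Poly_Mapping.lookup l)) p \<in> ?G \<times> ?G"
      by (simp only: split_beta mem_Times_iff fst_conv snd_conv)
  qed
  ultimately show ?thesis using fin by (meson finite_SigmaI inj_on_finite)
qed

instantiation mps :: (type) comm_monoid_mult
begin

definition one_mps_def: "1 = Mps (\<lambda>m. of_bool (m = 0))"

definition times_mps_def: "f * g = Mps (\<lambda>m. \<Sum>(k, l) | k + l = m. coeff f k * coeff g l)"

instance
proof
  fix a b c :: "'a mps"
  show "a * b * c = a * (b * c)"
  proof -
    have "(\<Sum>(k, l) | k + l = m. (\<Sum>(i, j) | i + j = k. coeff a i * coeff b j) * coeff c l)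
        = (\<Sum>(i, k) | i + k = m. coeff a i * (\<Sum>(j, l) | j + l = k. coeff b j * coeff c l))"
      (is "?L = ?R") for m
    proof -
      have "?L = (\<Sum>p\<in>{(k, l). k + l = m}. \<Sum>q\<in>{(i, j). i + j = fst p}.
          coeff a (fst q) * coeff b (snd q) * coeff c (snd p))"
        by (simp add: sum_distrib_right split_beta)
      also have "\<dots> = (\<Sum>(p, q)\<in>(SIGMA p:{(k, l). k + l = m}. {(i, j). i + j = fst p}).
          coeff a (fst q) * coeff b (snd q) * coeff c (snd p))"
        by (rule sum.Sigma) (auto intro: finite_antidiagonal)
      also have "\<dots> = (\<Sum>(p, q)\<in>(SIGMA p:{(i, k). i + k = m}. {(j, l). j + l = snd p}).
          coeff a (fst p) * (coeff b (fst q) * coeff c (snd q)))"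
        by (rule sum.reindex_bij_witness[where
              i = "\<lambda>(p, q). ((fst p + fst q, snd q), (fst p, fst q))" and
              j = "\<lambda>(p, q). ((fst q, snd q + snd p), (snd q, snd p))"])
           (auto simp: add.assoc mult.assoc)
      also have "\<dots> = (\<Sum>p\<in>{(i, k). i + k = m}. \<Sum>q\<in>{(j, l). j + l = snd p}.
          coeff a (fst p) * (coeff b (fst q) * coeff c (snd q)))"
        by (rule sum.Sigma[symmetric]) (auto intro: finite_antidiagonal)
      also have "\<dots> = ?R"
        by (simp add: sum_distrib_left split_beta)
      finally show ?thesis .
    qed
    then show ?thesis by (simp add: times_mps_def Mps_inverse)
  qed
  show "a * b = b * a"
  proof -
    have "(\<Sum>(k, l) | k + l = m. coeff a k * coeff b l)
        = (\<Sum>(k, l) | k + l = m. coeff b k * coeff a l)" for m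
      by (rule sum.reindex_bij_witness[where i = prod.swap and j = prod.swap])
         (auto simp: add.commute mult.commute)
    then show ?thesis by (simp add: times_mps_def)
  qed
  show "1 * a = a"
  proof -
    have "(\<Sum>(k, l) | k + l = m. of_bool (k = 0) * coeff a l) = coeff a m" for m
    proof -
      have "(\<Sum>(k, l) | k + l = m. of_bool (k = 0) * coeff a l)
          = (\<Sum>(k, l)\<in>{(0 :: 'a \<Rightarrow>\<^sub>0 nat, m)}. of_bool (k = 0) * coeff a l)"
        by (rule sum.mono_neutral_right) (auto intro: finite_antidiagonal)
      then show ?thesis by simp
    qed
    then show ?thesis by (simp add: times_mps_def one_mps_def Mps_inverse coeff_inverse)
  qed
qed

end

text \<open>The power series \<open>A(x)\<close> of a set of exponent vectors.\<close>

definition series :: "('v \<Rightarrow>\<^sub>0 nat) set \<Rightarrow> 'v mps" where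
  "series A = Mps (\<lambda>m. of_bool (m \<in> A))"

definition series1 :: "nat set \<Rightarrow> 'v \<Rightarrow> 'v mps" where
  "series1 C x = series (Poly_Mapping.single x ` C)"

text \<open>
  Substitution of the monomials with exponents \<open>\<sigma> i\<close> for the variables. The sum is finite
  whenever \<open>\<sigma> i \<noteq> 0\<close> for the finitely many variables \<open>i\<close> occurring in \<open>f\<close>, which is the case for
  all substitutions below.
\<close>

definition mps_subst :: "('v \<Rightarrow> ('w \<Rightarrow>\<^sub>0 nat)) \<Rightarrow> 'v mps \<Rightarrow> 'w mps" where
  "mps_subst \<sigma> f = Mps (\<lambda>m. \<Sum>u | coeff f u \<noteq> 0 \<and> expo_subst \<sigma> u = m. coeff f u)"

text \<open>The set \<open>L\<^sub>a\<close> in the variables \<open>X\<close>.\<close>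

definition Lset :: "'v set \<Rightarrow> ('v \<Rightarrow> nat) \<Rightarrow> ('v \<Rightarrow>\<^sub>0 nat) set" where
  "Lset X a = vecs X - (\<lambda>u. u + (\<Sum>x\<in>X. Poly_Mapping.single x (a x))) ` vecs X"


section \<open>Weighted trees\<close>

definition interval_pair :: "nat \<Rightarrow> nat set \<times> nat set \<Rightarrow> bool" where
  "interval_pair N P \<longleftrightarrow> N \<ge> 1 \<and> fst P \<subseteq> {..<N} \<and> snd P \<subseteq> {..<N} \<and>
     {c + d | c d. c \<in> fst P \<and> d \<in> snd P} = {..<N} \<and>
     (\<forall>m<N. \<exists>!p. p \<in> fst P \<times> snd P \<and> m = fst p + snd p)"

text \<open>
  A finite rooted tree is given by its nodes, its root and its edges, each edge being oriented
  from the parent to the offspring.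
\<close>

definition rooted_tree :: "'v set \<Rightarrow> ('v \<times> 'v) set \<Rightarrow> 'v \<Rightarrow> bool" where
  "rooted_tree V \<Gamma> \<phi> \<longleftrightarrow> finite V \<and> \<phi> \<in> V \<and> \<Gamma> \<subseteq> V \<times> V \<and>
     (\<forall>u. (u, \<phi>) \<notin> \<Gamma>) \<and> (\<forall>v\<in>V - {\<phi>}. \<exists>!u. (u, v) \<in> \<Gamma>) \<and> (\<forall>v\<in>V. (\<phi>, v) \<in> \<Gamma>\<^sup>*)"

definition offspring :: "('v \<times> 'v) set \<Rightarrow> 'v \<Rightarrow> 'v set" where
  "offspring \<Gamma> v = {w. (v, w) \<in> \<Gamma>}"

definition tops :: "'v set \<Rightarrow> ('v \<times> 'v) set \<Rightarrow> 'v set" where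
  "tops V \<Gamma> = {v \<in> V. offspring \<Gamma> v = {}}"

record 'v weight =
  initT :: "(nat \<Rightarrow>\<^sub>0 nat) set"
  initJ :: "(nat \<Rightarrow>\<^sub>0 nat) set"
  delta :: "'v \<Rightarrow> nat"
  alpha :: "'v \<Rightarrow> nat"
  Phi :: "'v \<Rightarrow> nat set \<times> nat set"

definition weighted_tree :: "'v set \<Rightarrow> ('v \<times> 'v) set \<Rightarrow> 'v \<Rightarrow> 'v weight \<Rightarrow> bool" where
  "weighted_tree V \<Gamma> \<phi> w \<longleftrightarrow> rooted_tree V \<Gamma> \<phi> \<and>
     (\<forall>v\<in>V - tops V \<Gamma>. card (offspring \<Gamma> v) \<ge> 2) \<and>
     npair 1 (initT w) (initJ w) \<and>
     (\<forall>v\<in>V - tops V \<Gamma>. delta w v \<in> {0, 1}) \<and>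
     (\<forall>v\<in>V - {\<phi>}. alpha w v \<ge> 1) \<and>
     (\<forall>v\<in>V - {\<phi>}. \<exists>N. interval_pair N (Phi w v)) \<and>
     (\<phi> \<notin> tops V \<Gamma> \<longrightarrow>
        (initT w = {0} \<longrightarrow> delta w \<phi> = 1) \<and> (initJ w = {0} \<longrightarrow> delta w \<phi> = 0))"


section \<open>The generated pair\<close>

text \<open>
  \<open>generates \<phi> w V \<Gamma> T J\<close>: the tree \<open>(V, \<Gamma>)\<close> with root \<open>\<phi>\<close> and weight \<open>w\<close> generates
  \<open>(T, J)\<close>, where the nodes serve as variables, so that \<open>T\<close> and \<open>J\<close> are subsets of
  \<open>vecs (tops V \<Gamma>)\<close>. The components of \<open>w\<close> are total functions, so restricting the weight to a
  subtree leaves them unchanged.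
\<close>

inductive generates ::
  "'v \<Rightarrow> 'v weight \<Rightarrow> 'v set \<Rightarrow> ('v \<times> 'v) set \<Rightarrow> ('v \<Rightarrow>\<^sub>0 nat) set \<Rightarrow> ('v \<Rightarrow>\<^sub>0 nat) set \<Rightarrow> bool"
  for \<phi> :: 'v and w :: "'v weight"
where
  root: "generates \<phi> w {\<phi>} {} (rename (\<lambda>_. \<phi>) ` initT w) (rename (\<lambda>_. \<phi>) ` initJ w)"
| step: "generates \<phi> w V \<Gamma> T J"
  if "z \<in> V - tops V \<Gamma>" and "X = offspring \<Gamma> z" and "X \<subseteq> tops V \<Gamma>"
    and "generates \<phi> w (V - X) (\<Gamma> - {z} \<times> X) T' J'"
    and "\<forall>x\<in>X. interval_pair (N x) (Phi w x)"
    and "\<sigma> = (\<lambda>y. if y = z then \<Sum>x\<in>X. Poly_Mapping.single x (alpha w x * N x)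
                  else Poly_Mapping.single y 1)"
    and "series T = (\<Prod>x\<in>X. series1 (fst (Phi w x)) x) *
           mps_subst (\<lambda>x. Poly_Mapping.single x (N x)) (series (Lset X (alpha w)) ^ delta w z) *
           mps_subst \<sigma> (series T')"
    and "series J = (\<Prod>x\<in>X. series1 (snd (Phi w x)) x) *
           mps_subst (\<lambda>x. Poly_Mapping.single x (N x)) (series (Lset X (alpha w)) ^ (1 - delta w z)) *
           mps_subst \<sigma> (series J')"

text \<open>
  The bijection \<open>e\<close> is the enumeration of the tops. Since trees are finite, it is no restriction
  to take natural numbers as nodes.
\<close>

definition tree_generated :: "nat \<Rightarrow> (nat \<Rightarrow>\<^sub>0 nat) set \<Rightarrow> (nat \<Rightarrow>\<^sub>0 nat) set \<Rightarrow> bool" where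
  "tree_generated n T J \<longleftrightarrow>
     (\<exists>(V :: nat set) \<Gamma> \<phi> w T' J' e. weighted_tree V \<Gamma> \<phi> w \<and> card (tops V \<Gamma>) = n \<and>
        generates \<phi> w V \<Gamma> T' J' \<and> bij_betw e (tops V \<Gamma>) {..<n} \<and>
        T = rename e ` T' \<and> J = rename e ` J')"

end

theory Submission
  imports Defs
begin

text \<open>
  Two observations drive the proof. First, a complementing set is determined by the other one, so a
  pair is a Cartesian product along a partition of the coordinates as soon as one of the two sets
  is. Second, if \<open>L\<^sub>a\<close>, placed in the face of the coordinates \<open>X\<close>, is contained in \<open>T\<close> while \<open>a\<close>
  itself lies in \<open>J\<close>, then \<open>T\<close> is the direct sum of \<open>L\<^sub>a\<close> and a set of vectors whose \<open>X\<close>-part is a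
  multiple of \<open>a\<close>, and the \<open>X\<close>-parts of \<open>J\<close> are multiples of \<open>a\<close> (division lemma).

  For \<open>X = {i}\<close> the division lemma splits off digits on the \<open>i\<close>-th axis. If this can be repeated
  forever, the pair is a product along \<open>{i}\<close>; so for a primitive pair in dimension at least two it
  stops, with every axis contained in one of the two sets. In a minimal face \<open>X\<close> that consists of
  axes of \<open>T\<close> but is not contained in \<open>T\<close>, the nonzero elements of \<open>J\<close> have full support and are
  totally ordered in all coordinates strictly, and the division lemma applies to the smallest one.
  The quotient has \<open>|X| - 1\<close> coordinates fewer, and is again primitive.
\<close>

section \<open>Vectors\<close>

text \<open>One application of the division lemma undoes one generation step: the coordinates X are
  exchanged for a single new coordinate z, and induction runs on the number of coordinates. As the
  index set changes with every step, the work is done over arbitrary finite index sets, where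
  primitivity means that no proper nonempty P splits both sets (\<open>indecomposable\<close>). That
  generation preserves primitivity comes down to whether a partition of the coordinates can cut
  through X. In the set that does not receive \<open>L_a\<close>, the X-parts are multiples of a up
  to scaling and digits, so one of its vectors with positive z-part blocks every such cut. In
  dimension at least two primitivity supplies such a vector; over the bare root it must come from
  the initial pair, which is why the weight ties \<delta> at the root to T_0 and J_0. Digits have to
  be split off on all axes before a face can be found, yet one step may remove them on X only. Those
  on the other axes are put back and wait for the recursion.\<close>

abbreviation entry :: "('v \<Rightarrow>\<^sub>0 nat) \<Rightarrow> 'v \<Rightarrow> nat" where
  "entry \<equiv> Poly_Mapping.lookup"

abbreviation unit_vec :: "'v \<Rightarrow> nat \<Rightarrow> ('v \<Rightarrow>\<^sub>0 nat)" where
  "unit_vec \<equiv> Poly_Mapping.single"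

definition vec :: "'v set \<Rightarrow> ('v \<Rightarrow> nat) \<Rightarrow> ('v \<Rightarrow>\<^sub>0 nat)" where
  "vec I f = Abs_poly_mapping (\<lambda>i. if i \<in> I then f i else 0)"

definition restr :: "'v set \<Rightarrow> ('v \<Rightarrow>\<^sub>0 nat) \<Rightarrow> ('v \<Rightarrow>\<^sub>0 nat)" where
  "restr P u = Abs_poly_mapping (\<lambda>i. if i \<in> P then entry u i else 0)"

lemma entry_vec:
  assumes "finite I"
  shows "entry (vec I f) i = (if i \<in> I then f i else 0)"
  unfolding vec_def
  by (subst Abs_poly_mapping_inverse) (use assms in \<open>auto intro: finite_subset[of _ I]\<close>)

lemma entry_restr [simp]: "entry (restr P u) i = (if i \<in> P then entry u i else 0)"
  unfolding restr_def
  by (subst Abs_poly_mapping_inverse)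
    (auto intro: finite_subset[OF _ finite_keys[of u]] simp: in_keys_iff)

lemma vecs_iff: "u \<in> vecs I \<longleftrightarrow> (\<forall>i. i \<notin> I \<longrightarrow> entry u i = 0)"
  by (auto simp: vecs_def in_keys_iff)

lemma vecs_entry: "u \<in> vecs I \<Longrightarrow> i \<notin> I \<Longrightarrow> entry u i = 0"
  by (simp add: vecs_iff)

lemma vecs_eqI: "u \<in> vecs I \<Longrightarrow> v \<in> vecs I \<Longrightarrow> (\<And>i. i \<in> I \<Longrightarrow> entry u i = entry v i) \<Longrightarrow> u = v"
  by (rule poly_mapping_eqI) (metis vecs_iff)

lemma vecs_add [simp]: "u + v \<in> vecs I \<longleftrightarrow> u \<in> vecs I \<and> v \<in> vecs I"
  by (auto simp: vecs_iff lookup_add)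

lemma vecs_zero [simp]: "0 \<in> vecs I"
  by (simp add: vecs_iff)

lemma vecs_vec [simp]: "finite I \<Longrightarrow> I \<subseteq> K \<Longrightarrow> vec I f \<in> vecs K"
  by (auto simp: vecs_iff entry_vec)

lemma vecs_mono: "u \<in> vecs I \<Longrightarrow> I \<subseteq> K \<Longrightarrow> u \<in> vecs K"
  by (auto simp: vecs_iff)

lemma vecs_single [simp]: "i \<in> I \<Longrightarrow> unit_vec i k \<in> vecs I"
  by (auto simp: vecs_iff lookup_single when_def)

lemma vec_entry: "finite I \<Longrightarrow> u \<in> vecs I \<Longrightarrow> vec I (entry u) = u"
  by (rule poly_mapping_eqI) (auto simp: entry_vec vecs_iff)

lemma vec_add_zero_iff [simp]: "u + v = 0 \<longleftrightarrow> u = 0 \<and> (v :: 'v \<Rightarrow>\<^sub>0 nat) = 0"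
  by (auto simp: poly_mapping_eq_iff fun_eq_iff lookup_add)

definition deg :: "('v \<Rightarrow>\<^sub>0 nat) \<Rightarrow> nat" where
  "deg u = sum (entry u) (Poly_Mapping.keys u)"

lemma deg_alt: "finite I \<Longrightarrow> u \<in> vecs I \<Longrightarrow> deg u = sum (entry u) I"
  unfolding deg_def by (rule sum.mono_neutral_left) (auto simp: vecs_def in_keys_iff)

lemma deg_add [simp]: "deg (u + v) = deg u + deg v"
proof -
  let ?I = "Poly_Mapping.keys u \<union> Poly_Mapping.keys v"
  have "u \<in> vecs ?I" "v \<in> vecs ?I" "u + v \<in> vecs ?I" "finite ?I"
    by (auto simp: vecs_def in_keys_iff lookup_add simp del: vecs_add)
  then show ?thesis by (simp add: deg_alt[of ?I] lookup_add sum.distrib del: vecs_add)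
qed

lemma deg_eq_0 [simp]: "deg u = 0 \<longleftrightarrow> u = 0"
  by (auto simp: deg_def in_keys_iff poly_mapping_eq_iff fun_eq_iff)

lemma deg_pos: "u \<noteq> 0 \<Longrightarrow> deg u > 0"
  using deg_eq_0 by blast

lemma restr_add: "restr P (u + v) = restr P u + restr P v"
  by (rule poly_mapping_eqI) (simp add: lookup_add)

lemma restr_split: "u \<in> vecs I \<Longrightarrow> u = restr P u + restr (I - P) u"
  by (rule poly_mapping_eqI) (auto simp: lookup_add vecs_iff)

section \<open>Complementing pairs\<close>

text \<open>The index set is arbitrary so that nodes of a tree can be coordinates and a node can be
  exchanged for its offspring; \<open>npair n\<close> is the case \<open>{..<n}\<close>.\<close>

locale complementing =
  fixes I :: "'v set" and T J :: "('v \<Rightarrow>\<^sub>0 nat) set"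
  assumes fin: "finite I"
    and subT: "T \<subseteq> vecs I" and subJ: "J \<subseteq> vecs I"
    and ex: "\<And>u. u \<in> vecs I \<Longrightarrow> \<exists>t\<in>T. \<exists>j\<in>J. u = t + j"
    and uniq: "\<And>t j t' j'. t \<in> T \<Longrightarrow> j \<in> J \<Longrightarrow> t' \<in> T \<Longrightarrow> j' \<in> J \<Longrightarrow> t + j = t' + j' \<Longrightarrow> t = t' \<and> j = j'"
begin

lemma swap: "complementing I J T"
proof
  show "\<exists>t\<in>J. \<exists>j\<in>T. u = t + j" if "u \<in> vecs I" for u
    using ex[OF that] by (metis add.commute)
  show "t = t' \<and> j = j'" if "t \<in> J" "j \<in> T" "t' \<in> J" "j' \<in> T" "t + j = t' + j'" for t j t' j'
    using uniq[of j t j' t'] that by (simp add: add.commute)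
qed (use fin subT subJ in auto)

lemma zero: "0 \<in> T" "0 \<in> J"
  using ex[of 0] by (metis vec_add_zero_iff vecs_zero)+

lemma inter: "u \<in> T \<Longrightarrow> u \<in> J \<Longrightarrow> u = 0"
  using uniq[of u 0 0 u] zero by auto

lemma in_T_unless:
  assumes "u \<in> vecs I" and "\<And>t j. t \<in> T \<Longrightarrow> j \<in> J \<Longrightarrow> u = t + j \<Longrightarrow> j = 0"
  shows "u \<in> T"
  using ex[OF assms(1)] assms(2) by (metis add.right_neutral)

lemma not_in_T: "t \<in> T \<Longrightarrow> j \<in> J \<Longrightarrow> j \<noteq> 0 \<Longrightarrow> t + j \<notin> T"
  using uniq[of t j "t + j" 0] zero by auto

lemma not_in_J: "t \<in> T \<Longrightarrow> j \<in> J \<Longrightarrow> t \<noteq> 0 \<Longrightarrow> t + j \<notin> J"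
  using uniq[of t j 0 "t + j"] zero by auto

lemma inT: "u \<in> T \<longleftrightarrow> u \<in> vecs I \<and> (\<forall>t\<in>T. \<forall>j\<in>J. u = t + j \<longrightarrow> j = 0)"
  using in_T_unless[of u] not_in_T subT by blast

end

text \<open>By \<open>inT\<close>, membership of \<open>u\<close> depends only on J and on those
  elements \<open>t\<close> of the set with \<open>u = t + j\<close> and \<open>j\<close> nonzero.
  They have smaller degree, so T is recursively determined by J.\<close>

lemma complementing_complement_unique:
  assumes "complementing I T J" "complementing I T' J"
  shows "T = T'"
proof -
  interpret A: complementing I T J by fact
  interpret B: complementing I T' J by fact
  have "u \<in> T \<longleftrightarrow> u \<in> T'" for u
  proof (induction "deg u" arbitrary: u rule: less_induct)
    case less
    have "t \<in> T \<longleftrightarrow> t \<in> T'" if "u = t + j" "j \<noteq> 0" for t j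
      using less that deg_pos[of j] by simp
    then show ?case unfolding A.inT[of u] B.inT[of u] by blast
  qed
  then show ?thesis by blast
qed

text \<open>A Cartesian product along P and \<open>I - P\<close>, expressed without renumbering the
  coordinates; \<open>splits_sum\<close> recovers the form as a sum.\<close>

definition splits :: "'v set \<Rightarrow> 'v set \<Rightarrow> ('v \<Rightarrow>\<^sub>0 nat) set \<Rightarrow> bool" where
  "splits I P T \<longleftrightarrow> (\<forall>u\<in>vecs I. u \<in> T \<longleftrightarrow> restr P u \<in> T \<and> restr (I - P) u \<in> T)"

lemma splits_compl: "P \<subseteq> I \<Longrightarrow> splits I (I - P) T \<longleftrightarrow> splits I P T"
  by (auto simp: splits_def double_diff)

text \<open>The set \<open>?T\<close> put together from the traces of T on the two faces also
  complements J: the two faces can be decomposed separately, and J contains the sum of the two parts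
  because it splits. Uniqueness of the complement yields \<open>?T = T\<close>.\<close>

lemma (in complementing) splits_T:
  assumes P: "P \<subseteq> I" and J: "splits I P J"
  shows "splits I P T"
proof -
  let ?Q = "I - P"
  let ?T = "{u\<in>vecs I. restr P u \<in> T \<and> restr ?Q u \<in> T}"
  have "complementing I ?T J"
  proof
    show "\<exists>t\<in>?T. \<exists>j\<in>J. u = t + j" if u: "u \<in> vecs I" for u
    proof -
      have "restr P u \<in> vecs I" "restr ?Q u \<in> vecs I"
        using u by (auto simp: vecs_iff)
      then obtain t1 j1 t2 j2 where
        h: "t1 \<in> T" "j1 \<in> J" "restr P u = t1 + j1" "t2 \<in> T" "j2 \<in> J" "restr ?Q u = t2 + j2"
        using ex by metis
      have s: "entry t1 i = 0 \<and> entry j1 i = 0" if "i \<notin> P" for i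
        using arg_cong[OF h(3), of "\<lambda>x. entry x i"] that by (simp add: lookup_add)
      have s2: "entry t2 i = 0 \<and> entry j2 i = 0" if "i \<notin> ?Q" for i
        using arg_cong[OF h(6), of "\<lambda>x. entry x i"] that by (simp add: lookup_add split: if_splits)
      have r: "restr P (t1 + t2) = t1" "restr P (j1 + j2) = j1"
        "restr ?Q (t1 + t2) = t2" "restr ?Q (j1 + j2) = j2"
        using s s2 by (auto intro!: poly_mapping_eqI simp: lookup_add)
      have v: "t1 + t2 \<in> vecs I" "j1 + j2 \<in> vecs I" using h subT subJ by auto
      have "t1 + t2 \<in> ?T" using r v h by simp
      moreover have "j1 + j2 \<in> J"
        using J[unfolded splits_def, rule_format, OF v(2)] r h by simp
      moreover have "u = (t1 + t2) + (j1 + j2)"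
        using restr_split[OF u, of P] h by (simp add: ac_simps)
      ultimately show ?thesis by blast
    qed
    show "t = t' \<and> j = j'" if h: "t \<in> ?T" "j \<in> J" "t' \<in> ?T" "j' \<in> J" "t + j = t' + j'" for t j t' j'
    proof -
      have v: "t \<in> vecs I" "t' \<in> vecs I" "j \<in> vecs I" "j' \<in> vecs I" using h subJ by auto
      have jj: "restr P j \<in> J" "restr ?Q j \<in> J" "restr P j' \<in> J" "restr ?Q j' \<in> J"
        using J h v unfolding splits_def by blast+
      have "restr P t = restr P t' \<and> restr P j = restr P j'"
        using h jj by (intro uniq) (auto simp: restr_add[symmetric])
      moreover have "restr ?Q t = restr ?Q t' \<and> restr ?Q j = restr ?Q j'"
        using h jj by (intro uniq) (auto simp: restr_add[symmetric])
      ultimately show ?thesis using restr_split v by metis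
    qed
  qed (use fin subJ in auto)
  then have "?T = T" using complementing_complement_unique[of I ?T J T] complementing_axioms by blast
  then show ?thesis unfolding splits_def by blast
qed

text \<open>The vectors of the face \<open>X\<close> that do not dominate \<open>a\<close> form the set \<open>L\<^sub>a\<close>.\<close>

lemma (in complementing) division:
  assumes X: "X \<subseteq> I" "X \<noteq> {}" and a: "\<And>x. x \<in> X \<Longrightarrow> a x \<ge> 1"
    and L: "\<And>v. v \<in> vecs X \<Longrightarrow> \<exists>x\<in>X. entry v x < a x \<Longrightarrow> v \<in> T"
    and aJ: "vec X a \<in> J"
    and v: "v \<in> vecs X" "\<exists>x\<in>X. entry v x < a x"
    and c: "c \<in> vecs I" "\<exists>m. \<forall>x\<in>X. entry c x = m * a x"
  shows "(v + c \<in> T \<longleftrightarrow> c \<in> T) \<and> (v + c \<in> J \<longrightarrow> v = 0)"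
proof -
  have finX: "finite X" using X fin finite_subset by auto
  define L' where "L' = {v\<in>vecs X. \<exists>x\<in>X. entry v x < a x}"
  \<comment> \<open>Vectors whose X-part is a multiple of \<open>a\<close>. The aim is that J lies
    in M and that T is the direct sum of \<open>L'\<close> and its trace on M.\<close>
  define M where "M = {c\<in>vecs I. \<exists>m. \<forall>x\<in>X. entry c x = m * a x}"
  have LT: "v \<in> L' \<Longrightarrow> v \<in> T" for v using L by (auto simp: L'_def)
  have L0: "0 \<in> L'" using X a by (fastforce simp: L'_def)
  have LI: "v \<in> L' \<Longrightarrow> v \<in> vecs I" for v using X by (auto simp: L'_def intro: vecs_mono)
  have split: "\<exists>v\<in>L'. \<exists>c\<in>M. u = v + c" if u: "u \<in> vecs I" for u
  proof -
    \<comment> \<open>The largest multiple of \<open>a\<close> that fits below \<open>u\<close> on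
      X. A coordinate where the minimum is attained shows that the remainder does not dominate
      \<open>a\<close>.\<close>
    define m where "m = Min ((\<lambda>x. entry u x div a x) ` X)"
    have m: "m \<le> entry u x div a x" if "x \<in> X" for x
      unfolding m_def using finX that by (intro Min_le) auto
    have "m \<in> (\<lambda>x. entry u x div a x) ` X"
      unfolding m_def using finX X by (intro Min_in) auto
    then obtain x0 where x0: "x0 \<in> X" "m = entry u x0 div a x0" by auto
    define c where "c = vec I (\<lambda>x. if x \<in> X then m * a x else entry u x)"
    define v where "v = vec X (\<lambda>x. entry u x - m * a x)"
    have le: "m * a x \<le> entry u x" if "x \<in> X" for x
      using m[OF that] by (metis div_times_less_eq_dividend le_trans mult_le_mono1)
    have "entry u x0 - m * a x0 < a x0"
      using x0 a[OF x0(1)] by (simp add: minus_div_mult_eq_mod)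
    then have "v \<in> L'" using x0 finX by (auto simp: L'_def v_def entry_vec)
    moreover have "c \<in> M" using fin X by (auto simp: M_def c_def entry_vec)
    moreover have "u = v + c"
      using u X le fin finX
      by (intro poly_mapping_eqI) (auto simp: v_def c_def entry_vec lookup_add vecs_iff)
    ultimately show ?thesis by blast
  qed
  \<comment> \<open>Cancellation of \<open>j\<close>: some coordinate of \<open>v\<close> is below
    \<open>a\<close>, so the multiple of \<open>a\<close> in \<open>j\<close> cannot exceed the one
    in \<open>c\<close>. What remains of \<open>t\<close> after removing \<open>v\<close> is again
    in M.\<close>
  have diff: "\<exists>t'\<in>M. t = v + t' \<and> c = t' + j"
    if h: "v \<in> L'" "c \<in> M" "j \<in> M" "t \<in> vecs I" "v + c = t + j" for v c j t
  proof -
    from h obtain m q where m: "\<forall>x\<in>X. entry c x = m * a x" and q: "\<forall>x\<in>X. entry j x = q * a x"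
      by (auto simp: M_def)
    have e: "entry v x + entry c x = entry t x + entry j x" for x
      using h(5) by (metis lookup_add)
    have "q \<le> m"
    proof (rule ccontr)
      assume "\<not> q \<le> m"
      then have "m < q" by simp
      then obtain k where k: "q = m + Suc k" using less_imp_Suc_add by fastforce
      from h obtain x where x: "x \<in> X" "entry v x < a x" by (auto simp: L'_def)
      show False using e[of x] x m q k by (auto simp: algebra_simps)
    qed
    then obtain k where k: "m = q + k" using le_Suc_ex by blast
    define t' where "t' = vec I (\<lambda>x. if x \<in> X then k * a x else entry t x)"
    have "t' \<in> M" using X fin by (auto simp: M_def t'_def entry_vec)
    moreover have "t = v + t'"
    proof (rule poly_mapping_eqI)
      fix x
      show "entry t x = entry (v + t') x"
        using e[of x] m q k h X fin
        by (cases "x \<in> X") (auto simp: t'_def entry_vec lookup_add algebra_simps L'_def vecs_iff)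
    qed
    moreover from this have "c = t' + j" using h(5) by (simp add: add.assoc)
    ultimately show ?thesis by blast
  qed
  \<comment> \<open>The induction on the degree places all elements of J of smaller degree in M,
    which is what \<open>diff\<close> asks for.\<close>
  have main: "(u = v + c \<and> v \<in> L' \<and> c \<in> M) \<longrightarrow> (u \<in> T \<longleftrightarrow> c \<in> T) \<and> (u \<in> J \<longrightarrow> v = 0)" for u v c
  proof (induction "deg u" arbitrary: u v c rule: less_induct)
    case less
    have IHJ: "j \<in> M" if "j \<in> J" "deg j < deg u" for j
    proof -
      from that subJ obtain v c where vc: "v \<in> L'" "c \<in> M" "j = v + c" using split by blast
      then show ?thesis using less[OF that(2), of v c] that by auto
    qed
    show ?case
    proof (intro impI, elim conjE)
      assume u: "u = v + c" and v: "v \<in> L'" and c: "c \<in> M"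
      show "(u \<in> T \<longleftrightarrow> c \<in> T) \<and> (u \<in> J \<longrightarrow> v = 0)"
      proof (cases "v = 0")
        case True then show ?thesis using u by simp
      next
        case v0: False
        have cI: "c \<in> vecs I" using c by (simp add: M_def)
        have cu: "deg c < deg u" using u deg_pos[OF v0] by simp
        from ex[OF cI] obtain t j where tj: "t \<in> T" "j \<in> J" "c = t + j" by blast
        have jM: "j \<in> M" using IHJ[OF tj(2)] tj(3) cu by simp
        have "t \<in> M" using diff[OF L0 c jM, of t] tj subT by auto
        show ?thesis
        proof (cases "j = 0")
          case j0: False
          \<comment> \<open>Here \<open>c\<close> lies outside T. Adding \<open>v\<close> to the
            T-part of its decomposition gives the decomposition of \<open>u\<close>, in which
            neither summand is zero.\<close>
          have "deg (v + t) < deg u" using u tj deg_pos[OF j0] by simp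
          then have vt: "v + t \<in> T" using less[of "v + t" v t] v \<open>t \<in> M\<close> tj by simp
          have uu: "u = (v + t) + j" using u tj by (simp add: add.assoc)
          have "u \<notin> T" using not_in_T[OF vt tj(2) j0] uu by simp
          moreover have "u \<notin> J" using not_in_J[OF vt tj(2)] uu v0 by simp
          moreover have "c \<notin> T" using not_in_T[OF tj(1,2) j0] tj by simp
          ultimately show ?thesis by simp
        next
          case True
          then have cT: "c \<in> T" using tj by simp
          have uI: "u \<in> vecs I" using u cI LI[OF v] by simp
          have uJ: "u \<notin> J"
          proof
            assume uJ: "u \<in> J"
            from v0 obtain i where i: "entry v i > 0"
              by (metis bot_nat_0.not_eq_extremum lookup_zero poly_mapping_eqI)
            then have iX: "i \<in> X" using v by (metis (no_types, lifting) L'_def mem_Collect_eq not_less_zero vecs_entry)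
            \<comment> \<open>Exchange trick: one unit in direction \<open>i\<close> moves from
              \<open>v\<close> to the other side. Since \<open>a\<close> minus this unit is in
              \<open>L'\<close>, hence in T, the equation \<open>(v' + c) + a = a' + u\<close>
              compares two decompositions, and uniqueness forces \<open>u\<close> to be
              \<open>a\<close>.\<close>
            define v' where "v' = v - unit_vec i 1"
            have vv: "v = v' + unit_vec i 1"
              using i by (intro poly_mapping_eqI) (auto simp: v'_def lookup_add lookup_minus lookup_single when_def)
            have v': "v' \<in> L'" using v iX unfolding vv
              by (auto simp: L'_def lookup_add) (use add_lessD1 in blast)
            define a' where "a' = vec X (\<lambda>x. if x = i then a i - 1 else a x)"
            have aa: "vec X a = a' + unit_vec i 1"
              using iX a[OF iX] finX by (intro poly_mapping_eqI) (auto simp: a'_def entry_vec lookup_add lookup_single when_def)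
            have a': "a' \<in> T" using iX a[OF iX] finX
              by (intro LT) (auto simp: L'_def a'_def entry_vec intro!: bexI[of _ i])
            have "deg (unit_vec i 1) > 0"
              by (rule deg_pos) (metis lookup_single_eq lookup_zero one_neq_zero)
            then have "v' + c \<in> T" using less[of "v' + c" v' c] v' c cT u vv by simp
            moreover have "(v' + c) + vec X a = a' + u" using u vv aa by (simp add: ac_simps)
            ultimately have "u = vec X a" using uniq[OF _ aJ a' uJ] by auto
            from c obtain m where m: "\<forall>x\<in>X. entry c x = m * a x" by (auto simp: M_def)
            have e: "a x = entry v x + m * a x" if "x \<in> X" for x
              using arg_cong[OF \<open>u = vec X a\<close>, of "\<lambda>y. entry y x"] u m that finX
              by (simp add: lookup_add entry_vec)
            \<comment> \<open>As \<open>v\<close> falls short of \<open>a\<close> at some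
              \<open>x\<close>, the equation \<open>a = v + c\<close> on X makes \<open>c\<close>
              contain \<open>a\<close> at least once. This leaves no room for \<open>v\<close> at
              \<open>i\<close>.\<close>
            from v obtain x where x: "x \<in> X" "entry v x < a x" by (auto simp: L'_def)
            have "m \<noteq> 0" using e[OF x(1)] x by (intro notI) simp
            then obtain k where "m = Suc k" by (cases m) auto
            then show False using e[OF iX] i by simp
          qed
          have "u \<in> T"
          proof (rule in_T_unless[OF uI])
            fix t j assume h: "t \<in> T" "j \<in> J" "u = t + j"
            show "j = 0"
            proof (rule ccontr)
              assume j0: "j \<noteq> 0"
              \<comment> \<open>Since \<open>u\<close> is not in J, \<open>t\<close> is nonzero, so
                \<open>j\<close> has smaller degree and lies in M. Then \<open>diff\<close> gives a
                decomposition of \<open>c\<close> with the same nonzero \<open>j\<close>, although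
                \<open>c\<close> is in T.\<close>
              have t0: "t \<noteq> 0" using h uJ by auto
              have jM: "j \<in> M" using IHJ[OF h(2)] h deg_pos[OF t0] by simp
              have "t \<in> vecs I" "v + c = t + j" using h(1,3) u subT by auto
              then obtain t' where t': "t' \<in> M" "t = v + t'" "c = t' + j"
                using diff[OF v c jM] by blast
              have "t' \<in> T" using less[of t v t'] t' v h deg_pos[OF j0] by simp
              then show False using not_in_T[OF _ h(2) j0] t' cT by simp
            qed
          qed
          then show ?thesis using cT uJ by simp
        qed
      qed
    qed
  qed
  then show ?thesis using v c by (auto simp: L'_def M_def)
qed

section \<open>Digits on the coordinate axes\<close>

lemma single_zero_eq [simp]: "unit_vec i 0 = 0"
  by (rule poly_mapping_eqI) (simp add: lookup_single)

lemma entry_single: "entry (unit_vec i k) j = (if j = i then k else 0)"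
  by (simp add: lookup_single when_def)

lemma vecs_axis: "u \<in> vecs {i} \<Longrightarrow> u = unit_vec i (entry u i)"
  by (rule poly_mapping_eqI) (auto simp: entry_single vecs_iff)

lemma single_eq_add:
  assumes "unit_vec i m = t + j"
  shows "t = unit_vec i (entry t i)" "j = unit_vec i (entry j i)" "m = entry t i + entry j i"
proof -
  have "t + j \<in> vecs {i}" unfolding assms[symmetric] by simp
  then show "t = unit_vec i (entry t i)" "j = unit_vec i (entry j i)"
    using vecs_axis by auto
  show "m = entry t i + entry j i"
    using arg_cong[OF assms, of "\<lambda>u. entry u i"] by (simp add: lookup_add)
qed

text \<open>
  The power series of \<open>T\<close> is a product of series in the single variables \<open>x\<^sub>i\<close>, of degree less than
  \<open>N i\<close>, and of a series in the variables \<open>x\<^sub>i ^ N i\<close>. The last clause of \<open>block\<close> makes the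
  digits of \<open>T\<close> and of \<open>J\<close> on an axis an interval pair of size \<open>N i\<close>.
\<close>

definition block_set :: "'v set \<Rightarrow> ('v \<Rightarrow> nat) \<Rightarrow> ('v \<Rightarrow>\<^sub>0 nat) set \<Rightarrow> bool" where
  "block_set I N T \<longleftrightarrow> (\<forall>u\<in>vecs I. u \<in> T \<longleftrightarrow>
     (\<forall>i\<in>I. unit_vec i (entry u i mod N i) \<in> T) \<and> vec I (\<lambda>i. N i * (entry u i div N i)) \<in> T)"

definition block :: "'v set \<Rightarrow> ('v \<Rightarrow> nat) \<Rightarrow> ('v \<Rightarrow>\<^sub>0 nat) set \<Rightarrow> ('v \<Rightarrow>\<^sub>0 nat) set \<Rightarrow> bool" where
  "block I N T J \<longleftrightarrow> (\<forall>i. N i \<ge> 1) \<and> block_set I N T \<and> block_set I N J \<and>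
     (\<forall>i\<in>I. \<forall>c<N i. \<forall>d<N i. unit_vec i c \<in> T \<longrightarrow> unit_vec i d \<in> J \<longrightarrow> c + d < N i)"

definition quot :: "'v set \<Rightarrow> ('v \<Rightarrow> nat) \<Rightarrow> ('v \<Rightarrow>\<^sub>0 nat) set \<Rightarrow> ('v \<Rightarrow>\<^sub>0 nat) set" where
  "quot I N T = {u\<in>vecs I. vec I (\<lambda>i. N i * entry u i) \<in> T}"

lemma block_swap: "block I N T J \<Longrightarrow> block I N J T"
  unfolding block_def by (subst add.commute) blast

lemma block_setD:
  "block_set I N T \<Longrightarrow> u \<in> vecs I \<Longrightarrow> u \<in> T \<longleftrightarrow>
     (\<forall>i\<in>I. unit_vec i (entry u i mod N i) \<in> T) \<and> vec I (\<lambda>i. N i * (entry u i div N i)) \<in> T"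
  unfolding block_set_def by blast

lemma block_set_quot:
  "finite I \<Longrightarrow> block_set I N T \<Longrightarrow> u \<in> vecs I \<Longrightarrow> u \<in> T \<longleftrightarrow>
     (\<forall>i\<in>I. unit_vec i (entry u i mod N i) \<in> T) \<and> vec I (\<lambda>i. entry u i div N i) \<in> quot I N T"
proof -
  assume fin: "finite I" and b: "block_set I N T" and u: "u \<in> vecs I"
  have "vec I (\<lambda>i. N i * entry (vec I (\<lambda>i. entry u i div N i)) i) = vec I (\<lambda>i. N i * (entry u i div N i))"
    using fin by (intro poly_mapping_eqI) (auto simp: entry_vec)
  then show ?thesis using block_setD[OF b u] fin by (simp add: quot_def)
qed

lemma vec_single: "finite I \<Longrightarrow> i \<in> I \<Longrightarrow> f 0 = 0 \<Longrightarrow> (\<And>j. g j 0 = 0) \<Longrightarrow>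
   vec I (\<lambda>j. g j (entry (unit_vec i k) j)) = unit_vec i (g i k)"
  by (rule poly_mapping_eqI) (auto simp: entry_vec entry_single)

lemma block_set_single:
  assumes "finite I" "block_set I N T" "0 \<in> T" "i \<in> I"
  shows "unit_vec i k \<in> T \<longleftrightarrow> unit_vec i (k mod N i) \<in> T \<and> unit_vec i (k div N i) \<in> quot I N T"
proof -
  have e: "vec I (\<lambda>j. entry (unit_vec i k) j div N j) = unit_vec i (k div N i)"
    using vec_single[of I i "\<lambda>_. 0" "\<lambda>j x. x div N j" k] assms by simp
  have "(\<forall>j\<in>I. unit_vec j (entry (unit_vec i k) j mod N j) \<in> T) \<longleftrightarrow> unit_vec i (k mod N i) \<in> T"
    using assms by (auto simp: entry_single)
  then show ?thesis using block_set_quot[OF assms(1,2), of "unit_vec i k"] assms(4) e by simp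
qed

section \<open>Block forms of a pair: existence, refinement, and the faces not covered by T\<close>

context complementing
begin

lemma axis_ex:
  assumes "i \<in> I"
  shows "\<exists>c d. unit_vec i c \<in> T \<and> unit_vec i d \<in> J \<and> m = c + d"
proof -
  from assms obtain t j where "t \<in> T" "j \<in> J" "unit_vec i m = t + j"
    using ex[of "unit_vec i m"] by auto
  then show ?thesis using single_eq_add by metis
qed

lemma axis_uniq:
  assumes "unit_vec i c \<in> T" "unit_vec i d \<in> J" "unit_vec i c' \<in> T" "unit_vec i d' \<in> J" "c + d = c' + d'"
  shows "c = c' \<and> d = d'"
proof -
  have "unit_vec i c = unit_vec i c' \<and> unit_vec i d = unit_vec i d'"
    using assms by (intro uniq) (auto simp: single_add[symmetric])
  then show ?thesis by (metis lookup_single_eq)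
qed

lemma block_one: "block I (\<lambda>_. 1) T J"
  using zero by (auto simp: block_def block_set_def vec_entry fin)

lemma block_interval_pair:
  assumes b: "block I N T J" and i: "i \<in> I"
  shows "interval_pair (N i) ({c. c < N i \<and> unit_vec i c \<in> T}, {d. d < N i \<and> unit_vec i d \<in> J})"
proof -
  let ?C = "{c. c < N i \<and> unit_vec i c \<in> T}" and ?D = "{d. d < N i \<and> unit_vec i d \<in> J}"
  have o: "c + d < N i" if "c \<in> ?C" "d \<in> ?D" for c d
    using b i that unfolding block_def by blast
  have e: "\<exists>c\<in>?C. \<exists>d\<in>?D. m = c + d" if "m < N i" for m
  proof -
    obtain c d where "unit_vec i c \<in> T" "unit_vec i d \<in> J" "m = c + d" using axis_ex[OF i] by blast
    moreover from this have "c < N i" "d < N i" using that by auto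
    ultimately show ?thesis by blast
  qed
  have "\<exists>!p. p \<in> ?C \<times> ?D \<and> m = fst p + snd p" if m: "m < N i" for m
  proof -
    obtain c d where cd: "c \<in> ?C" "d \<in> ?D" "m = c + d" using e[OF m] by blast
    show ?thesis
    proof (rule ex1I[of _ "(c, d)"])
      show "(c, d) \<in> ?C \<times> ?D \<and> m = fst (c, d) + snd (c, d)" using cd by simp
      show "p = (c, d)" if "p \<in> ?C \<times> ?D \<and> m = fst p + snd p" for p
        using axis_uniq[of i "fst p" "snd p" c d] that cd by (cases p) auto
    qed
  qed
  moreover have "{c + d | c d. c \<in> ?C \<and> d \<in> ?D} = {..<N i}" using e o by fast
  moreover have "N i \<ge> 1" using b by (simp add: block_def)
  ultimately show ?thesis by (auto simp: interval_pair_def)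
qed

lemma quot_complementing:
  assumes b: "block I N T J"
  shows "complementing I (quot I N T) (quot I N J)"
proof
  show "finite I" by (rule fin)
  show "quot I N T \<subseteq> vecs I" "quot I N J \<subseteq> vecs I" by (auto simp: quot_def)
  have N: "N i \<ge> 1" for i using b by (simp add: block_def)
  define f where "f u = vec I (\<lambda>i. N i * entry u i)" for u
  have f_add: "f (u + v) = f u + f v" for u v
    unfolding f_def using fin by (intro poly_mapping_eqI) (auto simp: entry_vec lookup_add algebra_simps)
  have f_inj: "u = v" if "f u = f v" "u \<in> vecs I" "v \<in> vecs I" for u v
  proof (rule vecs_eqI[OF that(2,3)])
    fix i assume "i \<in> I"
    then have "N i * entry u i = N i * entry v i"
      using arg_cong[OF that(1), of "\<lambda>w. entry w i"] fin by (simp add: f_def entry_vec)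
    then show "entry u i = entry v i" using N[of i] by simp
  qed
  have Q: "u \<in> quot I N A \<longleftrightarrow> u \<in> vecs I \<and> f u \<in> A" for u A
    by (simp add: quot_def f_def)
  show "t = t' \<and> j = j'" if "t \<in> quot I N T" "j \<in> quot I N J" "t' \<in> quot I N T" "j' \<in> quot I N J" "t + j = t' + j'" for t j t' j'
  proof -
    have "f t + f j = f t' + f j'" using that(5) by (metis f_add)
    then have "f t = f t' \<and> f j = f j'" using that Q by (intro uniq) auto
    then show ?thesis using that Q f_inj by blast
  qed
  show "\<exists>t\<in>quot I N T. \<exists>j\<in>quot I N J. u = t + j" if u: "u \<in> vecs I" for u
  proof -
    have "f u \<in> vecs I" using fin by (simp add: f_def)
    from ex[OF this] obtain t j where tj: "t \<in> T" "j \<in> J" "f u = t + j" by blast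
    have tI: "t \<in> vecs I" "j \<in> vecs I" using tj subT subJ by auto
    \<comment> \<open>The last digits of \<open>t\<close> and \<open>j\<close> add up to less than
      \<open>N i\<close>, and their sum is divisible by \<open>N i\<close> because the entry of
      \<open>f u\<close> is. So both digits vanish.\<close>
    have z: "entry t i mod N i = 0 \<and> entry j i mod N i = 0" if i: "i \<in> I" for i
    proof -
      have "unit_vec i (entry t i mod N i) \<in> T" "unit_vec i (entry j i mod N i) \<in> J"
        using b tj tI i block_setD[of I N T t] block_setD[of I N J j] by (auto simp: block_def)
      then have l: "entry t i mod N i + entry j i mod N i < N i"
        using b i N[of i] unfolding block_def by (metis mod_less_divisor less_eq_Suc_le One_nat_def)
      have "entry t i + entry j i = N i * entry u i"
        using arg_cong[OF tj(3), of "\<lambda>w. entry w i"] i fin by (simp add: f_def entry_vec lookup_add)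
      then have "(entry t i mod N i + entry j i mod N i) mod N i = 0"
        by (metis mod_add_eq mod_mult_self1_is_0)
      then show ?thesis using l by simp
    qed
    have zd: "N i * (entry t i div N i) = entry t i \<and> N i * (entry j i div N i) = entry j i" if "i \<in> I" for i
      using z[OF that] by (metis add.right_neutral mult_div_mod_eq)
    define g where "g v = vec I (\<lambda>i. entry v i div N i)" for v
    have fg: "f (g v) = v" if "v \<in> vecs I" "\<And>i. i \<in> I \<Longrightarrow> N i * (entry v i div N i) = entry v i" for v
    proof (rule vecs_eqI[OF _ that(1)])
      show "f (g v) \<in> vecs I" using fin by (simp add: f_def)
      fix i assume i: "i \<in> I"
      then have "entry (f (g v)) i = N i * (entry v i div N i)"
        using fin by (simp add: f_def g_def entry_vec)
      then show "entry (f (g v)) i = entry v i" using that(2)[OF i] by (rule trans)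
    qed
    have "f (g t) = t" "f (g j) = j" using fg zd tI by blast+
    then have "g t \<in> quot I N T" "g j \<in> quot I N J" using tj fin by (auto simp: Q g_def)
    moreover have "f u = f (g t + g j)" unfolding f_add \<open>f (g t) = t\<close> \<open>f (g j) = j\<close> by (rule tj(3))
    moreover have "g t \<in> vecs I" "g j \<in> vecs I" using fin by (simp_all add: g_def)
    ultimately have "u = g t + g j" "g t \<in> quot I N T" "g j \<in> quot I N J"
      using f_inj[OF _ u] by simp_all
    then show ?thesis by blast
  qed
qed

text \<open>Mixed radix: a remainder modulo \<open>N i * M i\<close> consists of the remainder
  modulo \<open>N i\<close> and the remainder of the quotient modulo \<open>M i\<close>. Without a
  carry on either level there is none in the product.\<close>

lemma block_mult:
  assumes b: "block I N T J" and b': "block I M (quot I N T) (quot I N J)"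
  shows "block I (\<lambda>i. N i * M i) T J"
proof -
  have N: "N i \<ge> 1" "M i \<ge> 1" for i using b b' by (auto simp: block_def)
  have bs: "block_set I (\<lambda>i. N i * M i) A"
    if b: "block_set I N A" "block_set I M (quot I N A)" and z: "0 \<in> A" for A
    unfolding block_set_def
  proof
    fix u :: "'v \<Rightarrow>\<^sub>0 nat" assume u: "u \<in> vecs I"
    define q where "q = vec I (\<lambda>i. entry u i div N i)"
    have qI: "q \<in> vecs I" using fin by (simp add: q_def)
    have s: "unit_vec i (entry u i mod (N i * M i)) \<in> A \<longleftrightarrow>
      unit_vec i (entry u i mod N i) \<in> A \<and> unit_vec i (entry q i mod M i) \<in> quot I N A"
      if "i \<in> I" for i
      using that block_set_single[OF fin b(1) z that, of "entry u i mod (N i * M i)"] fin N(1)[of i]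
      by (simp add: q_def entry_vec mod_mult2_eq)
    have r: "vec I (\<lambda>i. M i * (entry q i div M i)) \<in> quot I N A \<longleftrightarrow>
      vec I (\<lambda>i. N i * M i * (entry u i div (N i * M i))) \<in> A"
    proof -
      have "vec I (\<lambda>i. N i * entry (vec I (\<lambda>i. M i * (entry q i div M i))) i) =
        vec I (\<lambda>i. N i * M i * (entry u i div (N i * M i)))"
        using fin by (intro poly_mapping_eqI) (auto simp: entry_vec q_def div_mult2_eq)
      then show ?thesis using fin by (simp add: quot_def)
    qed
    have "u \<in> A \<longleftrightarrow> (\<forall>i\<in>I. unit_vec i (entry u i mod N i) \<in> A) \<and> q \<in> quot I N A"
      unfolding q_def by (rule block_set_quot[OF fin b(1) u])
    also have "q \<in> quot I N A \<longleftrightarrow> (\<forall>i\<in>I. unit_vec i (entry q i mod M i) \<in> quot I N A) \<and>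
        vec I (\<lambda>i. M i * (entry q i div M i)) \<in> quot I N A"
      by (rule block_setD[OF b(2) qI])
    finally show "u \<in> A \<longleftrightarrow> (\<forall>i\<in>I. unit_vec i (entry u i mod (N i * M i)) \<in> A) \<and>
        vec I (\<lambda>i. N i * M i * (entry u i div (N i * M i))) \<in> A"
      unfolding r using s by blast
  qed
  have "c + d < N i * M i"
    if i: "i \<in> I" and cd: "c < N i * M i" "d < N i * M i" "unit_vec i c \<in> T" "unit_vec i d \<in> J" for i c d
  proof -
    have "unit_vec i (c mod N i) \<in> T" "unit_vec i (c div N i) \<in> quot I N T"
      "unit_vec i (d mod N i) \<in> J" "unit_vec i (d div N i) \<in> quot I N J"
      using block_set_single[OF fin _ zero(1) i, of N c] block_set_single[OF fin _ zero(2) i, of N d] b cd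
      by (auto simp: block_def)
    moreover have "c mod N i < N i" "d mod N i < N i" "c div N i < M i" "d div N i < M i"
      using cd N[of i] by (auto simp: less_mult_imp_div_less mult.commute)
    ultimately have "c mod N i + d mod N i < N i" and l: "c div N i + d div N i < M i"
      using b b' i unfolding block_def by blast+
    moreover have "c + d = N i * (c div N i + d div N i) + (c mod N i + d mod N i)"
      by (simp add: algebra_simps)
    moreover have "N i * (c div N i + d div N i) + N i \<le> N i * M i"
      using mult_le_mono2[of "Suc (c div N i + d div N i)" "M i" "N i"] l by simp
    ultimately show ?thesis by linarith
  qed
  then show ?thesis
    unfolding block_def using bs[of T] bs[of J] b b' zero N by (auto simp: block_def)
qed

text \<open>Puts the digits outside X back. A generation step attaches digits to the new tops X
  only, whereas \<open>reduced_block\<close> splits them off on all axes.\<close>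

lemma block_restrict:
  assumes b: "block I N T J"
  shows "block I (\<lambda>i. if i \<in> X then N i else 1) T J"
proof -
  let ?M = "\<lambda>i. if i \<in> X then N i else 1"
  have "block_set I ?M A" if b: "block_set I N A" and z: "0 \<in> A" for A
    unfolding block_set_def
  proof
    fix u :: "'v \<Rightarrow>\<^sub>0 nat" assume u: "u \<in> vecs I"
    let ?u = "vec I (\<lambda>i. ?M i * (entry u i div ?M i))"
    have eq: "vec I (\<lambda>i. N i * (entry ?u i div N i)) = vec I (\<lambda>i. N i * (entry u i div N i))"
      using fin by (intro poly_mapping_eqI) (auto simp: entry_vec)
    have sp: "(\<forall>i\<in>I. unit_vec i (entry u i mod N i) \<in> A) \<longleftrightarrow>
      (\<forall>i\<in>I. unit_vec i (entry u i mod ?M i) \<in> A) \<and> (\<forall>i\<in>I. unit_vec i (entry ?u i mod N i) \<in> A)"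
      using fin z by (auto simp: entry_vec)
    show "u \<in> A \<longleftrightarrow> (\<forall>i\<in>I. unit_vec i (entry u i mod ?M i) \<in> A) \<and> ?u \<in> A"
      using block_setD[OF b u] block_setD[OF b, of ?u] fin sp eq by simp
  qed
  then show ?thesis using b zero unfolding block_def by auto
qed

text \<open>The base \<open>k\<close> is the first gap of T on an axis that begins in T. The digits
  are then all of \<open>0, ..., k - 1\<close> for T and only \<open>0\<close> for J.\<close>

lemma axis_block:
  assumes i: "i \<in> I" and one: "unit_vec i 1 \<in> T" and n: "unit_vec i k0 \<notin> T"
  shows "\<exists>k\<ge>2. block I ((\<lambda>_. 1)(i := k)) T J"
proof -
  define k where "k = (LEAST k. unit_vec i k \<notin> T)"
  have kn: "unit_vec i k \<notin> T" unfolding k_def using n by (rule LeastI)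
  have kl: "unit_vec i l \<in> T" if "l < k" for l using not_less_Least[OF that[unfolded k_def]] by blast
  have k2: "k \<ge> 2"
  proof (rule ccontr)
    assume "\<not> k \<ge> 2"
    then have "k = 0 \<or> k = 1" by auto
    then show False using kn one zero by auto
  qed
  obtain c d where cd: "unit_vec i c \<in> T" "unit_vec i d \<in> J" "k = c + d" using axis_ex[OF i] by blast
  have "d \<noteq> 0" using cd kn by (intro notI) simp
  \<comment> \<open>Otherwise \<open>d < k\<close>, and the axis vector of length \<open>d\<close>
    is a nonzero common element of T and J.\<close>
  have "c = 0"
  proof (rule ccontr)
    assume "c \<noteq> 0"
    then have "unit_vec i d = 0" using inter[OF kl cd(2)] cd(3) by simp
    then show False using \<open>d \<noteq> 0\<close> by (metis lookup_single_eq lookup_zero)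
  qed
  then have kJ: "unit_vec i k \<in> J" using cd by simp
  let ?N = "(\<lambda>_. 1)(i := k)"
  have vk: "vec {i} (\<lambda>_. k) = unit_vec i k"
    by (rule poly_mapping_eqI) (auto simp: entry_vec entry_single)
  have dv: "(u \<in> T \<longleftrightarrow> vec I (\<lambda>j. ?N j * (entry u j div ?N j)) \<in> T) \<and> (u \<in> J \<longrightarrow> unit_vec i (entry u i mod k) = 0)"
    if u: "u \<in> vecs I" for u
  proof -
    let ?c = "vec I (\<lambda>j. ?N j * (entry u j div ?N j))" and ?v = "unit_vec i (entry u i mod k)"
    have "u = ?v + ?c" using u fin i
      by (intro poly_mapping_eqI) (auto simp: entry_vec entry_single lookup_add vecs_iff)
    moreover have "(?v + ?c \<in> T \<longleftrightarrow> ?c \<in> T) \<and> (?v + ?c \<in> J \<longrightarrow> ?v = 0)"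
    proof (rule division[of "{i}" "\<lambda>_. k"])
      show "v \<in> T" if "v \<in> vecs {i}" "\<exists>x\<in>{i}. entry v x < k" for v
        using vecs_axis[OF that(1)] that(2) kl by (metis singletonD)
      show "\<exists>m. \<forall>x\<in>{i}. entry ?c x = m * k" using i fin by (auto simp: entry_vec)
    qed (use i k2 kJ vk fin in \<open>auto simp: entry_single\<close>)
    ultimately show ?thesis by metis
  qed
  have ax: "unit_vec j (entry u j mod ?N j) \<in> T" for j u
    using kl k2 zero by auto
  have "block_set I ?N T"
    unfolding block_set_def using dv ax by blast
  moreover have "block_set I ?N J"
    unfolding block_set_def
  proof
    fix u :: "'v \<Rightarrow>\<^sub>0 nat" assume u: "u \<in> vecs I"
    let ?c = "vec I (\<lambda>j. ?N j * (entry u j div ?N j))"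
    have c: "?c = u" if "unit_vec i (entry u i mod k) = 0"
    proof (rule vecs_eqI[OF _ u])
      have "entry u i mod k = 0" using that by (metis lookup_single_eq lookup_zero)
      then show "entry ?c j = entry u j" if "j \<in> I" for j
        using that fin by (auto simp: entry_vec)
    qed (use fin in simp)
    have m: "unit_vec i (entry u i mod k) = 0" if "unit_vec i (entry u i mod k) \<in> J"
      using inter[OF _ that] kl[of "entry u i mod k"] k2 by simp
    show "u \<in> J \<longleftrightarrow> (\<forall>j\<in>I. unit_vec j (entry u j mod ?N j) \<in> J) \<and> ?c \<in> J"
    proof
      assume "u \<in> J"
      then have "unit_vec i (entry u i mod k) = 0" using dv u by blast
      then show "(\<forall>j\<in>I. unit_vec j (entry u j mod ?N j) \<in> J) \<and> ?c \<in> J"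
        using c \<open>u \<in> J\<close> zero by simp
    next
      assume "(\<forall>j\<in>I. unit_vec j (entry u j mod ?N j) \<in> J) \<and> ?c \<in> J"
      moreover from this have "unit_vec i (entry u i mod k) \<in> J" using i by fastforce
      ultimately show "u \<in> J" using c m by simp
    qed
  qed
  moreover have "c + d < ?N j"
    if "j \<in> I" "c < ?N j" "d < ?N j" "unit_vec j c \<in> T" "unit_vec j d \<in> J" for j c d
  proof (cases "j = i")
    case True
    then have "unit_vec i d = 0" using inter kl[of d] that by auto
    then show ?thesis using that by (metis lookup_single_eq lookup_zero add.right_neutral)
  qed (use that in simp)
  ultimately have "block I ?N T J" using k2 unfolding block_def by auto
  then show ?thesis using k2 by blast
qed

text \<open>As 1 has no proper decomposition, the unit vector of the axis lies in T or in J.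
  Whichever it is, that set has a gap on the axis, so \<open>axis_block\<close> applies to
  it.\<close>

lemma axis_block':
  assumes i: "i \<in> I" and T: "unit_vec i k \<notin> T" and J: "unit_vec i l \<notin> J"
  shows "\<exists>k\<ge>2. block I ((\<lambda>_. 1)(i := k)) T J"
proof -
  obtain c d where cd: "unit_vec i c \<in> T" "unit_vec i d \<in> J" "1 = c + d" using axis_ex[OF i] by blast
  show ?thesis
  proof (cases "d = 0")
    case True
    then show ?thesis using axis_block[OF i _ T] cd by simp
  next
    case False
    then have "d = 1" using cd by simp
    then show ?thesis using complementing.axis_block[OF swap i _ J] cd block_swap by blast
  qed
qed

text \<open>Once \<open>N i\<close> exceeds the entry of \<open>u\<close> at \<open>i\<close>, this
  entry is nothing but a digit: it is tested by itself and contributes nothing to the quotient part.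
  Arbitrarily large bases cover all \<open>u\<close>.\<close>

lemma splits_unbounded:
  assumes i: "i \<in> I" and un: "\<And>b. \<exists>N. block I N T J \<and> N i > b"
  shows "splits I {i} T"
  unfolding splits_def
proof
  fix u :: "'v \<Rightarrow>\<^sub>0 nat" assume u: "u \<in> vecs I"
  obtain N where N: "block I N T J" "N i > entry u i" using un by blast
  let ?r = "restr (I - {i}) u"
  have r: "restr {i} u = unit_vec i (entry u i)"
    by (rule poly_mapping_eqI) (auto simp: entry_single)
  have v: "vec I (\<lambda>j. N j * (entry ?r j div N j)) = vec I (\<lambda>j. N j * (entry u j div N j))"
    using N fin by (intro poly_mapping_eqI) (auto simp: entry_vec)
  have m: "(\<forall>j\<in>I. unit_vec j (entry u j mod N j) \<in> T) \<longleftrightarrow>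
    unit_vec i (entry u i) \<in> T \<and> (\<forall>j\<in>I. unit_vec j (entry ?r j mod N j) \<in> T)"
    using i N zero by auto
  have b: "block_set I N T" using N by (simp add: block_def)
  have rI: "?r \<in> vecs I" using u by (simp add: vecs_iff)
  show "u \<in> T \<longleftrightarrow> restr {i} u \<in> T \<and> ?r \<in> T"
    unfolding r using block_setD[OF b u] block_setD[OF b rI] m v by simp
qed

text \<open>By \<open>splits_unbounded\<close> every base is bounded, so some block form has the
  largest sum of bases. If both sets had a gap on an axis of its quotient,
  \<open>axis_block'\<close> and \<open>block_mult\<close> would produce a larger one.\<close>

lemma reduced_block:
  assumes "\<And>i. i \<in> I \<Longrightarrow> \<not> splits I {i} T"
  shows "\<exists>N. block I N T J \<and>
    (\<forall>i\<in>I. (\<forall>k. unit_vec i k \<in> quot I N T) \<or> (\<forall>k. unit_vec i k \<in> quot I N J))"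
proof -
  have "\<exists>b. \<forall>N. block I N T J \<longrightarrow> N i \<le> b" if "i \<in> I" for i
    using splits_unbounded[OF that] assms[OF that] by (meson not_le)
  then obtain b where b: "\<And>i N. i \<in> I \<Longrightarrow> block I N T J \<Longrightarrow> N i \<le> b i" by metis
  have "\<forall>N. block I N T J \<longrightarrow> sum N I < Suc (sum b I)"
    using b by (auto simp: less_Suc_eq_le intro!: sum_mono)
  then obtain N where N: "block I N T J" and max: "\<And>M. block I M T J \<Longrightarrow> sum M I \<le> sum N I"
    using ex_has_greatest_nat[of "\<lambda>N. block I N T J", OF block_one, of "\<lambda>N. sum N I"] by blast
  have "(\<forall>k. unit_vec i k \<in> quot I N T) \<or> (\<forall>k. unit_vec i k \<in> quot I N J)" if i: "i \<in> I" for i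
  proof (rule ccontr)
    assume "\<not> ?thesis"
    then obtain k where k: "k \<ge> 2" "block I ((\<lambda>_. 1)(i := k)) (quot I N T) (quot I N J)"
      using complementing.axis_block'[OF quot_complementing[OF N] i] by blast
    let ?M = "\<lambda>j. N j * ((\<lambda>_. 1)(i := k)) j"
    have N1: "N j > 0" for j using N by (simp add: block_def Suc_le_eq)
    have "sum N I < sum ?M I"
      using fin i k N1 by (intro sum_strict_mono_ex1) (auto intro!: bexI[of _ i])
    then show False using max[OF block_mult[OF N k(2)]] by simp
  qed
  then show ?thesis using N by blast
qed

lemma minimal_face:
  assumes X: "X \<subseteq> I" and F: "\<And>x. x \<in> X \<Longrightarrow> vecs (X - {x}) \<subseteq> T" and n: "\<not> vecs X \<subseteq> T"
  shows "\<exists>a. (\<forall>x\<in>X. a x \<ge> 1) \<and> vec X a \<in> J \<and>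
    (\<forall>v\<in>vecs X. (\<exists>x\<in>X. entry v x < a x) \<longrightarrow> v \<in> T)"
proof -
  define S where "S = {j \<in> J. j \<in> vecs X \<and> j \<noteq> 0}"
  have finX: "finite X" using X fin finite_subset by blast
  have XI: "v \<in> vecs X \<Longrightarrow> v \<in> vecs I" for v using X vecs_mono by blast
  obtain u where u: "u \<in> vecs X" "u \<notin> T" using n by blast
  obtain t j where tj: "t \<in> T" "j \<in> J" "u = t + j" "j \<noteq> 0"
    using in_T_unless[OF XI[OF u(1)]] u(2) by blast
  then have "j \<in> S" using u by (simp add: S_def)
  then obtain b where b: "b \<in> S" and min: "\<And>j. j \<in> S \<Longrightarrow> deg b \<le> deg j"
    using ex_has_least_nat[of "\<lambda>j. j \<in> S" j deg] by blast
  have face: "v \<in> T" if "v \<in> vecs X" "x \<in> X" "entry v x = 0" for v x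
    using F[OF that(2)] that by (auto simp: vecs_iff subset_iff)
  have pos: "entry j x \<ge> 1" if "j \<in> S" "x \<in> X" for j x
  proof (rule ccontr)
    assume "\<not> ?thesis"
    then have "j \<in> T" using face that by (auto simp: S_def)
    then show False using inter that by (auto simp: S_def)
  qed
  have le: "entry b x \<le> entry j x" if j: "j \<in> S" and x: "x \<in> X" for j x
  proof (rule ccontr)
    assume c: "\<not> ?thesis"
    \<comment> \<open>Positive and negative part of \<open>j - b\<close>, so that
      \<open>s + b = s' + j\<close>. Vanishing at \<open>x\<close>, the vector \<open>s\<close> lies
      in a smaller face and hence in T. If \<open>s'\<close> vanishes somewhere as well, uniqueness
      gives \<open>b = j\<close>; otherwise \<open>b\<close> exceeds \<open>j\<close> everywhere on
      X, against its least degree.\<close>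
    define s where "s = vec X (\<lambda>x. entry j x - entry b x)"
    define s' where "s' = vec X (\<lambda>x. entry b x - entry j x)"
    have sT: "s \<in> T" using x c finX by (intro face[of _ x]) (auto simp: s_def entry_vec)
    have sb: "s + b = s' + j"
      using b j finX by (intro vecs_eqI[of _ X]) (auto simp: s_def s'_def S_def entry_vec lookup_add)
    show False
    proof (cases "\<exists>y\<in>X. entry b y \<le> entry j y")
      case True
      then have "s' \<in> T" using finX by (auto intro!: face simp: s'_def entry_vec)
      then have "b = j" using uniq[OF sT _ _ _ sb] b j by (auto simp: S_def)
      then show False using c by simp
    next
      case False
      then have "sum (entry j) X < sum (entry b) X"
        using x finX by (intro sum_strict_mono) (auto simp: not_le)
      then have "deg j < deg b" using deg_alt[OF finX] b j by (simp add: S_def)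
      then show False using min[OF j] by simp
    qed
  qed
  have "v \<in> T" if v: "v \<in> vecs X" "x \<in> X" "entry v x < entry b x" for v x
  proof (rule in_T_unless[OF XI[OF v(1)]])
    fix t j assume h: "t \<in> T" "j \<in> J" "v = t + j"
    show "j = 0"
    proof (rule ccontr)
      assume "j \<noteq> 0"
      then have "j \<in> S" using h v by (auto simp: S_def)
      then show False using le[of j x] v h by (simp add: lookup_add)
    qed
  qed
  moreover have "vec X (entry b) \<in> J" using b finX by (simp add: S_def vec_entry)
  ultimately show ?thesis using pos[OF b] by (intro exI[of _ "entry b"]) blast
qed

end

section \<open>Replacing a node by its offspring\<close>

text \<open>
  The set \<open>gen I X z N a C \<delta> T\<close> is what a node \<open>z\<close> with offspring \<open>X\<close> makes out of \<open>T\<close>. A vector \<open>u\<close>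
  over \<open>I\<close> is written uniquely as \<open>u\<^sub>x = c\<^sub>x + N\<^sub>x (v\<^sub>x + a\<^sub>x w\<^sub>z)\<close> for \<open>x \<in> X\<close> and \<open>u\<^sub>y = w\<^sub>y\<close> elsewhere,
  with digits \<open>c\<^sub>x < N\<^sub>x\<close> and \<open>v \<in> L\<^sub>a\<close>. Here \<open>enc\<close> computes \<open>u\<close> from \<open>c\<close>, \<open>v\<close>, \<open>w\<close>, while \<open>low\<close>
  recovers \<open>w\<^sub>z\<close> from \<open>u\<close> and \<open>pack\<close> recovers \<open>w\<close>.
\<close>

definition low :: "'v set \<Rightarrow> ('v \<Rightarrow> nat) \<Rightarrow> ('v \<Rightarrow> nat) \<Rightarrow> ('v \<Rightarrow>\<^sub>0 nat) \<Rightarrow> nat" where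
  "low X N a u = Min ((\<lambda>x. entry u x div N x div a x) ` X)"

definition pack :: "'v set \<Rightarrow> 'v set \<Rightarrow> 'v \<Rightarrow> nat \<Rightarrow> ('v \<Rightarrow>\<^sub>0 nat) \<Rightarrow> ('v \<Rightarrow>\<^sub>0 nat)" where
  "pack I X z m u = vec (insert z (I - X)) (\<lambda>y. if y = z then m else entry u y)"

definition gen :: "'v set \<Rightarrow> 'v set \<Rightarrow> 'v \<Rightarrow> ('v \<Rightarrow> nat) \<Rightarrow> ('v \<Rightarrow> nat) \<Rightarrow> ('v \<Rightarrow> nat set) \<Rightarrow> nat \<Rightarrow>
    ('v \<Rightarrow>\<^sub>0 nat) set \<Rightarrow> ('v \<Rightarrow>\<^sub>0 nat) set" where
  "gen I X z N a C \<delta> T = {u \<in> vecs I. (\<forall>x\<in>X. entry u x mod N x \<in> C x) \<and>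
     (\<delta> = 0 \<longrightarrow> (\<forall>x\<in>X. entry u x div N x = a x * low X N a u)) \<and> pack I X z (low X N a u) u \<in> T}"

definition enc :: "'v set \<Rightarrow> 'v set \<Rightarrow> 'v \<Rightarrow> ('v \<Rightarrow> nat) \<Rightarrow> ('v \<Rightarrow> nat) \<Rightarrow> ('v \<Rightarrow> nat) \<Rightarrow> ('v \<Rightarrow> nat) \<Rightarrow>
    ('v \<Rightarrow>\<^sub>0 nat) \<Rightarrow> ('v \<Rightarrow>\<^sub>0 nat)" where
  "enc I X z N a c v w = vec I (\<lambda>i. if i \<in> X then c i + N i * (v i + a i * entry w z) else entry w i)"

text \<open>Primitivity over an arbitrary index set;
  \<open>primitive_pair_iff_indecomposable\<close> makes the link for \<open>{..<n}\<close>.\<close>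

definition indecomposable :: "'v set \<Rightarrow> ('v \<Rightarrow>\<^sub>0 nat) set \<Rightarrow> ('v \<Rightarrow>\<^sub>0 nat) set \<Rightarrow> bool" where
  "indecomposable I T J \<longleftrightarrow> complementing I T J \<and> (\<forall>P. P \<subset> I \<longrightarrow> P \<noteq> {} \<longrightarrow> \<not> (splits I P T \<and> splits I P J))"

lemma indecomposable_swap: "indecomposable I T J \<Longrightarrow> indecomposable I J T"
  using complementing.swap by (auto simp: indecomposable_def)

lemma interval_pairD:
  assumes "interval_pair N (C, D)"
  shows "N > 0" "c \<in> C \<Longrightarrow> c < N" "d \<in> D \<Longrightarrow> d < N" "c \<in> C \<Longrightarrow> d \<in> D \<Longrightarrow> c + d < N"
    "m < N \<Longrightarrow> \<exists>c\<in>C. \<exists>d\<in>D. m = c + d"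
    "c \<in> C \<Longrightarrow> d \<in> D \<Longrightarrow> c' \<in> C \<Longrightarrow> d' \<in> D \<Longrightarrow> c + d = c' + d' \<Longrightarrow> c = c' \<and> d = d'"
    "0 \<in> C" "0 \<in> D"
proof -
  have S: "{c + d | c d. c \<in> C \<and> d \<in> D} = {..<N}" and N: "N > 0"
    and U: "\<And>m. m < N \<Longrightarrow> \<exists>!p. p \<in> C \<times> D \<and> m = fst p + snd p"
    and sub: "C \<subseteq> {..<N}" "D \<subseteq> {..<N}"
    using assms by (auto simp: interval_pair_def)
  show l: "c \<in> C \<Longrightarrow> d \<in> D \<Longrightarrow> c + d < N" for c d using S by blast
  show "N > 0" by fact
  show "c \<in> C \<Longrightarrow> c < N" "d \<in> D \<Longrightarrow> d < N" using sub by auto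
  show e: "m < N \<Longrightarrow> \<exists>c\<in>C. \<exists>d\<in>D. m = c + d" for m using S by blast
  show "c \<in> C \<Longrightarrow> d \<in> D \<Longrightarrow> c' \<in> C \<Longrightarrow> d' \<in> D \<Longrightarrow> c + d = c' + d' \<Longrightarrow> c = c' \<and> d = d'"
  proof -
    assume h: "c \<in> C" "d \<in> D" "c' \<in> C" "d' \<in> D" "c + d = c' + d'"
    have "(c, d) = (c', d')" using U[OF l[OF h(1,2)]] h by (metis fst_conv mem_Sigma_iff snd_conv)
    then show ?thesis by simp
  qed
  show "0 \<in> C" "0 \<in> D" using e[OF N] by auto
qed

lemma interval_pair_swap: "interval_pair N (C, D) \<Longrightarrow> interval_pair N (D, C)"
proof -
  assume i: "interval_pair N (C, D)"
  note h = interval_pairD[OF i]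
  have "\<exists>!p. p \<in> D \<times> C \<and> m = fst p + snd p" if "m < N" for m
  proof -
    obtain c d where cd: "c \<in> C" "d \<in> D" "m = c + d" using h(5)[OF \<open>m < N\<close>] by blast
    show ?thesis
    proof (rule ex1I[of _ "(d, c)"])
      show "p = (d, c)" if "p \<in> D \<times> C \<and> m = fst p + snd p" for p
        using h(6)[of "snd p" "fst p" c d] that cd by (cases p) (auto simp: add.commute)
    qed (use cd in auto)
  qed
  moreover have "{c + d |c d. c \<in> D \<and> d \<in> C} = {..<N}"
    using h(4,5) by (force simp: add.commute)
  ultimately show ?thesis using h(1-3) by (auto simp: interval_pair_def)
qed

text \<open>The data of one generation step: I are the tops after the step, and \<open>I'\<close>,
  with \<open>z\<close> standing for its offspring X, are the tops before it.\<close>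

locale merge =
  fixes I X :: "'v set" and z :: 'v and N a :: "'v \<Rightarrow> nat"
  assumes fin: "finite I" and X: "X \<subseteq> I" "X \<noteq> {}" and z: "z \<notin> I"
    and N: "\<And>x. x \<in> X \<Longrightarrow> N x > 0" and a: "\<And>x. x \<in> X \<Longrightarrow> a x > 0"
begin

abbreviation "I' \<equiv> insert z (I - X)"
abbreviation "en \<equiv> enc I X z N a"
abbreviation "ge \<equiv> gen I X z N a"
abbreviation "lo \<equiv> low X N a"
abbreviation "pk \<equiv> pack I X z"

lemma finX: "finite X"
  using X fin finite_subset by auto

lemma fin': "finite I'"
  using fin by simp

lemma en_vecs [simp]: "en c v w \<in> vecs I"
  using fin by (simp add: enc_def)

lemma pk_vecs [simp]: "pk m u \<in> vecs I'"
  using fin by (simp add: pack_def)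

lemma entry_en: "entry (en c v w) i =
    (if i \<in> X then c i + N i * (v i + a i * entry w z) else if i \<in> I then entry w i else 0)"
  using fin X by (auto simp: enc_def entry_vec)

lemma entry_pk: "entry (pk m u) y = (if y = z then m else if y \<in> I - X then entry u y else 0)"
  using fin by (auto simp: pack_def entry_vec)

lemma en_add: "en c v w + en c' v' w' = en (\<lambda>x. c x + c' x) (\<lambda>x. v x + v' x) (w + w')"
  by (rule poly_mapping_eqI) (auto simp: entry_en lookup_add algebra_simps)

lemma lo_le: "x \<in> X \<Longrightarrow> a x * lo u \<le> entry u x div N x"
proof -
  assume x: "x \<in> X"
  have "lo u \<le> entry u x div N x div a x"
    unfolding low_def using finX x by (intro Min_le) auto
  then show ?thesis using a[OF x] by (metis less_eq_div_iff_mult_less_eq mult.commute)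
qed

lemma lo_in: "\<exists>x\<in>X. lo u = entry u x div N x div a x"
proof -
  have "lo u \<in> (\<lambda>x. entry u x div N x div a x) ` X"
    unfolding low_def using finX X by (intro Min_in) auto
  then show ?thesis by blast
qed

lemma decode:
  assumes "u \<in> vecs I"
  shows "u = en (\<lambda>x. entry u x mod N x) (\<lambda>x. entry u x div N x - a x * lo u) (pk (lo u) u)"
    and "\<exists>x\<in>X. entry u x div N x - a x * lo u < a x"
proof -
  show "u = en (\<lambda>x. entry u x mod N x) (\<lambda>x. entry u x div N x - a x * lo u) (pk (lo u) u)"
  proof (rule poly_mapping_eqI)
    fix i
    show "entry u i = entry (en (\<lambda>x. entry u x mod N x) (\<lambda>x. entry u x div N x - a x * lo u) (pk (lo u) u)) i"
      using assms z lo_le[of i u] by (auto simp: entry_en entry_pk vecs_iff)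
  qed
  obtain x where x: "x \<in> X" "lo u = entry u x div N x div a x" using lo_in by blast
  then have "entry u x div N x - a x * lo u < a x"
    using a[OF x(1)] by (simp add: minus_mult_div_eq_mod)
  then show "\<exists>x\<in>X. entry u x div N x - a x * lo u < a x" using x by blast
qed

section \<open>Decoding inverts encoding\<close>

context
  fixes c v w
  assumes c: "\<And>x. x \<in> X \<Longrightarrow> c x < N x" and v: "\<exists>x\<in>X. v x < a x" and w: "w \<in> vecs I'"
begin

lemma en_mod: "x \<in> X \<Longrightarrow> entry (en c v w) x mod N x = c x"
  using c[of x] by (simp add: entry_en)

lemma en_div: "x \<in> X \<Longrightarrow> entry (en c v w) x div N x = v x + a x * entry w z"
  using c[of x] by (simp add: entry_en)

lemma lo_en: "lo (en c v w) = entry w z"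
proof -
  obtain x0 where x0: "x0 \<in> X" "v x0 < a x0" using v by blast
  have e: "entry (en c v w) x div N x div a x = v x div a x + entry w z" if "x \<in> X" for x
    using en_div[OF that] a[OF that] by simp
  show ?thesis
    unfolding low_def
  proof (rule Min_eqI)
    show "entry w z \<in> (\<lambda>x. entry (en c v w) x div N x div a x) ` X"
      using x0 e[OF x0(1)] by force
  qed (use finX e in auto)
qed

lemma pk_en: "pk (lo (en c v w)) (en c v w) = w"
  using w by (intro poly_mapping_eqI) (auto simp: lo_en entry_pk entry_en vecs_iff)

lemma en_in_ge: "en c v w \<in> ge C \<delta> T \<longleftrightarrow>
    (\<forall>x\<in>X. c x \<in> C x) \<and> (\<delta> = 0 \<longrightarrow> (\<forall>x\<in>X. v x = 0)) \<and> w \<in> T"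
  unfolding gen_def mem_Collect_eq pk_en using en_mod en_div lo_en by auto

end

lemma en_eqD:
  assumes e: "en c v w = en c' v' w'"
    and "\<forall>x\<in>X. c x < N x" "\<exists>x\<in>X. v x < a x" "w \<in> vecs I'"
    and "\<forall>x\<in>X. c' x < N x" "\<exists>x\<in>X. v' x < a x" "w' \<in> vecs I'"
  shows "\<And>x. x \<in> X \<Longrightarrow> c x = c' x" "\<And>x. x \<in> X \<Longrightarrow> v x = v' x" "w = w'"
proof -
  show 1: "w = w'" using pk_en[of c v w] pk_en[of c' v' w'] assms by metis
  show "c x = c' x" if "x \<in> X" for x
    using en_mod[of c v w x] en_mod[of c' v' w' x] assms that by metis
  show "v x = v' x" if x: "x \<in> X" for x
    using en_div[of c v w x] en_div[of c' v' w' x] assms x 1 by (metis add_right_cancel)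
qed

lemma en_cong: "(\<And>x. x \<in> X \<Longrightarrow> c x = c' x) \<Longrightarrow> (\<And>x. x \<in> X \<Longrightarrow> v x = v' x) \<Longrightarrow> en c v w = en c' v' w"
  by (rule poly_mapping_eqI) (auto simp: entry_en)

lemma ge_elim:
  assumes "u \<in> ge C \<delta> T"
  obtains c v w where "u = en c v w" "\<And>x. x \<in> X \<Longrightarrow> c x \<in> C x" "\<And>x. x \<in> X \<Longrightarrow> c x < N x"
    "\<exists>x\<in>X. v x < a x" "w \<in> T" "\<delta> = 0 \<Longrightarrow> v = (\<lambda>_. 0)"
proof -
  let ?c = "\<lambda>x. entry u x mod N x" and ?v = "\<lambda>x. entry u x div N x - a x * lo u" and ?w = "pk (lo u) u"
  \<comment> \<open>Membership in \<open>ge C 0 T\<close> controls \<open>?v\<close> on X only.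
    Replacing it by the zero function lets the rule return an equation between functions.\<close>
  let ?v' = "if \<delta> = 0 then (\<lambda>_. 0) else ?v"
  have uI: "u \<in> vecs I" using assms by (simp add: gen_def)
  have "u = en ?c ?v ?w" by (rule decode(1)[OF uI])
  also have "\<dots> = en ?c ?v' ?w"
    by (rule en_cong) (use assms in \<open>auto simp: gen_def\<close>)
  finally have 1: "u = en ?c ?v' ?w" .
  have "\<exists>x\<in>X. ?v' x < a x" using decode(2)[OF uI] a by (cases "\<delta> = 0") auto
  then show ?thesis using that[OF 1] assms N by (simp add: gen_def)
qed

text \<open>Encoding is additive and injective, so decompositions can be treated part by part:
  \<open>C x\<close> and \<open>D x\<close> add up to an interval without carries, the
  \<open>L_a\<close>-part belongs to one side alone, and what is left is the decomposition into T
  and J.\<close>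

lemma ge_complementing:
  assumes iv: "\<And>x. x \<in> X \<Longrightarrow> interval_pair (N x) (C x, D x)"
    and sub: "T \<subseteq> vecs I'" "J \<subseteq> vecs I'"
  shows "complementing I (ge C 1 T) (ge D 0 J) \<longleftrightarrow> complementing I' T J"
proof
  have zv: "\<exists>x\<in>X. 0 < a x" using X a by auto
  note h = interval_pairD[OF iv]
  show "complementing I (ge C 1 T) (ge D 0 J)" if "complementing I' T J"
  proof
    interpret R: complementing I' T J by fact
    show "finite I" by (rule fin)
    show "ge C 1 T \<subseteq> vecs I" "ge D 0 J \<subseteq> vecs I" by (auto simp: gen_def)
    show "\<exists>t\<in>ge C 1 T. \<exists>j\<in>ge D 0 J. u = t + j" if u: "u \<in> vecs I" for u
    proof -
      let ?e = "\<lambda>x. entry u x mod N x" and ?v = "\<lambda>x. entry u x div N x - a x * lo u" and ?w = "pk (lo u) u"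
      have "\<forall>x\<in>X. \<exists>p. fst p \<in> C x \<and> snd p \<in> D x \<and> ?e x = fst p + snd p"
        using h(5) N by (metis fst_conv snd_conv mod_less_divisor)
      then obtain p where p: "\<And>x. x \<in> X \<Longrightarrow> fst (p x) \<in> C x \<and> snd (p x) \<in> D x \<and> ?e x = fst (p x) + snd (p x)"
        by metis
      define c d where "c x = fst (p x)" and "d x = snd (p x)" for x
      note cd = p[folded c_def d_def]
      obtain t j where tj: "t \<in> T" "j \<in> J" "?w = t + j" using R.ex[OF pk_vecs] by blast
      have "u = en ?e ?v ?w" by (rule decode(1)[OF u])
      also have "\<dots> = en (\<lambda>x. c x + d x) (\<lambda>x. ?v x + 0) (t + j)"
        unfolding tj by (rule en_cong) (use cd in auto)
      also have "\<dots> = en c ?v t + en d (\<lambda>_. 0) j" by (rule en_add[symmetric])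
      finally have "u = en c ?v t + en d (\<lambda>_. 0) j" .
      moreover have "en c ?v t \<in> ge C 1 T"
        using decode(2)[OF u] cd h tj sub by (subst en_in_ge) auto
      moreover have "en d (\<lambda>_. 0) j \<in> ge D 0 J"
        using zv cd h tj sub by (subst en_in_ge) auto
      ultimately show ?thesis by blast
    qed
    show "t = t' \<and> j = j'"
      if hh: "t \<in> ge C 1 T" "j \<in> ge D 0 J" "t' \<in> ge C 1 T" "j' \<in> ge D 0 J" "t + j = t' + j'" for t j t' j'
    proof -
      from hh(1) obtain c v w where t: "t = en c v w" "\<And>x. x \<in> X \<Longrightarrow> c x \<in> C x" "\<exists>x\<in>X. v x < a x" "w \<in> T"
        by (rule ge_elim) blast
      from hh(3) obtain c' v' w' where t': "t' = en c' v' w'" "\<And>x. x \<in> X \<Longrightarrow> c' x \<in> C x" "\<exists>x\<in>X. v' x < a x" "w' \<in> T"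
        by (rule ge_elim) blast
      from hh(2) obtain d y where j: "j = en d (\<lambda>_. 0) y" "\<And>x. x \<in> X \<Longrightarrow> d x \<in> D x" "y \<in> J"
        by (rule ge_elim) blast
      from hh(4) obtain d' y' where j': "j' = en d' (\<lambda>_. 0) y'" "\<And>x. x \<in> X \<Longrightarrow> d' x \<in> D x" "y' \<in> J"
        by (rule ge_elim) blast
      have e: "en (\<lambda>x. c x + d x) v (w + y) = en (\<lambda>x. c' x + d' x) v' (w' + y')"
        using hh(5) unfolding t(1) j(1) t'(1) j'(1) en_add by simp
      have sm: "\<forall>x\<in>X. c x + d x < N x" "\<forall>x\<in>X. c' x + d' x < N x"
        using t j t' j' h(4) by auto
      have wv: "w + y \<in> vecs I'" "w' + y' \<in> vecs I'" using sub t j t' j' by auto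
      note E = en_eqD[OF e sm(1) t(3) wv(1) sm(2) t'(3) wv(2)]
      have "w = w' \<and> y = y'" using R.uniq[OF t(4) j(3) t'(4) j'(3) E(3)] .
      moreover have "c x = c' x \<and> d x = d' x" if "x \<in> X" for x
        by (rule h(6)[OF that t(2)[OF that] j(2)[OF that] t'(2)[OF that] j'(2)[OF that] E(1)[OF that]])
      ultimately show ?thesis
        unfolding t(1) j(1) t'(1) j'(1) using en_cong[of c c' v v' w] en_cong[of d d' "\<lambda>_. 0" "\<lambda>_. 0" y] E(2) by simp
    qed
  qed
  show "complementing I' T J" if "complementing I (ge C 1 T) (ge D 0 J)"
  proof
    interpret R: complementing I "ge C 1 T" "ge D 0 J" by fact
    \<comment> \<open>Zero digits and zero \<open>L_a\<close>-part embed the vectors over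
      \<open>I'\<close>. Decompositions over I of vectors in the image are pulled back.\<close>
    let ?f = "en (\<lambda>_. 0) (\<lambda>_. 0)"
    have f: "?f w \<in> ge C 1 A \<longleftrightarrow> w \<in> A" "?f w \<in> ge D 0 A \<longleftrightarrow> w \<in> A" if "w \<in> vecs I'" for w A
      using zv h N that by (subst en_in_ge; auto)+
    have f_inj: "w = w'" if "?f w = ?f w'" "w \<in> vecs I'" "w' \<in> vecs I'" for w w'
      using en_eqD(3)[OF that(1)] N zv that by blast
    show "finite I'" by (rule fin')
    show "T \<subseteq> vecs I'" "J \<subseteq> vecs I'" by fact+
    show "\<exists>t\<in>T. \<exists>j\<in>J. w = t + j" if w: "w \<in> vecs I'" for w
    proof -
      obtain t j where tj: "t \<in> ge C 1 T" "j \<in> ge D 0 J" "?f w = t + j" using R.ex[OF en_vecs] by blast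
      from tj(1) obtain c v w' where t: "t = en c v w'" "\<And>x. x \<in> X \<Longrightarrow> c x \<in> C x" "\<exists>x\<in>X. v x < a x" "w' \<in> T"
        by (rule ge_elim) blast
      from tj(2) obtain d y where j: "j = en d (\<lambda>_. 0) y" "\<And>x. x \<in> X \<Longrightarrow> d x \<in> D x" "y \<in> J"
        by (rule ge_elim) blast
      have e: "?f w = en (\<lambda>x. c x + d x) v (w' + y)"
        unfolding tj(3) t(1) j(1) en_add by simp
      have "w = w' + y"
        using en_eqD(3)[OF e _ zv w _ t(3)] N h(4) t(2) j(2) subsetD[OF sub(1) t(4)] subsetD[OF sub(2) j(3)]
        by simp
      then show ?thesis using t j by blast
    qed
    show "t = t' \<and> j = j'" if hh: "t \<in> T" "j \<in> J" "t' \<in> T" "j' \<in> J" "t + j = t' + j'" for t j t' j'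
    proof -
      have v: "t \<in> vecs I'" "j \<in> vecs I'" "t' \<in> vecs I'" "j' \<in> vecs I'" using hh sub by auto
      have "?f t + ?f j = ?f t' + ?f j'" unfolding en_add using hh(5) by simp
      then have "?f t = ?f t' \<and> ?f j = ?f j'"
        by (intro R.uniq) (use f v hh in simp_all)
      then show ?thesis using f_inj v by blast
    qed
  qed
qed

lemma ge_complementing':
  assumes iv: "\<And>x. x \<in> X \<Longrightarrow> interval_pair (N x) (C x, D x)"
    and sub: "T \<subseteq> vecs I'" "J \<subseteq> vecs I'" and \<delta>: "\<delta> \<in> {0, 1}"
  shows "complementing I (ge C \<delta> T) (ge D (1 - \<delta>) J) \<longleftrightarrow> complementing I' T J"
proof (cases "\<delta> = 1")
  case True
  then show ?thesis using ge_complementing[OF iv sub] by simp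
next
  case False
  then have "\<delta> = 0" using \<delta> by simp
  then show ?thesis
    using ge_complementing[OF interval_pair_swap[OF iv] sub(2,1)] complementing.swap by (metis diff_zero)
qed

text \<open>A set P that avoids X does not interfere with decoding: the restriction to P has zero
  X-part, and the restriction to the rest keeps the whole X-part, hence the same \<open>lo\<close>.
  On the level of \<open>I'\<close> the coordinate \<open>z\<close> belongs to the second
  side.\<close>

lemma splits_ge:
  assumes P: "P \<subseteq> I - X" and C0: "\<And>x. x \<in> X \<Longrightarrow> 0 \<in> C x"
  shows "splits I P (ge C \<delta> T) \<longleftrightarrow> splits I' P T"
proof -
  define K where "K u \<longleftrightarrow> (\<forall>x\<in>X. entry u x mod N x \<in> C x) \<and>
     (\<delta> = 0 \<longrightarrow> (\<forall>x\<in>X. entry u x div N x = a x * lo u))" for u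
  define q where "q u = pk (lo u) u" for u
  have zP: "z \<notin> P" using P z by auto
  have qI: "q u \<in> vecs I'" for u by (simp add: q_def)
  have mem: "u \<in> ge C \<delta> T \<longleftrightarrow> K u \<and> q u \<in> T" if "u \<in> vecs I" for u
    using that by (simp add: gen_def K_def q_def)
  have XP: "x \<notin> P \<and> x \<in> I" if "x \<in> X" for x using that P X by auto
  have lP: "lo (restr P u) = 0" for u
  proof -
    have "(\<lambda>x. entry (restr P u) x div N x div a x) ` X = {0}"
      using X XP by (auto simp: image_def)
    then show ?thesis by (simp add: low_def)
  qed
  have lR: "lo (restr (I - P) u) = lo u" for u
    unfolding low_def using XP by (auto intro!: arg_cong[of _ _ Min] image_cong)
  have inP: "restr P u \<in> ge C \<delta> T \<longleftrightarrow> restr P (q u) \<in> T" if "u \<in> vecs I" for u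
  proof -
    have "q (restr P u) = restr P (q u)"
      unfolding q_def lP using P zP by (intro poly_mapping_eqI) (auto simp: entry_pk)
    moreover have "K (restr P u)" using XP C0 by (simp add: K_def lP)
    ultimately show ?thesis using mem[of "restr P u"] that by (simp add: vecs_iff)
  qed
  have inR: "restr (I - P) u \<in> ge C \<delta> T \<longleftrightarrow> K u \<and> restr (I' - P) (q u) \<in> T" if "u \<in> vecs I" for u
  proof -
    have "q (restr (I - P) u) = restr (I' - P) (q u)"
      unfolding q_def lR using P zP by (intro poly_mapping_eqI) (auto simp: entry_pk)
    moreover have "K (restr (I - P) u) = K u" using XP by (simp add: K_def lR)
    ultimately show ?thesis using mem[of "restr (I - P) u"] that by (simp add: vecs_iff)
  qed
  show ?thesis
  proof
    assume s: "splits I' P T"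
    show "splits I P (ge C \<delta> T)"
      unfolding splits_def using s[unfolded splits_def] mem inP inR qI by blast
  next
    assume s: "splits I P (ge C \<delta> T)"
    show "splits I' P T"
      unfolding splits_def
    proof
      fix w assume w: "w \<in> vecs I'"
      let ?u = "en (\<lambda>_. 0) (\<lambda>_. 0) w"
      have zv: "\<exists>x\<in>X. 0 < a x" using X a by auto
      have "q ?u = w" unfolding q_def by (rule pk_en) (use N zv w in auto)
      moreover have "K ?u"
        using en_in_ge[of "\<lambda>_. 0" "\<lambda>_. 0" w C \<delta> UNIV] N zv w C0
        by (auto simp: K_def gen_def)
      ultimately show "w \<in> T \<longleftrightarrow> restr P w \<in> T \<and> restr (I' - P) w \<in> T"
        using s[unfolded splits_def, rule_format, of ?u] mem[of ?u] inP[of ?u] inR[of ?u] by simp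
    qed
  qed
qed

text \<open>With exponent 0 the quotients on X form a multiple of \<open>a\<close>. The encoding of
  a vector with positive entry at \<open>z\<close> is positive on all of X, but its restriction to P
  is zero on one part of X and positive on another, so it is no such multiple.\<close>

lemma splits_ge_full:
  assumes P: "P \<subset> I" "X \<inter> P \<noteq> {}" "X - P \<noteq> {}" and T: "w \<in> T" "w \<in> vecs I'" "entry w z > 0"
    and C0: "\<And>x. x \<in> X \<Longrightarrow> 0 \<in> C x"
  shows "\<not> splits I P (ge C 0 T)"
proof
  assume s: "splits I P (ge C 0 T)"
  let ?u = "en (\<lambda>_. 0) (\<lambda>_. 0) w"
  have zv: "\<exists>x\<in>X. 0 < a x" using X a by auto
  have "?u \<in> ge C 0 T" by (subst en_in_ge) (use N zv T C0 in auto)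
  then have "restr P ?u \<in> ge C 0 T" using s by (simp add: splits_def)
  then have e: "\<And>x. x \<in> X \<Longrightarrow> entry (restr P ?u) x div N x = a x * lo (restr P ?u)"
    by (simp add: gen_def)
  obtain x y where xy: "x \<in> X" "x \<notin> P" "y \<in> X" "y \<in> P" using P by blast
  have "lo (restr P ?u) = 0" using e[OF xy(1)] xy a[OF xy(1)] by simp
  then show False using e[OF xy(3)] xy a[OF xy(3)] N[OF xy(3)] T by (simp add: entry_en)
qed

lemma indecomposable_of_ge:
  assumes iv: "\<And>x. x \<in> X \<Longrightarrow> interval_pair (N x) (C x, D x)"
    and sub: "T \<subseteq> vecs I'" "J \<subseteq> vecs I'" and \<delta>: "\<delta> \<in> {0, 1}"
    and p: "indecomposable I (ge C \<delta> T) (ge D (1 - \<delta>) J)"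
  shows "indecomposable I' T J"
  unfolding indecomposable_def
proof (intro conjI allI impI notI)
  show "complementing I' T J" using ge_complementing'[OF iv sub \<delta>] p by (simp add: indecomposable_def)
  fix P assume P: "P \<subset> I'" "P \<noteq> {}" and s: "splits I' P T \<and> splits I' P J"
  \<comment> \<open>Of the two sides of the partition the one without \<open>z\<close> is taken,
    since it consists of coordinates in \<open>I - X\<close> and \<open>splits_ge\<close>
    applies.\<close>
  define Q where "Q = (if z \<in> P then I' - P else P)"
  have Q: "Q \<subseteq> I - X" "Q \<noteq> {}" using P by (auto simp: Q_def)
  have "splits I' Q T \<and> splits I' Q J" using s P splits_compl[of P I'] by (auto simp: Q_def)
  then have "splits I Q (ge C \<delta> T) \<and> splits I Q (ge D (1 - \<delta>) J)"
    using splits_ge[OF Q(1)] interval_pairD(7,8)[OF iv] by blast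
  moreover have "Q \<subset> I" using Q X by blast
  ultimately show False using p Q(2) unfolding indecomposable_def by blast
qed

text \<open>A partition either leaves X on one side, and then descends to \<open>I'\<close> by
  \<open>splits_ge\<close>, or cuts X. The positivity premises provide the vector that
  \<open>splits_ge_full\<close> needs against a cut, in the set that does not receive
  \<open>L_a\<close>.\<close>

lemma indecomposable_ge:
  assumes iv: "\<And>x. x \<in> X \<Longrightarrow> interval_pair (N x) (C x, D x)"
    and \<delta>: "\<delta> \<in> {0, 1}" and p: "indecomposable I' T J"
    and w1: "\<delta> = 1 \<Longrightarrow> \<exists>w\<in>J. entry w z > 0" and w0: "\<delta> = 0 \<Longrightarrow> \<exists>w\<in>T. entry w z > 0"
  shows "indecomposable I (ge C \<delta> T) (ge D (1 - \<delta>) J)"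
  unfolding indecomposable_def
proof (intro conjI allI impI notI)
  interpret complementing I' T J using p by (simp add: indecomposable_def)
  have cp: "complementing I' T J" by unfold_locales
  show "complementing I (ge C \<delta> T) (ge D (1 - \<delta>) J)" using ge_complementing'[OF iv subT subJ \<delta>] cp by simp
  note C0 = interval_pairD(7,8)[OF iv]
  fix P assume P: "P \<subset> I" "P \<noteq> {}" and s: "splits I P (ge C \<delta> T) \<and> splits I P (ge D (1 - \<delta>) J)"
  have no: False if Q: "Q \<subseteq> I - X" "Q \<noteq> {}" and s: "splits I Q (ge C \<delta> T) \<and> splits I Q (ge D (1 - \<delta>) J)" for Q
  proof -
    have "splits I' Q T \<and> splits I' Q J" using splits_ge[OF Q(1)] C0 s by blast
    moreover have "Q \<subset> I'" using Q z by blast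
    ultimately show False using p Q unfolding indecomposable_def by blast
  qed
  show False
  proof (cases "X \<inter> P = {}")
    case True
    then show False using no[of P] P s by blast
  next
    case XP: False
    show False
    proof (cases "X - P = {}")
      case True
      then show False using no[of "I - P"] P s splits_compl[of P I] by blast
    next
      case False
      show False
      proof (cases "\<delta> = 1")
        case True
        then show False using splits_ge_full[OF P(1) XP False, of _ J D] w1 C0 s subJ by auto
      next
        case False: False
        then have "\<delta> = 0" using \<delta> by simp
        then show False using splits_ge_full[OF P(1) XP \<open>X - P \<noteq> {}\<close>, of _ T C] w0 C0 s subT by auto
      qed
    qed
  qed
qed

end

text \<open>If J vanished at \<open>i\<close>, it would split along \<open>{i}\<close>, and T with
  it. Hence in dimension at least two the positivity premises of \<open>indecomposable_ge\<close>
  hold automatically.\<close>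

lemma indecomposable_positive:
  assumes p: "indecomposable I T J" and i: "i \<in> I" and I: "I \<noteq> {i}"
  shows "\<exists>j\<in>J. entry j i > 0"
proof (rule ccontr)
  interpret complementing I T J using p by (simp add: indecomposable_def)
  assume "\<not> ?thesis"
  then have n: "\<And>j. j \<in> J \<Longrightarrow> entry j i = 0" by simp
  have "splits I {i} J"
    unfolding splits_def
  proof
    fix u :: "'a \<Rightarrow>\<^sub>0 nat" assume u: "u \<in> vecs I"
    have 0: "restr {i} u = 0" "restr (I - {i}) u = u" if "entry u i = 0"
      using that u by (auto intro!: poly_mapping_eqI simp: vecs_iff)
    show "u \<in> J \<longleftrightarrow> restr {i} u \<in> J \<and> restr (I - {i}) u \<in> J"
    proof (cases "entry u i = 0")
      case True
      then show ?thesis using 0 zero by simp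
    next
      case False
      then show ?thesis using n[of u] n[of "restr {i} u"] by auto
    qed
  qed
  moreover from this have "splits I {i} T" using splits_T i by simp
  moreover have "{i} \<subset> I" using i I by blast
  ultimately show False using p unfolding indecomposable_def by blast
qed

section \<open>Decomposing a primitive pair\<close>

text \<open>Digits and quotients are taken coordinate by coordinate, so they commute with
  restriction, and a coordinate set to zero has digit 0, which is always admissible.\<close>

lemma splits_quot:
  assumes fin: "finite I" and b: "block_set I N T" and z: "0 \<in> T" and s: "splits I P (quot I N T)"
  shows "splits I P T"
  unfolding splits_def
proof
  fix u :: "'a \<Rightarrow>\<^sub>0 nat" assume u: "u \<in> vecs I"
  let ?q = "\<lambda>u. vec I (\<lambda>i. entry u i div N i)"
  have q: "?q (restr A u) = restr A (?q u)" for A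
    using fin by (intro poly_mapping_eqI) (auto simp: entry_vec)
  have rI: "restr A u \<in> vecs I" for A using u by (simp add: vecs_iff)
  have m: "(\<forall>i\<in>I. unit_vec i (entry u i mod N i) \<in> T) \<longleftrightarrow>
      (\<forall>i\<in>I. unit_vec i (entry (restr P u) i mod N i) \<in> T) \<and>
      (\<forall>i\<in>I. unit_vec i (entry (restr (I - P) u) i mod N i) \<in> T)"
    using z by auto
  have "?q u \<in> quot I N T \<longleftrightarrow> restr P (?q u) \<in> quot I N T \<and> restr (I - P) (?q u) \<in> quot I N T"
    using s fin by (simp add: splits_def)
  then show "u \<in> T \<longleftrightarrow> restr P u \<in> T \<and> restr (I - P) u \<in> T"
    unfolding block_set_quot[OF fin b u] block_set_quot[OF fin b rI] q m by blast
qed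

text \<open>Here T equals \<open>vecs A\<close>: any \<open>t\<close> is its part in A, an element
  of T, plus its part outside A, an element of J, so the latter is zero.\<close>

lemma (in complementing) splits_faces:
  assumes A: "A \<subseteq> I" and T: "vecs A \<subseteq> T" and J: "vecs (I - A) \<subseteq> J"
  shows "splits I P T"
proof -
  have "t \<in> vecs A" if t: "t \<in> T" for t
  proof -
    have tI: "t \<in> vecs I" using subT t by blast
    have "restr A t \<in> T" using T tI by (auto simp: vecs_iff subset_iff)
    moreover have "restr (I - A) t \<in> J" using J tI by (auto simp: vecs_iff subset_iff)
    ultimately have "restr (I - A) t = 0"
      using not_in_T t restr_split[OF tI, of A] by metis
    then have "t = restr A t" using restr_split[OF tI, of A] by simp
    then show ?thesis by (metis vecs_iff entry_restr)
  qed
  then have "T = vecs A" using T by blast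
  moreover have "u \<in> vecs A \<longleftrightarrow> restr P u \<in> vecs A \<and> restr (I - P) u \<in> vecs A" if "u \<in> vecs I" for u
    using restr_split[OF that, of P] vecs_add[of "restr P u" "restr (I - P) u" A] by simp
  ultimately show ?thesis by (simp add: splits_def)
qed

text \<open>The last two premises yield the constraint that a weight imposes on \<open>\<delta>\<close> at the root.\<close>

inductive decomposes :: "'v set \<Rightarrow> 'v \<Rightarrow> nat \<Rightarrow> ('v \<Rightarrow>\<^sub>0 nat) set \<Rightarrow> ('v \<Rightarrow>\<^sub>0 nat) set \<Rightarrow> bool"
  for I :: "'v set" and z :: 'v and \<delta> :: nat and T J :: "('v \<Rightarrow>\<^sub>0 nat) set" where
  decomposesI: "decomposes I z \<delta> T J"
    if "X \<subseteq> I" "card X \<ge> 2" "\<And>x. x \<in> X \<Longrightarrow> a x > 0"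
      "\<And>x. x \<in> X \<Longrightarrow> interval_pair (N x) (C x, D x)" "indecomposable (insert z (I - X)) T' J'"
      "T = gen I X z N a C \<delta> T'" "J = gen I X z N a D (1 - \<delta>) J'"
      "\<delta> = 1 \<Longrightarrow> \<exists>j\<in>J'. entry j z > 0" "\<delta> = 0 \<Longrightarrow> \<exists>t\<in>T'. entry t z > 0"

lemma decomposes_swap: "decomposes I z 1 T J \<Longrightarrow> decomposes I z 0 J T"
proof (erule decomposes.cases)
  fix X a N C D T' J'
  assume h: "X \<subseteq> I" "card X \<ge> 2" "\<And>x. x \<in> X \<Longrightarrow> a x > 0"
      "\<And>x. x \<in> X \<Longrightarrow> interval_pair (N x) (C x, D x)" "indecomposable (insert z (I - X)) T' J'"
      "T = gen I X z N a C 1 T'" "J = gen I X z N a D (1 - 1) J'" "1 = 1 \<Longrightarrow> \<exists>j\<in>J'. entry j z > 0"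
  show "decomposes I z 0 J T"
    by (rule decomposesI[OF h(1-3) interval_pair_swap[OF h(4)] indecomposable_swap[OF h(5)]]) (simp_all add: h(6-8))
qed

lemma (in complementing) split_off_face:
  assumes p: "indecomposable I T J" and z: "z \<notin> I" and b: "block I N T J"
    and A: "A \<subseteq> I" "\<And>i k. i \<in> A \<Longrightarrow> unit_vec i k \<in> quot I N T" "\<not> vecs A \<subseteq> quot I N T"
  shows "decomposes I z 1 T J"
proof -
  let ?bad = "\<lambda>X. X \<subseteq> A \<and> \<not> vecs X \<subseteq> quot I N T"
  obtain X where X: "?bad X" and min: "\<And>Y. ?bad Y \<Longrightarrow> card X \<le> card Y"
    using ex_has_least_nat[of ?bad A card] A by blast
  have XI: "X \<subseteq> I" using X A by blast
  have finX: "finite X" using XI fin finite_subset by blast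
  interpret Q: complementing I "quot I N T" "quot I N J" by (rule quot_complementing[OF b])
  have face: "vecs (X - {x}) \<subseteq> quot I N T" if "x \<in> X" for x
    using min[of "X - {x}"] X that finX by (metis Diff_subset card_Diff1_less not_le subset_trans)
  have "u = 0" if "u \<in> vecs {}" for u :: "'v \<Rightarrow>\<^sub>0 nat"
    using that by (intro poly_mapping_eqI) (simp add: vecs_iff)
  then have "X \<noteq> {}" using X Q.zero by blast
  moreover have "X \<noteq> {x}" for x
    using X A(2)[of x] vecs_axis by (metis insert_subset subsetI)
  ultimately have X2: "card X \<ge> 2"
    using finX by (metis One_nat_def card_0_eq card_1_singletonE less_2_cases not_le)
  have "X \<noteq> {}" by fact
  obtain a where a: "\<And>x. x \<in> X \<Longrightarrow> a x \<ge> 1" and aJ: "vec X a \<in> quot I N J"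
    and L: "\<And>v. v \<in> vecs X \<Longrightarrow> \<exists>x\<in>X. entry v x < a x \<Longrightarrow> v \<in> quot I N T"
    using Q.minimal_face[OF XI face] X by blast
  \<comment> \<open>The face was found in the quotient by \<open>N\<close>, but the step may remove
    digits on X only, so division takes place in the quotient by \<open>?M\<close>. On vectors of
    the face X the two quotients agree (\<open>qX\<close>), and so \<open>a\<close> and the vectors
    below it carry over.\<close>
  let ?M = "\<lambda>i. if i \<in> X then N i else 1"
  have bM: "block I ?M T J" by (rule block_restrict[OF b])
  interpret R: complementing I "quot I ?M T" "quot I ?M J" by (rule quot_complementing[OF bM])
  have qX: "v \<in> quot I ?M B \<longleftrightarrow> v \<in> quot I N B" if "v \<in> vecs X" for v B
  proof -
    have "vec I (\<lambda>i. ?M i * entry v i) = vec I (\<lambda>i. N i * entry v i)"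
      using that fin by (intro poly_mapping_eqI) (auto simp: entry_vec vecs_iff)
    then show ?thesis by (simp add: quot_def)
  qed
  have div: "(v + c \<in> quot I ?M T \<longleftrightarrow> c \<in> quot I ?M T) \<and> (v + c \<in> quot I ?M J \<longrightarrow> v = 0)"
    if "v \<in> vecs X" "\<exists>x\<in>X. entry v x < a x" "c \<in> vecs I" "\<exists>m. \<forall>x\<in>X. entry c x = m * a x" for v c
    using that finX a aJ qX L by (intro R.division[OF XI \<open>X \<noteq> {}\<close>, of a]) auto
  have N: "N x > 0" for x using b by (simp add: block_def Suc_le_eq)
  interpret G: merge I X z N a
    using fin XI \<open>X \<noteq> {}\<close> z N a by unfold_locales (auto simp: Suc_le_eq)
  let ?C = "\<lambda>x. {c. c < N x \<and> unit_vec x c \<in> T}" and ?D = "\<lambda>x. {c. c < N x \<and> unit_vec x c \<in> J}"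
  \<comment> \<open>The smaller pair is read off from T and J on vectors with zero digits and zero
    \<open>L_a\<close>-part, that is, whose X-part is a multiple of the vector with entries
    \<open>a x * N x\<close>.\<close>
  let ?f = "G.en (\<lambda>_. 0) (\<lambda>_. 0)"
  let ?T = "{w \<in> vecs G.I'. ?f w \<in> T}" and ?J = "{w \<in> vecs G.I'. ?f w \<in> J}"
  have iv: "interval_pair (N x) (?C x, ?D x)" if "x \<in> X" for x
    using block_interval_pair[OF b, of x] XI that by auto
  \<comment> \<open>Without its digits on X, \<open>u\<close> becomes \<open>v u + c u\<close>,
    where \<open>v u\<close> belongs to \<open>L_a\<close> and the X-part of \<open>c u\<close> is a
    multiple of \<open>a\<close>. This is the form that the division lemma handles.\<close>
  define v where "v u = vec X (\<lambda>x. entry u x div N x - a x * G.lo u)" for u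
  define c where "c u = vec I (\<lambda>i. if i \<in> X then a i * G.lo u else entry u i)" for u
  have q: "vec I (\<lambda>i. entry u i div ?M i) = v u + c u" if "u \<in> vecs I" for u
    using that fin finX XI G.lo_le[of _ u]
    by (intro poly_mapping_eqI) (auto simp: v_def c_def entry_vec lookup_add)
  have vX: "v u \<in> vecs X" "\<exists>x\<in>X. entry (v u) x < a x" if "u \<in> vecs I" for u
    using finX G.decode(2)[OF that] by (auto simp: v_def entry_vec)
  have cM: "c u \<in> vecs I" "\<exists>m. \<forall>x\<in>X. entry (c u) x = m * a x" for u
    using fin XI by (auto simp: c_def entry_vec mult.commute)
  have cf: "c u \<in> quot I ?M B \<longleftrightarrow> ?f (G.pk (G.lo u) u) \<in> B" if "u \<in> vecs I" for u B
  proof -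
    have "vec I (\<lambda>i. ?M i * entry (c u) i) = ?f (G.pk (G.lo u) u)"
      using fin XI z by (intro poly_mapping_eqI) (auto simp: c_def entry_vec G.entry_en G.entry_pk)
    then show ?thesis using cM(1) by (simp add: quot_def)
  qed
  have dig: "(\<forall>i\<in>I. unit_vec i (entry u i mod ?M i) \<in> B) \<longleftrightarrow> (\<forall>x\<in>X. entry u x mod N x \<in> {c. c < N x \<and> unit_vec x c \<in> B})"
    if "0 \<in> B" for u B
    using that XI N by auto
  have memT: "u \<in> T \<longleftrightarrow> u \<in> G.ge ?C 1 ?T" if u: "u \<in> vecs I" for u
  proof -
    have "u \<in> T \<longleftrightarrow> (\<forall>i\<in>I. unit_vec i (entry u i mod ?M i) \<in> T) \<and> v u + c u \<in> quot I ?M T"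
      using block_set_quot[OF fin _ u, of ?M T] bM unfolding block_def q[OF u] by blast
    also have "v u + c u \<in> quot I ?M T \<longleftrightarrow> ?f (G.pk (G.lo u) u) \<in> T"
      using div[OF vX[OF u] cM] cf[OF u] by blast
    also have "(\<forall>i\<in>I. unit_vec i (entry u i mod ?M i) \<in> T) \<longleftrightarrow> (\<forall>x\<in>X. entry u x mod N x \<in> ?C x)"
      by (rule dig[OF zero(1)])
    finally show ?thesis using u by (simp add: gen_def)
  qed
  have memJ: "u \<in> J \<longleftrightarrow> u \<in> G.ge ?D 0 ?J" if u: "u \<in> vecs I" for u
  proof -
    have "u \<in> J \<longleftrightarrow> (\<forall>i\<in>I. unit_vec i (entry u i mod ?M i) \<in> J) \<and> v u + c u \<in> quot I ?M J"
      using block_set_quot[OF fin _ u, of ?M J] bM unfolding block_def q[OF u] by blast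
    also have "v u + c u \<in> quot I ?M J \<longleftrightarrow> v u = 0 \<and> c u \<in> quot I ?M J"
      using div[OF vX[OF u] cM[of u]] by (cases "v u = 0") simp_all
    also have "c u \<in> quot I ?M J \<longleftrightarrow> ?f (G.pk (G.lo u) u) \<in> J"
      by (rule cf[OF u])
    also have "v u = 0 \<longleftrightarrow> (\<forall>x\<in>X. entry u x div N x = a x * G.lo u)"
      using finX G.lo_le[of _ u] by (auto simp: v_def poly_mapping_eq_iff fun_eq_iff entry_vec intro: le_antisym)
    also have "(\<forall>i\<in>I. unit_vec i (entry u i mod ?M i) \<in> J) \<longleftrightarrow> (\<forall>x\<in>X. entry u x mod N x \<in> ?D x)"
      by (rule dig[OF zero(2)])
    finally show ?thesis using u by (auto simp: gen_def)
  qed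
  have ext: "B = B'" if "B \<subseteq> vecs I" "B' \<subseteq> vecs I" "\<And>u. u \<in> vecs I \<Longrightarrow> u \<in> B \<longleftrightarrow> u \<in> B'"
    for B B' :: "('v \<Rightarrow>\<^sub>0 nat) set"
    using that by blast
  have geI: "G.ge B \<delta> R \<subseteq> vecs I" for B \<delta> R by (auto simp: gen_def)
  have T: "T = G.ge ?C 1 ?T" by (rule ext[OF subT geI memT])
  have J: "J = G.ge ?D 0 ?J" by (rule ext[OF subJ geI memJ])
  have sub: "?T \<subseteq> vecs G.I'" "?J \<subseteq> vecs G.I'" by auto
  have pr: "indecomposable G.I' ?T ?J"
    using G.indecomposable_of_ge[OF iv sub, of 1] p T J by simp
  \<comment> \<open>The unit vector of \<open>z\<close> encodes \<open>a\<close> scaled by the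
    bases, and this lies in J because \<open>a\<close> lies in the quotient of J.\<close>
  have pos: "\<exists>j\<in>?J. entry j z > 0"
  proof
    have "?f (unit_vec z 1) = vec I (\<lambda>i. N i * entry (vec X a) i)"
      using fin finX XI z by (intro poly_mapping_eqI) (auto simp: G.entry_en entry_vec entry_single)
    then show "unit_vec z 1 \<in> ?J" using aJ by (simp add: quot_def)
  qed simp
  show ?thesis
    by (rule decomposesI[OF XI X2 G.a iv pr T _ pos]) (simp_all add: J[symmetric])
qed

text \<open>The axes fall into A, contained in the reduced T, and the rest, contained in the reduced
  J. If both spanned faces were contained too, \<open>splits_faces\<close> would split the pair. A
  failing face of T gives \<delta> = 1, and one of J gives \<delta> = 0 after exchanging the two
  sets.\<close>

lemma indecomposable_decompose:
  assumes p: "indecomposable I T J" and I2: "card I \<ge> 2" and z: "z \<notin> I"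
  shows "\<exists>\<delta>\<in>{0, 1}. decomposes I z \<delta> T J"
proof -
  interpret complementing I T J using p by (simp add: indecomposable_def)
  interpret S: complementing I J T by (rule swap)
  have ns: "\<not> splits I {i} T" if "i \<in> I" for i
  proof
    assume s: "splits I {i} T"
    then have "splits I {i} J" using S.splits_T that by simp
    moreover have "{i} \<subset> I" using that I2 by auto
    ultimately show False using p s unfolding indecomposable_def by blast
  qed
  obtain N where b: "block I N T J"
    and ax: "\<And>i. i \<in> I \<Longrightarrow> (\<forall>k. unit_vec i k \<in> quot I N T) \<or> (\<forall>k. unit_vec i k \<in> quot I N J)"
    using reduced_block[OF ns] by blast
  interpret Q: complementing I "quot I N T" "quot I N J" by (rule quot_complementing[OF b])
  define A where "A = {i\<in>I. \<forall>k. unit_vec i k \<in> quot I N T}"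
  have A: "A \<subseteq> I" "\<And>i k. i \<in> A \<Longrightarrow> unit_vec i k \<in> quot I N T"
    "\<And>i k. i \<in> I - A \<Longrightarrow> unit_vec i k \<in> quot I N J"
    using ax by (auto simp: A_def)
  show ?thesis
  proof (cases "vecs A \<subseteq> quot I N T")
    case False
    have "decomposes I z 1 T J" by (rule split_off_face[OF p z b A(1,2) False])
    then show ?thesis by simp
  next
    case T: True
    have J: "\<not> vecs (I - A) \<subseteq> quot I N J"
    proof
      assume J: "vecs (I - A) \<subseteq> quot I N J"
      obtain i where i: "i \<in> I" using I2 by fastforce
      have "splits I {i} (quot I N T)" by (rule Q.splits_faces[OF A(1) T J])
      then have "splits I {i} T" using splits_quot[OF fin _ zero(1)] b by (auto simp: block_def)
      then show False using ns i by blast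
    qed
    have "decomposes I z 1 J T"
      by (rule S.split_off_face[OF indecomposable_swap[OF p] z block_swap[OF b] Diff_subset A(3) J])
    then have "decomposes I z 0 T J" by (rule decomposes_swap)
    then show ?thesis by simp
  qed
qed

section \<open>Power series\<close>

lemma coeff_series: "coeff (series A) m = of_bool (m \<in> A)"
  by (simp add: series_def Mps_inverse)

lemma series_inject: "series A = series B \<longleftrightarrow> A = B"
proof
  assume e: "series A = series B"
  have "m \<in> A \<longleftrightarrow> m \<in> B" for m
    using arg_cong[OF e, of "\<lambda>f. coeff f m"] by (simp add: coeff_series split: split_of_bool_asm)
  then show "A = B" by blast
qed simp

lemma series_zero: "series {0} = 1"
  by (simp add: series_def one_mps_def)

text \<open>Unique sums leave at most one nonzero term in every coefficient of the product, so no
  multiplicities arise.\<close>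

lemma series_mult:
  assumes u: "\<And>a b a' b'. a \<in> A \<Longrightarrow> b \<in> B \<Longrightarrow> a' \<in> A \<Longrightarrow> b' \<in> B \<Longrightarrow> a + b = a' + b' \<Longrightarrow> a = a' \<and> b = b'"
  shows "series A * series B = series {a + b | a b. a \<in> A \<and> b \<in> B}"
proof -
  have "(\<Sum>(k, l) | k + l = m. coeff (series A) k * coeff (series B) l) =
      of_bool (m \<in> {a + b | a b. a \<in> A \<and> b \<in> B})" for m
  proof (cases "\<exists>a\<in>A. \<exists>b\<in>B. m = a + b")
    case True
    then obtain a b where ab: "a \<in> A" "b \<in> B" "m = a + b" by blast
    have "(\<Sum>(k, l) | k + l = m. coeff (series A) k * coeff (series B) l) =
        (\<Sum>(k, l)\<in>{(a, b)}. coeff (series A) k * coeff (series B) l)"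
    proof (rule sum.mono_neutral_right)
      show "\<forall>i\<in>{(k, l). k + l = m} - {(a, b)}. (case i of (k, l) \<Rightarrow> coeff (series A) k * coeff (series B) l) = 0"
      proof
        fix i assume i: "i \<in> {(k, l). k + l = m} - {(a, b)}"
        obtain k l where kl: "i = (k, l)" by (cases i)
        have "\<not> (k \<in> A \<and> l \<in> B)" using u[of k l a b] ab i kl by auto
        then show "(case i of (k, l) \<Rightarrow> coeff (series A) k * coeff (series B) l) = 0"
          by (auto simp: kl coeff_series)
      qed
    qed (use ab finite_antidiagonal in auto)
    also have "\<dots> = 1" using ab by (simp add: coeff_series)
    finally show ?thesis using ab by auto
  next
    case False
    then show ?thesis by (subst sum.neutral) (auto simp: coeff_series)
  qed
  then show ?thesis by (simp add: times_mps_def series_def[of "{a + b | a b. a \<in> A \<and> b \<in> B}"])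
qed

lemma mps_subst_series:
  assumes "inj_on (expo_subst \<sigma>) A"
  shows "mps_subst \<sigma> (series A) = series (expo_subst \<sigma> ` A)"
proof -
  have "(\<Sum>u | coeff (series A) u \<noteq> 0 \<and> expo_subst \<sigma> u = m. coeff (series A) u) =
      of_bool (m \<in> expo_subst \<sigma> ` A)" for m
  proof (cases "m \<in> expo_subst \<sigma> ` A")
    case True
    then obtain u where u: "u \<in> A" "m = expo_subst \<sigma> u" by blast
    have "{u. coeff (series A) u \<noteq> 0 \<and> expo_subst \<sigma> u = m} = {u}"
      using u inj_onD[OF assms] by (auto simp: coeff_series)
    then show ?thesis using u by (simp add: coeff_series)
  next
    case False
    then show ?thesis by (subst sum.neutral) (auto simp: coeff_series)
  qed
  then show ?thesis unfolding mps_subst_def series_def[of "expo_subst \<sigma> ` A"] by presburger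
qed

lemma entry_expo_subst: "entry (expo_subst \<sigma> u) j = (\<Sum>i\<in>Poly_Mapping.keys u. entry u i * entry (\<sigma> i) j)"
  unfolding expo_subst_def lookup_sum by (rule sum.cong) (auto simp: Poly_Mapping.map.rep_eq when_def)

lemma entry_expo_subst_vecs:
  "finite K \<Longrightarrow> u \<in> vecs K \<Longrightarrow> entry (expo_subst \<sigma> u) j = (\<Sum>i\<in>K. entry u i * entry (\<sigma> i) j)"
  unfolding entry_expo_subst by (rule sum.mono_neutral_left) (auto simp: vecs_def in_keys_iff)

lemma prod_series1:
  "finite X \<Longrightarrow> (\<Prod>x\<in>X. series1 (C x) x) = series {u \<in> vecs X. \<forall>x\<in>X. entry u x \<in> C x}"
proof (induction X rule: finite_induct)
  case empty
  have "{u \<in> vecs {}. \<forall>x\<in>{}. entry u x \<in> C x} = {0}"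
    by (auto simp: vecs_iff poly_mapping_eq_iff fun_eq_iff)
  then show ?case by (simp add: series_zero)
next
  case (insert x X)
  let ?P = "{u \<in> vecs X. \<forall>x\<in>X. entry u x \<in> C x}"
  let ?S = "unit_vec x ` C x"
  have "a = a' \<and> b = b'" if h: "a \<in> ?S" "b \<in> ?P" "a' \<in> ?S" "b' \<in> ?P" "a + b = a' + b'" for a b a' b'
  proof -
    obtain c c' where c: "a = unit_vec x c" "a' = unit_vec x c'" using h(1,3) by blast
    have "entry b x = 0" "entry b' x = 0" using h insert.hyps by (auto simp: vecs_iff)
    then have "c = c'"
      using arg_cong[OF h(5), of "\<lambda>u. entry u x"] c by (simp add: lookup_add)
    then show ?thesis using c h by simp
  qed
  then have "series ?S * series ?P = series {a + b | a b. a \<in> ?S \<and> b \<in> ?P}"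
    by (rule series_mult)
  also have "{a + b | a b. a \<in> ?S \<and> b \<in> ?P} = {u \<in> vecs (insert x X). \<forall>y\<in>insert x X. entry u y \<in> C y}"
    (is "_ = ?R")
  proof
    show "{a + b | a b. a \<in> ?S \<and> b \<in> ?P} \<subseteq> ?R"
      using insert.hyps by (auto simp: vecs_iff lookup_add entry_single)
    show "?R \<subseteq> {a + b | a b. a \<in> ?S \<and> b \<in> ?P}"
    proof
      fix u assume u: "u \<in> ?R"
      have "u = unit_vec x (entry u x) + restr X u"
        using u insert.hyps by (intro poly_mapping_eqI) (auto simp: vecs_iff lookup_add entry_single)
      moreover have "restr X u \<in> ?P" using u by (auto simp: vecs_iff)
      ultimately show "u \<in> {a + b | a b. a \<in> ?S \<and> b \<in> ?P}" using u by blast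
    qed
  qed
  finally show ?case using insert by (simp add: series1_def)
qed

lemma Lset_eq: "finite X \<Longrightarrow> Lset X a = {v \<in> vecs X. \<exists>x\<in>X. entry v x < a x}"
proof -
  assume X: "finite X"
  have e: "entry (\<Sum>x\<in>X. unit_vec x (a x)) y = (if y \<in> X then a y else 0)" for y
    using X by (simp add: lookup_sum entry_single sum.delta)
  have "v \<in> (\<lambda>u. u + (\<Sum>x\<in>X. unit_vec x (a x))) ` vecs X \<longleftrightarrow> \<not> (\<exists>x\<in>X. entry v x < a x)"
    if v: "v \<in> vecs X" for v
  proof
    assume "\<not> (\<exists>x\<in>X. entry v x < a x)"
    then have "v = vec X (\<lambda>x. entry v x - a x) + (\<Sum>x\<in>X. unit_vec x (a x))"
      using v X by (intro poly_mapping_eqI) (auto simp: lookup_add entry_vec e not_less vecs_iff)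
    then show "v \<in> (\<lambda>u. u + (\<Sum>x\<in>X. unit_vec x (a x))) ` vecs X" using X by force
  qed (auto simp: lookup_add e)
  then show ?thesis by (auto simp: Lset_def)
qed

section \<open>The generation formula as a product of power series\<close>

context merge
begin

definition subst_z :: "'v \<Rightarrow> ('v \<Rightarrow>\<^sub>0 nat)" where
  "subst_z = (\<lambda>y. if y = z then \<Sum>x\<in>X. unit_vec x (a x * N x) else unit_vec y 1)"

lemma entry_subst_z:
  assumes "w \<in> vecs I'"
  shows "entry (expo_subst subst_z w) j = (if j \<in> X then a j * N j * entry w z else if j \<in> I then entry w j else 0)"
proof -
  have "entry (expo_subst subst_z w) j = (\<Sum>i\<in>I'. entry w i * entry (subst_z i) j)"
    by (rule entry_expo_subst_vecs[OF fin' assms])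
  also have "\<dots> = entry w z * entry (subst_z z) j + (\<Sum>i\<in>I - X. entry w i * entry (subst_z i) j)"
    using fin z by simp
  also have "(\<Sum>i\<in>I - X. entry w i * entry (subst_z i) j) = (\<Sum>i\<in>I - X. if i = j then entry w i else 0)"
    using z by (intro sum.cong) (auto simp: subst_z_def entry_single)
  also have "\<dots> = (if j \<in> I - X then entry w j else 0)" using fin by simp
  also have "entry (subst_z z) j = (if j \<in> X then a j * N j else 0)"
    using finX by (simp add: subst_z_def lookup_sum entry_single)
  finally show ?thesis using X by auto
qed

lemma entry_scale: "entry (expo_subst (\<lambda>x. unit_vec x (N x)) u) j = entry u j * N j"
proof -
  have "entry (expo_subst (\<lambda>x. unit_vec x (N x)) u) j =
      (\<Sum>i\<in>Poly_Mapping.keys u. if i = j then entry u j * N j else 0)"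
    unfolding entry_expo_subst by (rule sum.cong) (auto simp: entry_single)
  then show ?thesis by (simp add: in_keys_iff)
qed

text \<open>By \<open>en0\<close> a sum of exponents, one from each of the three factors, is an
  encoding. Encodings determine their parts, so both products have unique sums and
  \<open>series_mult\<close> turns them into sums of sets.\<close>

lemma series_ge:
  assumes C: "\<And>x c. x \<in> X \<Longrightarrow> c \<in> C x \<Longrightarrow> c < N x" and T: "T \<subseteq> vecs I'" and \<delta>: "\<delta> \<in> {0, 1}"
  shows "series (ge C \<delta> T) = (\<Prod>x\<in>X. series1 (C x) x) *
    mps_subst (\<lambda>x. unit_vec x (N x)) (series (Lset X a) ^ \<delta>) * mps_subst subst_z (series T)"
proof -
  let ?ex = "expo_subst (\<lambda>x. unit_vec x (N x))" and ?es = "expo_subst subst_z"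
  let ?P = "{u \<in> vecs X. \<forall>x\<in>X. entry u x \<in> C x}"
  \<comment> \<open>One set for both exponents: the zeroth power of a series is 1, the series of
    \<open>{0}\<close>.\<close>
  define L where "L = (if \<delta> = 0 then {0} else Lset X a)"
  have L: "v \<in> L \<Longrightarrow> v \<in> vecs X \<and> (\<exists>x\<in>X. entry v x < a x)" for v
    using X a finX by (cases "\<delta> = 0") (auto simp: L_def Lset_eq)
  have Lp: "series (Lset X a) ^ \<delta> = series L"
    using \<delta> by (auto simp: L_def series_zero)
  have en0: "p + ?ex v + ?es w = en (entry p) (entry v) w" if "p \<in> vecs X" "v \<in> vecs X" "w \<in> vecs I'" for p v w
    using that X by (intro poly_mapping_eqI)
      (auto simp: lookup_add entry_scale entry_subst_z entry_en vecs_iff algebra_simps)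
  have es0: "?es 0 = 0" by (simp add: expo_subst_def)
  have uniq: "p = p' \<and> v = v' \<and> w = w'"
    if h: "p \<in> ?P" "v \<in> L" "w \<in> vecs I'" "p' \<in> ?P" "v' \<in> L" "w' \<in> vecs I'"
      and e: "p + ?ex v + ?es w = p' + ?ex v' + ?es w'" for p v w p' v' w'
  proof -
    have "en (entry p) (entry v) w = en (entry p') (entry v') w'"
      using e en0 h L by simp
    note E = en_eqD[OF this _ _ h(3) _ _ h(6)]
    have "\<forall>x\<in>X. entry p x < N x" "\<forall>x\<in>X. entry p' x < N x" using h C by auto
    then have "\<forall>x\<in>X. entry p x = entry p' x" "\<forall>x\<in>X. entry v x = entry v' x" "w = w'"
      using E L[OF h(2)] L[OF h(5)] by simp_all
    then show ?thesis using h L by (auto intro: vecs_eqI)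
  qed
  have "inj_on ?es T"
  proof (rule inj_onI)
    fix w w' assume h: "w \<in> T" "w' \<in> T" "?es w = ?es w'"
    have "entry w i = entry w' i" if "i \<in> I'" for i
    proof (cases "i = z")
      case True
      obtain x where "x \<in> X" using X by blast
      moreover from this have "a x * N x * entry w z = a x * N x * entry w' z"
        using arg_cong[OF h(3), of "\<lambda>u. entry u x"] entry_subst_z[of w x] entry_subst_z[of w' x] h T
        by (auto simp: subset_iff)
      ultimately show ?thesis using a[of x] N[of x] True by simp
    next
      case False
      then show ?thesis
        using arg_cong[OF h(3), of "\<lambda>u. entry u i"] entry_subst_z[of w i] entry_subst_z[of w' i] h T that
        by (simp add: subset_iff)
    qed
    then show "w = w'" using h T by (intro vecs_eqI[of w I' w']) auto
  qed
  then have sT: "mps_subst subst_z (series T) = series (?es ` T)" by (rule mps_subst_series)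
  have "inj_on ?ex L"
  proof (rule inj_onI)
    fix v v' assume h: "v \<in> L" "v' \<in> L" "?ex v = ?ex v'"
    have "entry v x = entry v' x" if "x \<in> X" for x
      using arg_cong[OF h(3), of "\<lambda>u. entry u x"] N[OF that] by (simp add: entry_scale)
    then show "v = v'" using L h by (intro vecs_eqI[of v X v']) auto
  qed
  then have sL: "mps_subst (\<lambda>x. unit_vec x (N x)) (series L) = series (?ex ` L)" by (rule mps_subst_series)
  let ?PL = "{p + l | p l. p \<in> ?P \<and> l \<in> ?ex ` L}"
  have "series ?P * series (?ex ` L) = series ?PL"
  proof (rule series_mult)
    fix p l p' l' assume h: "p \<in> ?P" "l \<in> ?ex ` L" "p' \<in> ?P" "l' \<in> ?ex ` L" "p + l = p' + l'"
    then obtain v v' where v: "v \<in> L" "l = ?ex v" "v' \<in> L" "l' = ?ex v'" by blast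
    show "p = p' \<and> l = l'" using uniq[of p v 0 p' v' 0] h v es0 by simp
  qed
  moreover have "series ?PL * series (?es ` T) = series {b + t | b t. b \<in> ?PL \<and> t \<in> ?es ` T}"
  proof (rule series_mult)
    fix b t b' t' assume h: "b \<in> ?PL" "t \<in> ?es ` T" "b' \<in> ?PL" "t' \<in> ?es ` T" "b + t = b' + t'"
    then obtain p v p' v' where v: "p \<in> ?P" "v \<in> L" "b = p + ?ex v" "p' \<in> ?P" "v' \<in> L" "b' = p' + ?ex v'"
      by blast
    obtain w w' where w: "w \<in> T" "t = ?es w" "w' \<in> T" "t' = ?es w'" using h by blast
    show "b = b' \<and> t = t'" using uniq[of p v w p' v' w'] v w h T by blast
  qed
  moreover have "{b + t | b t. b \<in> ?PL \<and> t \<in> ?es ` T} = ge C \<delta> T"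
  proof
    show "{b + t | b t. b \<in> ?PL \<and> t \<in> ?es ` T} \<subseteq> ge C \<delta> T"
    proof
      fix u assume "u \<in> {b + t | b t. b \<in> ?PL \<and> t \<in> ?es ` T}"
      then obtain p v w where h: "p \<in> ?P" "v \<in> L" "w \<in> T" "u = p + ?ex v + ?es w" by blast
      then have "u = en (entry p) (entry v) w" using en0 L T by blast
      moreover have "\<delta> = 0 \<longrightarrow> (\<forall>x\<in>X. entry v x = 0)" using h(2) by (auto simp: L_def)
      moreover have "en (entry p) (entry v) w \<in> ge C \<delta> T \<longleftrightarrow>
          (\<forall>x\<in>X. entry p x \<in> C x) \<and> (\<delta> = 0 \<longrightarrow> (\<forall>x\<in>X. entry v x = 0)) \<and> w \<in> T"
        by (rule en_in_ge) (use h C T L[OF h(2)] in auto)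
      ultimately show "u \<in> ge C \<delta> T" using h by simp
    qed
    show "ge C \<delta> T \<subseteq> {b + t | b t. b \<in> ?PL \<and> t \<in> ?es ` T}"
    proof
      fix u assume "u \<in> ge C \<delta> T"
      then obtain c v w where h: "u = en c v w" "\<And>x. x \<in> X \<Longrightarrow> c x \<in> C x"
        "\<exists>x\<in>X. v x < a x" "w \<in> T" "\<delta> = 0 \<Longrightarrow> v = (\<lambda>_. 0)"
        by (rule ge_elim) blast
      have "vec X c \<in> ?P" using h finX by (simp add: entry_vec)
      moreover have "vec X v \<in> L"
        using h finX by (auto simp: L_def Lset_eq entry_vec intro!: poly_mapping_eqI)
      moreover have "u = vec X c + ?ex (vec X v) + ?es w"
        unfolding h(1) using h T finX by (subst en0) (auto intro!: en_cong simp: entry_vec)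
      ultimately show "u \<in> {b + t | b t. b \<in> ?PL \<and> t \<in> ?es ` T}" using h(4) by blast
    qed
  qed
  ultimately show ?thesis by (simp add: prod_series1[OF finX] Lp sL sT)
qed

end

section \<open>Renaming coordinates\<close>

lemma entry_rename:
  assumes f: "inj_on f I" and u: "u \<in> vecs I"
  shows "i \<in> I \<Longrightarrow> entry (rename f u) (f i) = entry u i"
    and "j \<notin> f ` I \<Longrightarrow> entry (rename f u) j = 0"
proof -
  have k: "Poly_Mapping.keys u \<subseteq> I" using u by (simp add: vecs_def)
  show "entry (rename f u) (f i) = entry u i" if i: "i \<in> I"
  proof -
    have "entry (rename f u) (f i) = (\<Sum>l\<in>Poly_Mapping.keys u. if l = i then entry u i else 0)"
      unfolding rename_def entry_expo_subst
      by (rule sum.cong) (use f k i in \<open>auto simp: entry_single dest: inj_onD\<close>)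
    then show ?thesis by (simp add: in_keys_iff)
  qed
  show "entry (rename f u) j = 0" if "j \<notin> f ` I"
    unfolding rename_def entry_expo_subst
    by (rule sum.neutral) (use k that in \<open>auto simp: entry_single\<close>)
qed

lemma rename_eqI:
  assumes f: "inj_on f I" and u: "u \<in> vecs I" and v: "v \<in> vecs (f ` I)"
    and e: "\<And>i. i \<in> I \<Longrightarrow> entry v (f i) = entry u i"
  shows "rename f u = v"
proof (rule poly_mapping_eqI)
  fix j
  show "entry (rename f u) j = entry v j"
    using entry_rename[OF f u] v e by (cases "j \<in> f ` I") (auto simp: vecs_iff)
qed

lemma rename_vecs: "inj_on f I \<Longrightarrow> u \<in> vecs I \<Longrightarrow> rename f u \<in> vecs (f ` I)"
  using entry_rename(2) by (metis vecs_iff)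

lemma rename_inj:
  assumes f: "inj_on f I" and u: "u \<in> vecs I" "v \<in> vecs I" and e: "rename f u = rename f v"
  shows "u = v"
  using u by (rule vecs_eqI) (metis e entry_rename(1)[OF f u(1)] entry_rename(1)[OF f u(2)])

lemma rename_add:
  assumes f: "inj_on f I" and u: "u \<in> vecs I" "v \<in> vecs I"
  shows "rename f (u + v) = rename f u + rename f v"
  by (rule rename_eqI[OF f])
    (use u f in \<open>auto simp: rename_vecs lookup_add entry_rename(1)[OF f]\<close>)

lemma rename_surj:
  assumes f: "inj_on f I" and fin: "finite I" and v: "v \<in> vecs (f ` I)"
  shows "\<exists>u\<in>vecs I. v = rename f u"
proof
  show "vec I (\<lambda>i. entry v (f i)) \<in> vecs I" using fin by simp
  show "v = rename f (vec I (\<lambda>i. entry v (f i)))"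
    by (rule rename_eqI[OF f, symmetric]) (use fin v in \<open>auto simp: entry_vec\<close>)
qed

lemma rename_restr:
  assumes f: "inj_on f I" and u: "u \<in> vecs I" and P: "P \<subseteq> I"
  shows "rename f (restr P u) = restr (f ` P) (rename f u)"
proof (rule rename_eqI[OF f])
  show "restr P u \<in> vecs I" using u by (simp add: vecs_iff)
  show "restr (f ` P) (rename f u) \<in> vecs (f ` I)" using P by (auto simp: vecs_iff)
  show "entry (restr (f ` P) (rename f u)) (f i) = entry (restr P u) i" if "i \<in> I" for i
    using that entry_rename(1)[OF f u] inj_on_image_mem_iff[OF f that P] by simp
qed

lemma rename_comp:
  assumes g: "inj_on g I" and f: "inj_on f (g ` I)" and u: "u \<in> vecs I"
  shows "rename f (rename g u) = rename (f \<circ> g) u"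
proof (rule rename_eqI[OF comp_inj_on[OF g f] u, symmetric])
  show "rename f (rename g u) \<in> vecs ((f \<circ> g) ` I)"
    unfolding image_comp[symmetric] by (rule rename_vecs[OF f rename_vecs[OF g u]])
  show "entry (rename f (rename g u)) ((f \<circ> g) i) = entry u i" if "i \<in> I" for i
    using that entry_rename(1)[OF f rename_vecs[OF g u]] entry_rename(1)[OF g u] by simp
qed

lemma rename_id_on:
  assumes "u \<in> vecs I" "\<And>i. i \<in> I \<Longrightarrow> f i = i"
  shows "rename f u = u"
  by (rule rename_eqI[of f I]) (use assms in \<open>auto simp: inj_on_def image_def\<close>)

lemma rename_in_image:
  assumes f: "inj_on f I" and u: "u \<in> vecs I" and T: "T \<subseteq> vecs I"
  shows "rename f u \<in> rename f ` T \<longleftrightarrow> u \<in> T"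
  using rename_inj[OF f u] T by blast

lemma rename_cong: "u \<in> vecs I \<Longrightarrow> (\<And>i. i \<in> I \<Longrightarrow> f i = g i) \<Longrightarrow> rename f u = rename g u"
  unfolding rename_def expo_subst_def by (rule sum.cong) (auto simp: vecs_def)

lemma complementing_rename:
  assumes p: "complementing I T J" and f: "inj_on f I"
  shows "complementing (f ` I) (rename f ` T) (rename f ` J)"
proof -
  interpret complementing I T J by fact
  show ?thesis
  proof
    show "finite (f ` I)" using fin by simp
    show "rename f ` T \<subseteq> vecs (f ` I)" "rename f ` J \<subseteq> vecs (f ` I)"
      using subT subJ rename_vecs[OF f] by blast+
    show "\<exists>t\<in>rename f ` T. \<exists>j\<in>rename f ` J. v = t + j" if v: "v \<in> vecs (f ` I)" for v
    proof -
      obtain u where u: "u \<in> vecs I" "v = rename f u" using rename_surj[OF f fin v] by blast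
      obtain t j where tj: "t \<in> T" "j \<in> J" "u = t + j" using ex[OF u(1)] by blast
      have "v = rename f t + rename f j" unfolding u tj using tj subT subJ by (intro rename_add[OF f]) auto
      then show ?thesis using tj by blast
    qed
    show "t = t' \<and> j = j'" if h: "t \<in> rename f ` T" "j \<in> rename f ` J" "t' \<in> rename f ` T"
      "j' \<in> rename f ` J" "t + j = t' + j'" for t j t' j'
    proof -
      from h obtain s k s' k' where s: "s \<in> T" "t = rename f s" "k \<in> J" "j = rename f k"
        "s' \<in> T" "t' = rename f s'" "k' \<in> J" "j' = rename f k'" by blast
      have v: "s \<in> vecs I" "k \<in> vecs I" "s' \<in> vecs I" "k' \<in> vecs I" using s subT subJ by auto
      have "rename f (s + k) = rename f (s' + k')"
        using h(5) s rename_add[OF f] v by simp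
      then have "s + k = s' + k'" using rename_inj[OF f] v by simp
      then have "s = s' \<and> k = k'" using uniq s by blast
      then show ?thesis using s by simp
    qed
  qed
qed

lemma splits_rename:
  assumes f: "inj_on f I" and fin: "finite I" and T: "T \<subseteq> vecs I" and P: "P \<subseteq> I"
  shows "splits (f ` I) (f ` P) (rename f ` T) \<longleftrightarrow> splits I P T"
proof -
  have d: "f ` I - f ` P = f ` (I - P)" using f P by (simp add: inj_on_image_set_diff)
  have k: "rename f u \<in> rename f ` T \<longleftrightarrow> u \<in> T"
    "restr (f ` P) (rename f u) \<in> rename f ` T \<longleftrightarrow> restr P u \<in> T"
    "restr (f ` I - f ` P) (rename f u) \<in> rename f ` T \<longleftrightarrow> restr (I - P) u \<in> T" if u: "u \<in> vecs I" for u
  proof -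
    have r: "restr A u \<in> vecs I" for A using u by (simp add: vecs_iff)
    show "rename f u \<in> rename f ` T \<longleftrightarrow> u \<in> T" by (rule rename_in_image[OF f u T])
    show "restr (f ` P) (rename f u) \<in> rename f ` T \<longleftrightarrow> restr P u \<in> T"
      unfolding rename_restr[OF f u P, symmetric] by (rule rename_in_image[OF f r T])
    show "restr (f ` I - f ` P) (rename f u) \<in> rename f ` T \<longleftrightarrow> restr (I - P) u \<in> T"
      unfolding d rename_restr[OF f u Diff_subset, symmetric] by (rule rename_in_image[OF f r T])
  qed
  have "vecs (f ` I) = rename f ` vecs I"
    using rename_surj[OF f fin] rename_vecs[OF f] by blast
  then have "splits (f ` I) (f ` P) (rename f ` T) \<longleftrightarrow> (\<forall>u\<in>vecs I. rename f u \<in> rename f ` T \<longleftrightarrow>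
      restr (f ` P) (rename f u) \<in> rename f ` T \<and> restr (f ` I - f ` P) (rename f u) \<in> rename f ` T)"
    unfolding splits_def by (simp only: ball_simps)
  also have "\<dots> \<longleftrightarrow> splits I P T"
    unfolding splits_def by (rule ball_cong[OF refl]) (simp only: k)
  finally show ?thesis .
qed

lemma indecomposable_rename:
  assumes p: "indecomposable I T J" and f: "inj_on f I"
  shows "indecomposable (f ` I) (rename f ` T) (rename f ` J)"
  unfolding indecomposable_def
proof (intro conjI allI impI notI)
  interpret complementing I T J using p by (simp add: indecomposable_def)
  show "complementing (f ` I) (rename f ` T) (rename f ` J)" by (rule complementing_rename[OF _ f]) unfold_locales
  fix P assume P: "P \<subset> f ` I" "P \<noteq> {}"
    and s: "splits (f ` I) P (rename f ` T) \<and> splits (f ` I) P (rename f ` J)"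
  define Q where "Q = {i \<in> I. f i \<in> P}"
  have Q: "P = f ` Q" "Q \<subset> I" "Q \<noteq> {}" using P by (auto simp: Q_def)
  have "splits I Q T \<and> splits I Q J"
    using s splits_rename[OF f fin subT] splits_rename[OF f fin subJ] Q by auto
  then show False using p Q(2,3) by (auto simp: indecomposable_def)
qed

section \<open>Pairs on the standard coordinates, and Cartesian products as splittings\<close>

lemma npair_iff_complementing: "npair n T J \<longleftrightarrow> complementing {..<n} T J"
proof
  assume h: "npair n T J"
  show "complementing {..<n} T J"
  proof
    show "T \<subseteq> vecs {..<n}" "J \<subseteq> vecs {..<n}" using h by (auto simp: npair_def)
    show "\<exists>t\<in>T. \<exists>j\<in>J. u = t + j" if "u \<in> vecs {..<n}" for u
    proof -
      have "\<exists>!p. p \<in> T \<times> J \<and> u = fst p + snd p" using h that by (simp add: npair_def)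
      then obtain p where p: "p \<in> T \<times> J" "u = fst p + snd p" by (elim ex1E conjE)
      show ?thesis using p(2) p(1)[unfolded mem_Times_iff] by (intro bexI[of _ "fst p"] bexI[of _ "snd p"]) simp_all
    qed
    show "t = t' \<and> j = j'" if hh: "t \<in> T" "j \<in> J" "t' \<in> T" "j' \<in> J" "t + j = t' + j'" for t j t' j'
    proof -
      have "t + j \<in> vecs {..<n}" using h hh by (auto simp: npair_def)
      then have "\<exists>!p. p \<in> T \<times> J \<and> t + j = fst p + snd p" using h by (simp add: npair_def)
      then have "(t, j) = (t', j')" using hh by (metis fst_conv mem_Sigma_iff snd_conv)
      then show ?thesis by simp
    qed
  qed simp
next
  assume "complementing {..<n} T J"
  then interpret complementing "{..<n}" T J .
  have "\<exists>!p. p \<in> T \<times> J \<and> u = fst p + snd p" if u: "u \<in> vecs {..<n}" for u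
  proof -
    obtain t j where tj: "t \<in> T" "j \<in> J" "u = t + j" using ex[OF u] by blast
    show ?thesis
    proof (rule ex1I[of _ "(t, j)"])
      show "p = (t, j)" if "p \<in> T \<times> J \<and> u = fst p + snd p" for p
        using uniq[of "fst p" "snd p" t j] that tj by (cases p) auto
    qed (use tj in simp)
  qed
  then show "npair n T J" using subT subJ by (simp add: npair_def)
qed

text \<open>Entries are nonnegative, so both summands of a vector in a face lie in that
  face.\<close>

lemma (in complementing) face:
  assumes P: "P \<subseteq> I"
  shows "complementing P (T \<inter> vecs P) (J \<inter> vecs P)"
proof
  show "finite P" using P fin finite_subset by blast
  show "\<exists>t\<in>T \<inter> vecs P. \<exists>j\<in>J \<inter> vecs P. u = t + j" if u: "u \<in> vecs P" for u
  proof -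
    obtain t j where tj: "t \<in> T" "j \<in> J" "u = t + j" using ex[OF vecs_mono[OF u P]] by blast
    then show ?thesis using u by (metis IntI vecs_add)
  qed
qed (use uniq in auto)

lemma plus_image_lessThan: "(+) p ` {..<q} = {p..<p + q :: nat}"
  using image_add_atLeastLessThan[of p 0 q] by (simp add: lessThan_atLeast0 add.commute[of q p])

lemma cart_iff:
  assumes A: "A \<subseteq> vecs {..<p}" and B: "B \<subseteq> vecs {..<q}" and u: "u \<in> vecs {..<p + q}"
  shows "u \<in> cart p A B \<longleftrightarrow> restr {..<p} u \<in> A \<and> vec {..<q} (\<lambda>i. entry u (p + i)) \<in> B"
proof -
  have inj: "inj_on ((+) p) {..<q}" by simp
  have im: "(+) p ` {..<q} = {p..<p + q}" by (rule plus_image_lessThan)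
  show ?thesis
  proof
    assume "u \<in> cart p A B"
    then obtain a b where ab: "a \<in> A" "b \<in> B" "u = a + rename ((+) p) b" by (auto simp: cart_def)
    have v: "a \<in> vecs {..<p}" "b \<in> vecs {..<q}" using ab A B by auto
    have rv: "rename ((+) p) b \<in> vecs {p..<p + q}" using rename_vecs[OF inj v(2)] im by simp
    have "restr {..<p} u = a"
      unfolding ab using v rv by (intro poly_mapping_eqI) (auto simp: lookup_add vecs_iff)
    moreover have "vec {..<q} (\<lambda>i. entry u (p + i)) = b"
      unfolding ab using v entry_rename(1)[OF inj v(2)]
      by (intro poly_mapping_eqI) (auto simp: lookup_add vecs_iff entry_vec)
    ultimately show "restr {..<p} u \<in> A \<and> vec {..<q} (\<lambda>i. entry u (p + i)) \<in> B" using ab by simp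
  next
    assume h: "restr {..<p} u \<in> A \<and> vec {..<q} (\<lambda>i. entry u (p + i)) \<in> B"
    have "rename ((+) p) (vec {..<q} (\<lambda>i. entry u (p + i))) = restr {p..<p + q} u"
      by (rule rename_eqI[OF inj]) (use im in \<open>auto simp: entry_vec vecs_iff\<close>)
    moreover have "u = restr {..<p} u + restr {p..<p + q} u"
      using u by (intro poly_mapping_eqI) (auto simp: lookup_add vecs_iff)
    ultimately show "u \<in> cart p A B" using h unfolding cart_def by force
  qed
qed

lemma splits_cart:
  assumes A: "A \<subseteq> vecs {..<p}" "0 \<in> A" and B: "B \<subseteq> vecs {..<q}" "0 \<in> B"
  shows "splits {..<p + q} {..<p} (cart p A B)"
  unfolding splits_def
proof
  fix u :: "nat \<Rightarrow>\<^sub>0 nat" assume u: "u \<in> vecs {..<p + q}"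
  let ?R = "{..<p + q} - {..<p}"
  let ?v = "\<lambda>u. vec {..<q} (\<lambda>i. entry u (p + i))"
  have r: "restr P u \<in> vecs {..<p + q}" for P using u by (simp add: vecs_iff)
  have e: "restr {..<p} (restr {..<p} u) = restr {..<p} u" "?v (restr {..<p} u) = 0"
    "restr {..<p} (restr ?R u) = 0" "?v (restr ?R u) = ?v u"
    by (auto intro!: poly_mapping_eqI simp: entry_vec)
  show "u \<in> cart p A B \<longleftrightarrow> restr {..<p} u \<in> cart p A B \<and> restr ?R u \<in> cart p A B"
    unfolding cart_iff[OF A(1) B(1) u] cart_iff[OF A(1) B(1) r] e using A B by simp
qed

lemma splits_sum:
  assumes s: "splits I P T" and T: "T \<subseteq> vecs I" and P: "P \<subseteq> I"
  shows "T = {t + s | t s. t \<in> T \<inter> vecs P \<and> s \<in> T \<inter> vecs (I - P)}"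
proof
  show "T \<subseteq> {t + s | t s. t \<in> T \<inter> vecs P \<and> s \<in> T \<inter> vecs (I - P)}"
  proof
    fix u assume u: "u \<in> T"
    then have "u = restr P u + restr (I - P) u" "restr P u \<in> T" "restr (I - P) u \<in> T"
      using s T restr_split[of u I P] by (auto simp: splits_def)
    moreover have "restr P u \<in> vecs P" "restr (I - P) u \<in> vecs (I - P)" by (auto simp: vecs_iff)
    ultimately show "u \<in> {t + s | t s. t \<in> T \<inter> vecs P \<and> s \<in> T \<inter> vecs (I - P)}" by blast
  qed
  show "{t + s | t s. t \<in> T \<inter> vecs P \<and> s \<in> T \<inter> vecs (I - P)} \<subseteq> T"
  proof clarify
    fix t s' assume h: "t \<in> T" "t \<in> vecs P" "s' \<in> T" "s' \<in> vecs (I - P)"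
    have "restr P (t + s') = t" "restr (I - P) (t + s') = s'"
      using h P by (auto intro!: poly_mapping_eqI simp: lookup_add vecs_iff)
    moreover have "t + s' \<in> vecs I" using h T by auto
    ultimately show "t + s' \<in> T" using s h by (auto simp: splits_def)
  qed
qed

lemma primitive_pair_iff_indecomposable: "primitive_pair n T J \<longleftrightarrow> indecomposable {..<n} T J"
proof
  assume pr: "indecomposable {..<n} T J"
  then have cp: "complementing {..<n} T J" by (simp add: indecomposable_def)
  interpret complementing "{..<n}" T J by (rule cp)
  show "primitive_pair n T J"
    unfolding primitive_pair_def
  proof (intro conjI notI)
    show "npair n T J" using cp npair_iff_complementing by blast
    assume "\<exists>p q I1 J1 I2 J2 \<pi>. p \<ge> 1 \<and> q \<ge> 1 \<and> p + q = n \<and>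
          npair p I1 J1 \<and> npair q I2 J2 \<and> \<pi> permutes {..<n} \<and>
          T = rename \<pi> ` cart p I1 I2 \<and> J = rename \<pi> ` cart p J1 J2"
    then obtain p q I1 J1 I2 J2 \<pi> where h: "p \<ge> 1" "q \<ge> 1" "p + q = n"
      "complementing {..<p} I1 J1" "complementing {..<q} I2 J2" "\<pi> permutes {..<n}"
      "T = rename \<pi> ` cart p I1 I2" "J = rename \<pi> ` cart p J1 J2"
      unfolding npair_iff_complementing by blast
    interpret A: complementing "{..<p}" I1 J1 by fact
    interpret B: complementing "{..<q}" I2 J2 by fact
    have inj: "inj_on \<pi> {..<n}" using h(6) permutes_inj_on by blast
    have im: "\<pi> ` {..<n} = {..<n}" using h(6) permutes_image by blast
    have cv: "cart p A B \<subseteq> vecs {..<n}" if "A \<subseteq> vecs {..<p}" "B \<subseteq> vecs {..<q}" for A B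
    proof -
      have "(+) p ` {..<q} \<subseteq> {..<n}" using h(3) by auto
      then have "rename ((+) p) b \<in> vecs {..<n}" if "b \<in> vecs {..<q}" for b
        using rename_vecs[of "(+) p" "{..<q}" b] that vecs_mono by (metis inj_on_add)
      moreover have "a \<in> vecs {..<n}" if "a \<in> vecs {..<p}" for a
        using that h(3) vecs_mono[of a "{..<p}" "{..<n}"] by auto
      ultimately show ?thesis using subsetD[OF that(1)] subsetD[OF that(2)] by (auto simp: cart_def)
    qed
    have le: "{..<p} \<subseteq> {..<n}" using h(3) by auto
    have "splits {..<n} {..<p} (cart p I1 I2)" "splits {..<n} {..<p} (cart p J1 J2)"
      unfolding h(3)[symmetric]
      using A.subT A.subJ A.zero B.subT B.subJ B.zero by (auto intro!: splits_cart)
    then have "splits {..<n} (\<pi> ` {..<p}) T" "splits {..<n} (\<pi> ` {..<p}) J"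
      using splits_rename[OF inj _ cv[OF A.subT B.subT] le] splits_rename[OF inj _ cv[OF A.subJ B.subJ] le] im
      unfolding h(7,8) by simp_all
    moreover have "\<pi> ` {..<p} \<subset> {..<n}"
    proof -
      have "{..<p} \<subset> {..<n}" using h(2,3) by auto
      then have "\<pi> ` {..<p} \<subset> \<pi> ` {..<n}" by (rule image_strict_mono[OF inj])
      then show ?thesis using im by simp
    qed
    moreover have "\<pi> ` {..<p} \<noteq> {}" using h(1) by (simp add: lessThan_empty_iff)
    ultimately show False using pr unfolding indecomposable_def by blast
  qed
next
  assume pr: "primitive_pair n T J"
  then have cp: "complementing {..<n} T J" by (simp add: primitive_pair_def npair_iff_complementing)
  interpret complementing "{..<n}" T J by (rule cp)
  show "indecomposable {..<n} T J"
    unfolding indecomposable_def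
  proof (intro conjI allI impI notI)
    show "complementing {..<n} T J" by (rule cp)
    fix P assume P: "P \<subset> {..<n}" "P \<noteq> {}" and s: "splits {..<n} P T \<and> splits {..<n} P J"
    let ?Q = "{..<n} - P"
    define p q where "p = card P" and "q = n - p"
    have fP: "finite P" "P \<subseteq> {..<n}" using P finite_subset[of P "{..<n}"] by auto
    have "p < n" unfolding p_def using psubset_card_mono[OF _ P(1)] by simp
    moreover have "p \<ge> 1" using P(2) fP(1) by (simp add: p_def Suc_le_eq card_gt_0_iff)
    ultimately have pq: "p \<ge> 1" "q \<ge> 1" "p + q = n" by (auto simp: q_def)
    have cQ: "card ?Q = q" using fP by (simp add: card_Diff_subset p_def q_def)
    have "\<exists>f. bij_betw f P {..<p}" by (rule finite_same_card_bij[OF fP(1)]) (simp_all add: p_def)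
    then obtain f where f: "bij_betw f P {..<p}" ..
    have "\<exists>g. bij_betw g ?Q {..<q}" by (rule finite_same_card_bij) (simp_all add: cQ)
    then obtain g where g: "bij_betw g ?Q {..<q}" ..
    \<comment> \<open>Lists the coordinates of P first and the others after them. Outside
      \<open>{..<n}\<close> it is the identity, as \<open>permutes\<close> demands.\<close>
    define \<sigma> where "\<sigma> i = (if i \<in> P then f i else if i < n then p + g i else i)" for i
    have "bij_betw \<sigma> P {..<p}" using f by (rule bij_betw_cong[THEN iffD1, rotated]) (simp add: \<sigma>_def)
    moreover have "bij_betw ((+) p \<circ> g) ?Q {p..<p + q}"
      by (rule bij_betw_trans[OF g], rule bij_betw_imageI[OF _ plus_image_lessThan]) simp
    then have "bij_betw \<sigma> ?Q {p..<p + q}"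
      by (rule bij_betw_cong[THEN iffD1, rotated]) (simp add: \<sigma>_def)
    ultimately have "bij_betw \<sigma> (P \<union> ?Q) ({..<p} \<union> {p..<p + q})"
      by (rule bij_betw_combine) auto
    moreover have "P \<union> ?Q = {..<n}" "{..<p} \<union> {p..<p + q} = {..<n}" using fP pq by auto
    ultimately have "bij_betw \<sigma> {..<n} {..<n}" by simp
    then have perm: "\<sigma> permutes {..<n}"
      by (rule bij_imp_permutes) (use fP in \<open>auto simp: \<sigma>_def\<close>)
    \<comment> \<open>The Cartesian product has the coordinates of P in front; the inverse of
      \<sigma> moves them back, for T and J alike.\<close>
    let ?\<pi> = "inv \<sigma>"
    have perm': "?\<pi> permutes {..<n}" by (rule permutes_inv[OF perm])
    have fi: "inj_on f P" "f ` P = {..<p}" and gi: "inj_on g ?Q" "g ` ?Q = {..<q}"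
      using f g by (auto simp: bij_betw_def)
    have c1: "complementing {..<p} (rename f ` (T \<inter> vecs P)) (rename f ` (J \<inter> vecs P))"
      using complementing_rename[OF face[OF fP(2)] fi(1)] fi(2) by simp
    have c2: "complementing {..<q} (rename g ` (T \<inter> vecs ?Q)) (rename g ` (J \<inter> vecs ?Q))"
      using complementing_rename[OF face[of ?Q] gi(1)] gi(2) by simp
    have eq: "A = rename ?\<pi> ` cart p (rename f ` (A \<inter> vecs P)) (rename g ` (A \<inter> vecs ?Q))"
      if A: "A \<subseteq> vecs {..<n}" and sA: "splits {..<n} P A" for A
    proof -
      have undo: "rename ?\<pi> (rename f t + rename ((+) p) (rename g r)) = t + r"
        if t: "t \<in> vecs P" and r: "r \<in> vecs ?Q" for t r
      proof -
        have \<sigma>: "inj_on \<sigma> {..<n}" "\<sigma> ` {..<n} = {..<n}"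
          using perm permutes_inj_on permutes_image by blast+
        have v: "t \<in> vecs {..<n}" "r \<in> vecs {..<n}"
          using t r fP vecs_mono[of t P "{..<n}"] vecs_mono[of r ?Q "{..<n}"] by auto
        have "rename f t = rename \<sigma> t" by (rule rename_cong[OF t]) (simp add: \<sigma>_def)
        moreover have "rename ((+) p) (rename g r) = rename ((+) p \<circ> g) r"
          by (rule rename_comp[OF gi(1) _ r]) simp
        moreover have "\<dots> = rename \<sigma> r" by (rule rename_cong[OF r]) (simp add: \<sigma>_def)
        ultimately have "rename f t + rename ((+) p) (rename g r) = rename \<sigma> (t + r)"
          using rename_add[OF \<sigma>(1) v] by simp
        moreover have "rename ?\<pi> (rename \<sigma> (t + r)) = rename (?\<pi> \<circ> \<sigma>) (t + r)"
          by (rule rename_comp[OF \<sigma>(1)]) (use v \<sigma>(2) perm' permutes_inj_on in \<open>auto\<close>)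
        moreover have "\<dots> = t + r"
          by (rule rename_id_on[of _ "{..<n}"]) (use v permutes_inverses[OF perm] in auto)
        ultimately show ?thesis by simp
      qed
      let ?S = "(A \<inter> vecs P) \<times> (A \<inter> vecs ?Q)"
      have "cart p (rename f ` (A \<inter> vecs P)) (rename g ` (A \<inter> vecs ?Q)) =
          (\<lambda>x. rename f (fst x) + rename ((+) p) (rename g (snd x))) ` ?S"
        by (force simp: cart_def image_def)
      then have "rename ?\<pi> ` cart p (rename f ` (A \<inter> vecs P)) (rename g ` (A \<inter> vecs ?Q)) =
          (\<lambda>x. rename ?\<pi> (rename f (fst x) + rename ((+) p) (rename g (snd x)))) ` ?S"
        by (simp only: image_image)
      also have "\<dots> = (\<lambda>x. fst x + snd x) ` ?S"
        by (rule image_cong[OF refl]) (use undo in auto)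
      also have "\<dots> = {t + r | t r. t \<in> A \<inter> vecs P \<and> r \<in> A \<inter> vecs ?Q}"
        by force
      also have "\<dots> = A" by (rule splits_sum[OF sA A fP(2), symmetric])
      finally show ?thesis by (rule sym)
    qed
    have "\<not> (\<exists>p q I1 J1 I2 J2 \<pi>. p \<ge> 1 \<and> q \<ge> 1 \<and> p + q = n \<and>
        complementing {..<p} I1 J1 \<and> complementing {..<q} I2 J2 \<and> \<pi> permutes {..<n} \<and>
        T = rename \<pi> ` cart p I1 I2 \<and> J = rename \<pi> ` cart p J1 J2)"
      using pr unfolding primitive_pair_def npair_iff_complementing by (rule conjunct2)
    then show False
      using pq c1 c2 perm' eq[OF subT conjunct1[OF s]] eq[OF subJ conjunct2[OF s]] by blast
  qed
qed

section \<open>Weighted trees\<close>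

lemma tops_subset: "tops V \<Gamma> \<subseteq> V"
  by (auto simp: tops_def)

lemma root_top:
  assumes "rooted_tree V \<Gamma> \<phi>" "\<phi> \<in> tops V \<Gamma>"
  shows "V = {\<phi>}"
proof -
  have n: "(\<phi>, y) \<notin> \<Gamma>" for y using assms(2) by (auto simp: tops_def offspring_def)
  have "v = \<phi>" if "v \<in> V" for v
  proof -
    have "(\<phi>, v) \<in> \<Gamma>\<^sup>*" using assms(1) that by (simp add: rooted_tree_def)
    then show ?thesis by (cases rule: converse_rtranclE) (use n in auto)
  qed
  then show ?thesis using assms(1) by (auto simp: rooted_tree_def)
qed

text \<open>Undoes the last generation step, so that an induction hypothesis about the smaller tree
  can be used. The nodes of X have no outgoing edges, so removing them leaves the paths to all other
  nodes intact.\<close>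

lemma prune:
  assumes w: "weighted_tree V \<Gamma> \<phi> w" and z: "z \<in> V - tops V \<Gamma>"
    and X: "X = offspring \<Gamma> z" "X \<subseteq> tops V \<Gamma>"
  shows "weighted_tree (V - X) (\<Gamma> - {z} \<times> X) \<phi> w"
    and "tops (V - X) (\<Gamma> - {z} \<times> X) = insert z (tops V \<Gamma> - X)"
    and "card X \<ge> 2" and "\<phi> \<notin> X"
proof -
  let ?V = "V - X" and ?\<Gamma> = "\<Gamma> - {z} \<times> X"
  have rt: "rooted_tree V \<Gamma> \<phi>" using w by (simp add: weighted_tree_def)
  have noX: "(x, y) \<notin> \<Gamma>" if "x \<in> X" for x y
    using that X(2) by (auto simp: tops_def offspring_def)
  have zX: "z \<notin> X" using z X by blast
  show c: "card X \<ge> 2" using w z X by (auto simp: weighted_tree_def)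
  show \<phi>X: "\<phi> \<notin> X" using rt X by (auto simp: rooted_tree_def offspring_def)
  have off: "offspring ?\<Gamma> v = (if v = z then {} else offspring \<Gamma> v)" for v
    using X by (auto simp: offspring_def)
  show t: "tops ?V ?\<Gamma> = insert z (tops V \<Gamma> - X)"
    using z zX by (auto simp: tops_def off)
  have "(\<phi>, v) \<in> ?\<Gamma>\<^sup>*" if "(\<phi>, v) \<in> \<Gamma>\<^sup>*" "v \<notin> X" for v
    using that
  proof (induction rule: rtrancl_induct)
    case (step u v)
    then have "u \<notin> X" "(u, v) \<in> ?\<Gamma>" using noX by blast+
    then show ?case using step by (meson rtrancl.rtrancl_into_rtrancl)
  qed simp
  moreover have "?\<Gamma> \<subseteq> ?V \<times> ?V"
  proof
    fix e assume e: "e \<in> ?\<Gamma>"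
    obtain u v where uv: "e = (u, v)" by (cases e)
    have "u \<in> V" "v \<in> V" using rt e uv by (auto simp: rooted_tree_def)
    moreover have "u \<notin> X" using noX e uv by auto
    moreover have "v \<notin> X"
    proof
      assume v: "v \<in> X"
      then have "(z, v) \<in> \<Gamma>" "v \<noteq> \<phi>" using X \<phi>X by (auto simp: offspring_def)
      then have "u = z" using rt e uv \<open>v \<in> V\<close> unfolding rooted_tree_def by blast
      then show False using e uv v by simp
    qed
    ultimately show "e \<in> ?V \<times> ?V" using uv by simp
  qed
  moreover have "\<exists>!u. (u, v) \<in> ?\<Gamma>" if "v \<in> ?V - {\<phi>}" for v
  proof -
    have "\<exists>!u. (u, v) \<in> \<Gamma>" using rt that by (auto simp: rooted_tree_def)
    then show ?thesis using that by auto
  qed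
  ultimately have "rooted_tree ?V ?\<Gamma> \<phi>"
    using rt \<phi>X unfolding rooted_tree_def by auto
  moreover have "\<And>v. v \<in> ?V - tops ?V ?\<Gamma> \<Longrightarrow> v \<in> V - tops V \<Gamma> \<and> v \<noteq> z" using t by auto
  moreover have "\<phi> \<notin> tops ?V ?\<Gamma> \<longrightarrow> \<phi> \<notin> tops V \<Gamma>" using t \<phi>X by auto
  ultimately show "weighted_tree ?V ?\<Gamma> \<phi> w"
    using w off unfolding weighted_tree_def by auto
qed

text \<open>Separates the bare root from larger trees. Two tops mean dimension at least two, where
  positivity at \<open>z\<close> follows from primitivity and not from the initial pair.\<close>

lemma generates_cases':
  assumes "generates \<phi> w V \<Gamma> T J" "weighted_tree V \<Gamma> \<phi> w"
  obtains "V = {\<phi>}" "T = rename (\<lambda>_. \<phi>) ` initT w" "J = rename (\<lambda>_. \<phi>) ` initJ w"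
  | X where "X \<subseteq> tops V \<Gamma>" "card X \<ge> 2"
  using assms(1)
proof cases
  case root
  then show ?thesis using that(1) by simp
next
  case (step z X T' J' N \<sigma>)
  have "card X \<ge> 2" using prune(3)[OF assms(2) step(1-3)] .
  then show ?thesis using that(2) step(3) by simp
qed

lemma finite_tops: "weighted_tree V \<Gamma> \<phi> w \<Longrightarrow> finite (tops V \<Gamma>)"
  using finite_subset[OF tops_subset] by (auto simp: weighted_tree_def rooted_tree_def)

lemma initial_positive:
  assumes A: "A \<subseteq> vecs {..<1::nat}" "0 \<in> A" "A \<noteq> {0}"
  shows "\<exists>u\<in>rename (\<lambda>_. z) ` A. entry u z > 0"
proof -
  obtain u where u: "u \<in> A" "u \<noteq> 0" using A by blast
  have "entry u 0 \<noteq> 0"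
  proof
    assume "entry u 0 = 0"
    then have "u = 0" using u A by (intro vecs_eqI[of u "{..<1}"]) auto
    then show False using u by simp
  qed
  moreover have "entry (rename (\<lambda>_. z) u) z = entry u 0"
    using entry_rename(1)[of "\<lambda>_. z" "{..<1::nat}" u 0] u A by (auto simp: inj_on_def)
  ultimately show ?thesis using u by (intro bexI[of _ "rename (\<lambda>_. z) u"]) simp_all
qed

text \<open>Each generation step is an instance of \<open>indecomposable_ge\<close>, once
  \<open>series_ge\<close> has turned the product formulas into \<open>gen\<close>. For the bare
  root, a one-element index set has no proper nonempty part.\<close>

lemma generates_indecomposable: "generates \<phi> w V \<Gamma> T J \<Longrightarrow> weighted_tree V \<Gamma> \<phi> w \<Longrightarrow> indecomposable (tops V \<Gamma>) T J"
proof (induction rule: generates.induct)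
  case root
  have t: "tops {\<phi>} {} = (\<lambda>_. \<phi>) ` {..<1::nat}" by (auto simp: tops_def offspring_def)
  have i: "inj_on (\<lambda>_. \<phi>) {..<1::nat}" by (simp add: inj_on_def)
  have "complementing {..<1} (initT w) (initJ w)"
    using root by (simp add: weighted_tree_def npair_iff_complementing)
  then have "indecomposable {..<1} (initT w) (initJ w)"
    by (auto simp: indecomposable_def lessThan_Suc)
  then show ?case unfolding t using indecomposable_rename i by blast
next
  case (step z V \<Gamma> X T' J' N \<sigma> T J)
  note pr = prune[OF step.prems step.hyps(1-3)]
  let ?I = "tops V \<Gamma>" and ?\<delta> = "delta w z"
  have p: "indecomposable (insert z (?I - X)) T' J'" using step.IH pr(1,2) by simp
  then interpret P: complementing "insert z (?I - X)" T' J' by (simp add: indecomposable_def)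
  have X: "X \<subseteq> ?I" "X \<noteq> {}" using step.hyps(3) pr(3) by auto
  have zI: "z \<notin> ?I" using step.hyps(1) by simp
  have iv: "interval_pair (N x) (fst (Phi w x), snd (Phi w x))" if "x \<in> X" for x
    using step.hyps(5) that by simp
  have a: "alpha w x > 0" if "x \<in> X" for x
  proof -
    have "x \<in> V - {\<phi>}" using that X(1) tops_subset[of V \<Gamma>] pr(4) by auto
    then show ?thesis using step.prems by (auto simp: weighted_tree_def Suc_le_eq)
  qed
  have \<delta>: "?\<delta> \<in> {0, 1}" using step.prems step.hyps(1) by (simp add: weighted_tree_def)
  then have \<delta>': "1 - ?\<delta> \<in> {0, 1}" by auto
  interpret G: merge ?I X z N "alpha w"
    using finite_tops[OF step.prems] X zI iv a interval_pairD(1) by unfold_locales blast+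
  have \<sigma>: "\<sigma> = G.subst_z" using step.hyps(6) by (simp add: G.subst_z_def)
  have "series T = series (G.ge (\<lambda>x. fst (Phi w x)) ?\<delta> T')"
    unfolding step.hyps(7) \<sigma>
    by (rule G.series_ge[OF _ P.subT \<delta>, symmetric]) (use iv interval_pairD(2) in blast)
  then have T: "T = G.ge (\<lambda>x. fst (Phi w x)) ?\<delta> T'" by (simp add: series_inject)
  have "series J = series (G.ge (\<lambda>x. snd (Phi w x)) (1 - ?\<delta>) J')"
    unfolding step.hyps(8) \<sigma>
    by (rule G.series_ge[OF _ P.subJ \<delta>', symmetric]) (use iv interval_pairD(3) in blast)
  then have J: "J = G.ge (\<lambda>x. snd (Phi w x)) (1 - ?\<delta>) J'" by (simp add: series_inject)
  \<comment> \<open>If the remaining tree is the bare root, the constraint on \<delta> excludes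
    \<open>{0}\<close> on the side that has to supply a nonzero vector. Otherwise
    \<open>indecomposable_positive\<close> supplies it.\<close>
  have pos: "(?\<delta> = 1 \<longrightarrow> (\<exists>j\<in>J'. entry j z > 0)) \<and> (?\<delta> = 0 \<longrightarrow> (\<exists>t\<in>T'. entry t z > 0))"
    using step.hyps(4) pr(1)
  proof (cases rule: generates_cases')
    case 1
    have "z \<in> V - X" using step.hyps(1) X by blast
    then have "z = \<phi>" using 1(1) by simp
    then have c: "initT w = {0} \<longrightarrow> ?\<delta> = 1" "initJ w = {0} \<longrightarrow> ?\<delta> = 0"
      using step.prems zI by (auto simp: weighted_tree_def)
    interpret I: complementing "{..<1}" "initT w" "initJ w"
      using step.prems by (simp add: weighted_tree_def npair_iff_complementing)
    have "\<exists>j\<in>J'. entry j z > 0" if "?\<delta> = 1"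
      unfolding 1(3) \<open>z = \<phi>\<close> using that c
      by (intro initial_positive[OF I.subJ I.zero(2)] notI) simp
    moreover have "\<exists>t\<in>T'. entry t z > 0" if "?\<delta> = 0"
      unfolding 1(2) \<open>z = \<phi>\<close> using that c
      by (intro initial_positive[OF I.subT I.zero(1)] notI) simp
    ultimately show ?thesis by blast
  next
    case (2 Y)
    have "insert z (?I - X) \<noteq> {z}"
    proof
      assume "insert z (?I - X) = {z}"
      then have "card Y \<le> card {z}" using 2(1) pr(2) by (intro card_mono) auto
      then show False using 2(2) by simp
    qed
    then have "\<exists>j\<in>J'. entry j z > 0" "\<exists>t\<in>T'. entry t z > 0"
      by (rule indecomposable_positive[OF p insertI1], rule indecomposable_positive[OF indecomposable_swap[OF p] insertI1])
    then show ?thesis by simp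
  qed
  show ?case
    unfolding T J by (rule G.indecomposable_ge[OF iv \<delta> p]) (use pos in simp_all)
qed

section \<open>Growing a tree by one generation, and building the tree of a primitive pair\<close>

lemma generates_cong:
  assumes "generates \<phi> w V \<Gamma> T J"
    and "initT w' = initT w" "initJ w' = initJ w"
    and "\<And>v. v \<in> V - tops V \<Gamma> \<Longrightarrow> delta w' v = delta w v"
    and "\<And>v. v \<in> V \<Longrightarrow> alpha w' v = alpha w v" "\<And>v. v \<in> V \<Longrightarrow> Phi w' v = Phi w v"
  shows "generates \<phi> w' V \<Gamma> T J"
  using assms
proof (induction rule: generates.induct)
  case root
  then show ?case using generates.root[of \<phi> w'] by simp
next
  case (step z V \<Gamma> X T' J' N \<sigma> T J)
  have XV: "x \<in> V" if "x \<in> X" for x using that step.hyps(3) tops_subset[of V \<Gamma>] by (meson subsetD)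
  have "v \<in> V - tops V \<Gamma>" if "v \<in> V - X - tops (V - X) (\<Gamma> - {z} \<times> X)" for v
    using that by (auto simp: tops_def offspring_def)
  then have g: "generates \<phi> w' (V - X) (\<Gamma> - {z} \<times> X) T' J'" using step by simp
  have P: "Phi w' x = Phi w x" "alpha w' x = alpha w x" if "x \<in> X" for x
    using step.prems XV[OF that] by auto
  have d: "delta w' z = delta w z" using step by simp
  have L: "Lset X (alpha w') = Lset X (alpha w)" using P by (simp add: Lset_def cong: sum.cong)
  have s: "(\<Sum>x\<in>X. unit_vec x (alpha w' x * N x)) = (\<Sum>x\<in>X. unit_vec x (alpha w x * N x))"
    using P by (intro sum.cong) simp_all
  have p: "(\<Prod>x\<in>X. series1 (fst (Phi w' x)) x) = (\<Prod>x\<in>X. series1 (fst (Phi w x)) x)"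
    "(\<Prod>x\<in>X. series1 (snd (Phi w' x)) x) = (\<Prod>x\<in>X. series1 (snd (Phi w x)) x)"
    using P by (simp_all cong: prod.cong)
  have "\<forall>x\<in>X. interval_pair (N x) (Phi w' x)" using step.hyps(5) P by simp
  then show ?case
    by (rule generates.step[OF step.hyps(1-3) g _ step.hyps(6)[folded s]
      step.hyps(7)[folded p d L] step.hyps(8)[folded p d L]])
qed

text \<open>The inverse of \<open>prune\<close>. The constraint on \<delta> at the root is a new
  condition only when the growing top is the root itself; otherwise it is inherited.\<close>

lemma graft:
  assumes w: "weighted_tree V \<Gamma> \<phi> w" and z: "z \<in> tops V \<Gamma>" and X: "X \<inter> V = {}" "finite X" "card X \<ge> 2"
    and \<delta>: "\<delta> \<in> {0, 1}" and a: "\<And>x. x \<in> X \<Longrightarrow> a x > 0"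
    and iv: "\<And>x. x \<in> X \<Longrightarrow> \<exists>N. interval_pair N (F x)"
    and rootc: "z = \<phi> \<Longrightarrow> (initT w = {0} \<longrightarrow> \<delta> = 1) \<and> (initJ w = {0} \<longrightarrow> \<delta> = 0)"
    and w': "w' = w\<lparr>delta := (delta w)(z := \<delta>), alpha := (\<lambda>v. if v \<in> X then a v else alpha w v),
      Phi := (\<lambda>v. if v \<in> X then F v else Phi w v)\<rparr>"
  shows "weighted_tree (V \<union> X) (\<Gamma> \<union> {z} \<times> X) \<phi> w'"
    and "tops (V \<union> X) (\<Gamma> \<union> {z} \<times> X) = (tops V \<Gamma> - {z}) \<union> X"
    and "offspring (\<Gamma> \<union> {z} \<times> X) z = X"
proof -
  let ?V = "V \<union> X" and ?\<Gamma> = "\<Gamma> \<union> {z} \<times> X"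
  have rt: "rooted_tree V \<Gamma> \<phi>"
    and wc: "\<forall>v\<in>V - tops V \<Gamma>. card (offspring \<Gamma> v) \<ge> 2" "\<forall>v\<in>V - tops V \<Gamma>. delta w v \<in> {0, 1}"
    and wa: "\<forall>v\<in>V - {\<phi>}. alpha w v \<ge> 1" and wp: "\<forall>v\<in>V - {\<phi>}. \<exists>N. interval_pair N (Phi w v)"
    using w unfolding weighted_tree_def by simp_all
  then have GV: "\<Gamma> \<subseteq> V \<times> V" and \<phi>: "\<phi> \<in> V" by (auto simp: rooted_tree_def)
  have zV: "z \<in> V" and nz: "offspring \<Gamma> z = {}" using z by (auto simp: tops_def)
  have X0: "X \<noteq> {}" using X by auto
  have off: "offspring ?\<Gamma> v = (if v = z then X else offspring \<Gamma> v)" for v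
    using nz by (auto simp: offspring_def)
  show "offspring ?\<Gamma> z = X" by (simp add: off)
  have offX: "offspring \<Gamma> x = {}" if "x \<in> X" for x using that GV X by (auto simp: offspring_def)
  show t: "tops ?V ?\<Gamma> = (tops V \<Gamma> - {z}) \<union> X"
    using X0 X(1) zV offX by (auto simp: tops_def off)
  have reach: "(\<phi>, v) \<in> ?\<Gamma>\<^sup>*" if "v \<in> V" for v
  proof -
    have "(\<phi>, v) \<in> \<Gamma>\<^sup>*" using rt that by (simp add: rooted_tree_def)
    then show ?thesis using rtrancl_mono[of \<Gamma> ?\<Gamma>] by blast
  qed
  have "(\<phi>, v) \<in> ?\<Gamma>\<^sup>*" if "v \<in> ?V" for v
  proof (cases "v \<in> V")
    case False
    then have "(z, v) \<in> ?\<Gamma>" using that by simp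
    then show ?thesis using reach[OF zV] by (rule rtrancl_into_rtrancl[rotated])
  qed (rule reach)
  moreover have "\<exists>!u. (u, v) \<in> ?\<Gamma>" if "v \<in> ?V - {\<phi>}" for v
  proof (cases "v \<in> X")
    case True
    then show ?thesis using GV X(1) by (intro ex1I[of _ z]) auto
  next
    case False
    then have "\<exists>!u. (u, v) \<in> \<Gamma>" using rt that by (auto simp: rooted_tree_def)
    then show ?thesis using False by auto
  qed
  moreover have "finite ?V" "?\<Gamma> \<subseteq> ?V \<times> ?V" "\<forall>u. (u, \<phi>) \<notin> ?\<Gamma>"
    using rt GV X zV \<phi> by (auto simp: rooted_tree_def)
  ultimately have "rooted_tree ?V ?\<Gamma> \<phi>"
    using \<phi> by (simp add: rooted_tree_def)
  moreover have nt: "v = z \<or> v \<in> V - tops V \<Gamma>" "v \<notin> X" if "v \<in> ?V - tops ?V ?\<Gamma>" for v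
    using that t by auto
  moreover have "card (offspring ?\<Gamma> v) \<ge> 2" if "v \<in> ?V - tops ?V ?\<Gamma>" for v
    using nt(1)[OF that] wc(1) X(3) by (cases "v = z") (simp_all add: off)
  moreover have "delta w' v \<in> {0, 1}" if "v \<in> ?V - tops ?V ?\<Gamma>" for v
  proof (cases "v = z")
    case False
    then show ?thesis using wc(2) nt(1)[OF that] by (simp add: w')
  qed (use \<delta> in \<open>simp add: w'\<close>)
  moreover have "alpha w' v \<ge> 1" if "v \<in> ?V - {\<phi>}" for v
    using that wa a by (cases "v \<in> X") (simp_all add: w' Suc_le_eq)
  moreover have "\<exists>N. interval_pair N (Phi w' v)" if "v \<in> ?V - {\<phi>}" for v
    using that wp iv by (cases "v \<in> X") (simp_all add: w')
  moreover have "(initT w' = {0} \<longrightarrow> delta w' \<phi> = 1) \<and> (initJ w' = {0} \<longrightarrow> delta w' \<phi> = 0)"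
    if "\<phi> \<notin> tops ?V ?\<Gamma>"
  proof (cases "z = \<phi>")
    case True
    then show ?thesis using rootc by (simp add: w')
  next
    case False
    then have "\<phi> \<notin> tops V \<Gamma>" using that t by auto
    then show ?thesis using False w by (simp add: w' weighted_tree_def)
  qed
  moreover have "npair 1 (initT w') (initJ w')" using w by (simp add: w' weighted_tree_def)
  ultimately show "weighted_tree ?V ?\<Gamma> \<phi> w'"
    unfolding weighted_tree_def by blast
qed

text \<open>S collects forbidden nodes. The coordinates X are removed before the recursive call and
  attached to the resulting tree afterwards, so they must not occur in that tree; the induction
  therefore runs over all finite S.\<close>

lemma indecomposable_generated:
  fixes I S :: "nat set"
  assumes "indecomposable I T J" "I \<noteq> {}" "finite S" "S \<inter> I = {}"
  shows "\<exists>V \<Gamma> \<phi> w. weighted_tree V \<Gamma> \<phi> w \<and> tops V \<Gamma> = I \<and> V \<inter> S = {} \<and> generates \<phi> w V \<Gamma> T J"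
  using assms
proof (induction "card I" arbitrary: I S T J rule: less_induct)
  case less
  interpret complementing I T J using less.prems(1) by (simp add: indecomposable_def)
  have "card I \<ge> 1" using less.prems(2) fin by (simp add: Suc_le_eq card_gt_0_iff)
  then consider "card I = 1" | "card I \<ge> 2" by linarith
  then show ?case
  proof cases
    case 1
    then obtain \<phi> where I: "I = {\<phi>}" by (auto simp: card_1_singleton_iff)
    \<comment> \<open>A bare root is described by its initial pair; the other fields are defaults,
      overwritten by \<open>graft\<close> where the tree grows.\<close>
    define w :: "nat weight" where "w = \<lparr>initT = rename (\<lambda>_. 0) ` T, initJ = rename (\<lambda>_. 0) ` J,
      delta = (\<lambda>_. 0), alpha = (\<lambda>_. 1), Phi = (\<lambda>_. ({}, {}))\<rparr>"
    have t: "tops {\<phi>} {} = {\<phi>}" by (auto simp: tops_def offspring_def)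
    have i: "inj_on (\<lambda>_. 0::nat) I" "(\<lambda>_. 0) ` I = {..<1::nat}" by (auto simp: I)
    have "complementing {..<1} (initT w) (initJ w)"
      using complementing_rename[OF _ i(1), of T J] i(2) complementing_axioms by (simp add: w_def)
    then have "weighted_tree {\<phi>} {} \<phi> w"
      using t by (simp add: weighted_tree_def rooted_tree_def npair_iff_complementing)
    moreover have "rename (\<lambda>_. \<phi>) (rename (\<lambda>_. 0::nat) u) = u" if "u \<in> vecs I" for u
    proof -
      have "rename (\<lambda>_. \<phi>) (rename (\<lambda>_. 0::nat) u) = rename ((\<lambda>_. \<phi>) \<circ> (\<lambda>_. 0::nat)) u"
        by (rule rename_comp[OF i(1) _ that]) (simp add: I)
      also have "\<dots> = u" by (rule rename_id_on[OF that]) (simp add: I)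
      finally show ?thesis .
    qed
    then have "rename (\<lambda>_. \<phi>) ` initT w = T" "rename (\<lambda>_. \<phi>) ` initJ w = J"
      using subT subJ by (force simp: w_def image_image subset_iff)+
    then have "generates \<phi> w {\<phi>} {} T J" using generates.root[of \<phi> w] by simp
    ultimately show ?thesis using t I less.prems(4) by blast
  next
    case 2
    obtain z where z: "z \<notin> I \<union> S" using ex_new_if_finite[of "I \<union> S"] fin less.prems(3) by auto
    then have zI: "z \<notin> I" by simp
    obtain \<delta> where \<delta>: "\<delta> \<in> {0, 1}" and "decomposes I z \<delta> T J"
      using indecomposable_decompose[OF less.prems(1) 2 zI] by blast
    from this(2) show ?thesis
    proof cases
      case d: (decomposesI X a N C D T' J')
      have finX: "finite X" using d(1) fin finite_subset by blast
      have X0: "X \<noteq> {}" using d(2) by auto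
      let ?I = "insert z (I - X)"
      \<comment> \<open>One coordinate replaces X, so the number drops by \<open>card X - 1\<close>,
        which is positive.\<close>
      have "card ?I < card I"
        using zI fin d(1,2) finX card_mono[OF fin d(1)] by (simp add: card_Diff_subset)
      moreover have "finite (S \<union> X)" "(S \<union> X) \<inter> ?I = {}"
        using finX less.prems(3,4) z d(1) by auto
      ultimately obtain V \<Gamma> \<phi> w where V: "weighted_tree V \<Gamma> \<phi> w" "tops V \<Gamma> = ?I" "V \<inter> (S \<union> X) = {}"
        "generates \<phi> w V \<Gamma> T' J'"
        using less.hyps[of ?I T' J' "S \<union> X"] d(5) by blast
      define F where "F x = (C x, D x)" for x
      define w' where "w' = w\<lparr>delta := (delta w)(z := \<delta>), alpha := (\<lambda>v. if v \<in> X then a v else alpha w v),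
        Phi := (\<lambda>v. if v \<in> X then F v else Phi w v)\<rparr>"
      have zt: "z \<in> tops V \<Gamma>" using V by simp
      have XV: "X \<inter> V = {}" using V(3) by blast
      \<comment> \<open>If \<open>z\<close> is the root, the smaller tree is the bare root, and an
        initial set \<open>{0}\<close> has no element with positive entry. The positivity clauses of
        \<open>decomposes\<close> then rule out the wrong value of \<delta>.\<close>
      have rootc: "(initT w = {0} \<longrightarrow> \<delta> = 1) \<and> (initJ w = {0} \<longrightarrow> \<delta> = 0)" if "z = \<phi>"
      proof -
        have V1: "V = {\<phi>}" using root_top[of V \<Gamma> \<phi>] V(1) zt that by (simp add: weighted_tree_def)
        from V(4,1) show ?thesis
        proof (cases rule: generates_cases')
          case 1
          have r0: "rename (\<lambda>_. \<phi>) (0 :: nat \<Rightarrow>\<^sub>0 nat) = 0" by (simp add: rename_def expo_subst_def)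
          have "\<delta> \<noteq> 0" if "initT w = {0}"
          proof
            assume "\<delta> = 0"
            moreover have "T' = {0}" using 1(2) that r0 by simp
            ultimately show False using d(9) by simp
          qed
          moreover have "\<delta> \<noteq> 1" if "initJ w = {0}"
          proof
            assume "\<delta> = 1"
            moreover have "J' = {0}" using 1(3) that r0 by simp
            ultimately show False using d(8) by simp
          qed
          ultimately show ?thesis using \<delta> by blast
        next
          case (2 Y)
          then have "Y \<subseteq> {\<phi>}" using subset_trans[OF 2(1) tops_subset] V1 by simp
          then have "card Y \<le> 1" using card_mono[of "{\<phi>}" Y] by simp
          then show ?thesis using 2 by simp
        qed
      qed
      have iv: "\<exists>N. interval_pair N (F x)" if "x \<in> X" for x using d(4)[OF that] by (auto simp: F_def)
      let ?V = "V \<union> X" and ?\<Gamma> = "\<Gamma> \<union> {z} \<times> X"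
      have gr: "weighted_tree ?V ?\<Gamma> \<phi> w'" "tops ?V ?\<Gamma> = (tops V \<Gamma> - {z}) \<union> X" "offspring ?\<Gamma> z = X"
        by (rule graft[OF V(1) zt XV finX d(2) \<delta> d(3) iv rootc w'_def]; assumption)+
      have top: "tops ?V ?\<Gamma> = I" unfolding gr(2) V(2) using zI d(1) by auto
      interpret G: merge I X z N a
        using fin d(1) X0 zI d(3) interval_pairD(1)[OF d(4)] by unfold_locales
      interpret P: complementing ?I T' J' using d(5) by (simp add: indecomposable_def)
      have GV: "\<Gamma> \<subseteq> V \<times> V" using V(1) by (simp add: weighted_tree_def rooted_tree_def)
      have "?V - X = V" "?\<Gamma> - {z} \<times> X = \<Gamma>" using XV GV by auto
      \<comment> \<open>The two weights differ only in \<delta> at \<open>z\<close>, which is a top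
        of the smaller tree, and in \<alpha> and \<Phi> on X, which is disjoint from V.\<close>
      moreover have "generates \<phi> w' V \<Gamma> T' J'"
        using V(4) by (rule generates_cong) (use zt XV in \<open>auto simp: w'_def\<close>)
      ultimately have g: "generates \<phi> w' (?V - X) (?\<Gamma> - {z} \<times> X) T' J'" by simp
      have w'X: "alpha w' x = a x" "Phi w' x = (C x, D x)" if "x \<in> X" for x
        using that by (simp_all add: w'_def F_def)
      have dz: "delta w' z = \<delta>" by (simp add: w'_def)
      have L: "Lset X (alpha w') = Lset X a" using w'X by (simp add: Lset_def cong: sum.cong)
      have s: "G.subst_z = (\<lambda>y. if y = z then \<Sum>x\<in>X. unit_vec x (alpha w' x * N x) else unit_vec y 1)"
        using w'X by (auto simp: G.subst_z_def cong: sum.cong)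
      have p: "(\<Prod>x\<in>X. series1 (fst (Phi w' x)) x) = (\<Prod>x\<in>X. series1 (C x) x)"
        "(\<Prod>x\<in>X. series1 (snd (Phi w' x)) x) = (\<Prod>x\<in>X. series1 (D x) x)"
        using w'X by (simp_all cong: prod.cong)
      have \<delta>': "1 - \<delta> \<in> {0, 1}" using \<delta> by auto
      have "generates \<phi> w' ?V ?\<Gamma> T J"
      proof (rule generates.step[OF _ gr(3)[symmetric] _ g _ s])
        show "z \<in> ?V - tops ?V ?\<Gamma>" using top zI subsetD[OF tops_subset zt] by simp
        show "X \<subseteq> tops ?V ?\<Gamma>" using top d(1) by simp
        show "\<forall>x\<in>X. interval_pair (N x) (Phi w' x)" using d(4) w'X by simp
        show "series T = (\<Prod>x\<in>X. series1 (fst (Phi w' x)) x) *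
            mps_subst (\<lambda>x. unit_vec x (N x)) (series (Lset X (alpha w')) ^ delta w' z) *
            mps_subst G.subst_z (series T')"
          unfolding p L dz d(6)
          by (rule G.series_ge[OF interval_pairD(2)[OF d(4)] P.subT \<delta>])
        show "series J = (\<Prod>x\<in>X. series1 (snd (Phi w' x)) x) *
            mps_subst (\<lambda>x. unit_vec x (N x)) (series (Lset X (alpha w')) ^ (1 - delta w' z)) *
            mps_subst G.subst_z (series J')"
          unfolding p L dz d(7)
          by (rule G.series_ge[OF interval_pairD(3)[OF d(4)] P.subJ \<delta>'])
      qed
      moreover have "?V \<inter> S = {}" using V(3) d(1) less.prems(4) by blast
      ultimately show ?thesis using gr(1) top by blast
    qed
  qed
qed

theorem theorem1p2:
  fixes n :: nat and T J :: "(nat \<Rightarrow>\<^sub>0 nat) set"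
  assumes "n \<ge> 1" and "nstar_pair T J"
  shows "primitive_pair n T J \<longleftrightarrow> tree_generated n T J"
proof
  assume "primitive_pair n T J"
  then have p: "indecomposable {..<n} T J" by (simp add: primitive_pair_iff_indecomposable)
  have "{..<n} \<noteq> {}" using assms(1) by (simp add: lessThan_empty_iff)
  then obtain V \<Gamma> \<phi> w where V: "weighted_tree V \<Gamma> \<phi> w" "tops V \<Gamma> = {..<n}" "generates \<phi> w V \<Gamma> T J"
    using indecomposable_generated[OF p, of "{}"] by auto
  \<comment> \<open>The tops of the constructed tree are the coordinates themselves, so the identity
    enumerates them.\<close>
  have "rename id = (id :: (nat \<Rightarrow>\<^sub>0 nat) \<Rightarrow> _)"
    using rename_id_on[of _ UNIV id] by (intro ext) (simp add: vecs_def)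
  moreover have "bij_betw id (tops V \<Gamma>) {..<n}" using V(2) by simp
  ultimately have "weighted_tree V \<Gamma> \<phi> w \<and> card (tops V \<Gamma>) = n \<and> generates \<phi> w V \<Gamma> T J \<and>
      bij_betw id (tops V \<Gamma>) {..<n} \<and> T = rename id ` T \<and> J = rename id ` J"
    using V by simp
  then show "tree_generated n T J" unfolding tree_generated_def by (intro exI)
next
  assume "tree_generated n T J"
  then obtain V :: "nat set" and \<Gamma> \<phi> w T' J' e where h: "weighted_tree V \<Gamma> \<phi> w" "generates \<phi> w V \<Gamma> T' J'"
    "bij_betw e (tops V \<Gamma>) {..<n}" "T = rename e ` T'" "J = rename e ` J'"
    unfolding tree_generated_def by blast
  have "indecomposable (e ` tops V \<Gamma>) T J"
    unfolding h(4,5) using generates_indecomposable[OF h(2,1)] h(3) by (intro indecomposable_rename) (auto simp: bij_betw_def)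
  then show "primitive_pair n T J"
    using h(3) by (simp add: primitive_pair_iff_indecomposable bij_betw_def)
qed

end
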